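(* Let $A$ be a commutative $C^\ast$-algebra with Banach space dual $A^\ast$, and let $\mathscr{M}$ be a commutative von Neumann algebra with predual $\mathscr{M}_\ast$. Then the additive group of $A^\ast$, equipped with the topology $\tau_k(A)$ of uniform convergence on compact subsets of $A$, and the additive group of $\mathscr{M}_\ast$, equipped with the topology $\tau_k(\mathscr{M})$ of uniform convergence on compact subsets of $\mathscr{M}$, are both unitarily representable.
   Context: A topological group is called unitarily representable if it is topologically isomorphic to a subgroup of the unitary group $\mathcal{U}(\mathbb{H})$ of some Hilbert space $\mathbb{H}$ (of arbitrary dimension), where $\mathcal{U}(\mathbb{H})$ carries the strong operator topology. Compact subsets of $A$ and $\mathscr{M}$ are taken with respect to the norm topology; elements of $\mathscr{M}_\ast$ are regarded as functionals on $\mathscr{M}$. *)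

theory Defs
  imports "HOL-Analysis.Analysis" "HOL-Algebra.Coset"
begin

section \<open>Complex normed spaces, C*-algebras and Hilbert spaces as type classes\<close>

class scaleC =
  fixes scaleC :: "complex \<Rightarrow> 'a \<Rightarrow> 'a"  (infixr \<open>*\<^sub>C\<close> 75)

class complex_normed_space = real_normed_vector + scaleC +
  assumes scaleC_add_right: "a *\<^sub>C (x + y) = a *\<^sub>C x + a *\<^sub>C y"
    and scaleC_add_left: "(a + b) *\<^sub>C x = a *\<^sub>C x + b *\<^sub>C x"
    and scaleC_scaleC: "a *\<^sub>C b *\<^sub>C x = (a * b) *\<^sub>C x"
    and scaleR_eq_scaleC: "r *\<^sub>R x = complex_of_real r *\<^sub>C x"
    and norm_scaleC: "norm (a *\<^sub>C x) = cmod a * norm x"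

lemma scaleC_one: "1 *\<^sub>C x = (x :: 'a::complex_normed_space)"
  using scaleR_eq_scaleC[of 1 x] by simp

text \<open>No unit is required, and the zero algebra is allowed.\<close>

class cstar_algebra = complex_normed_space + real_normed_algebra + banach +
  fixes star :: "'a \<Rightarrow> 'a"
  assumes scaleC_mult_left: "(a *\<^sub>C x) * y = a *\<^sub>C (x * y)"
    and scaleC_mult_right: "x * (a *\<^sub>C y) = a *\<^sub>C (x * y)"
    and star_star: "star (star x) = x"
    and star_add: "star (x + y) = star x + star y"
    and star_scaleC: "star (a *\<^sub>C x) = cnj a *\<^sub>C star x"
    and star_mult: "star (x * y) = star y * star x"
    and cstar_identity: "norm (star x * x) = (norm x)\<^sup>2"

class comm_cstar_algebra = cstar_algebra + comm_ring

text \<open>The inner product is linear in its first argument.\<close>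

class chilbert_space = complex_normed_space + banach +
  fixes cinner :: "'a \<Rightarrow> 'a \<Rightarrow> complex"
  assumes cinner_add_left: "cinner (x + y) z = cinner x z + cinner y z"
    and cinner_scaleC_left: "cinner (a *\<^sub>C x) y = a * cinner x y"
    and cinner_commute: "cinner y x = cnj (cinner x y)"
    and cinner_self: "cinner x x = complex_of_real ((norm x)\<^sup>2)"


section \<open>Duals and the topology of uniform convergence on compact sets\<close>

definition clinear_on :: "'a::complex_normed_space set \<Rightarrow> ('a \<Rightarrow> complex) \<Rightarrow> bool" where
  "clinear_on A \<phi> \<longleftrightarrow>
     (\<forall>x\<in>A. \<forall>y\<in>A. \<phi> (x + y) = \<phi> x + \<phi> y) \<and> (\<forall>c. \<forall>x\<in>A. \<phi> (c *\<^sub>C x) = c * \<phi> x)"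

definition cdual :: "('a::complex_normed_space \<Rightarrow> complex) set" where
  "cdual = {\<phi>. clinear_on UNIV \<phi> \<and> (\<exists>B. \<forall>x. cmod (\<phi> x) \<le> B * norm x)}"

text \<open>A functional on a subspace \<open>A\<close> is represented by a function in \<^term>\<open>extensional A\<close>.\<close>

definition additive_group :: "'a set \<Rightarrow> ('a \<Rightarrow> complex) set \<Rightarrow> ('a \<Rightarrow> complex) monoid" where
  "additive_group A F =
     \<lparr>carrier = F, mult = (\<lambda>\<phi> \<psi>. \<lambda>x\<in>A. \<phi> x + \<psi> x), one = (\<lambda>x\<in>A. 0)\<rparr>"

definition tau_k :: "'a::topological_space set \<Rightarrow> ('a \<Rightarrow> complex) set \<Rightarrow> ('a \<Rightarrow> complex) topology" where
  "tau_k A F = topology (\<lambda>U. U \<subseteq> F \<and>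
     (\<forall>\<phi>\<in>U. \<exists>K \<epsilon>. compact K \<and> K \<subseteq> A \<and> \<epsilon> > 0 \<and> {\<psi>\<in>F. \<forall>x\<in>K. cmod (\<psi> x - \<phi> x) < \<epsilon>} \<subseteq> U))"

lemma openin_tau_k:
  "openin (tau_k A F) U \<longleftrightarrow> U \<subseteq> F \<and>
     (\<forall>\<phi>\<in>U. \<exists>K \<epsilon>. compact K \<and> K \<subseteq> A \<and> \<epsilon> > 0 \<and> {\<psi>\<in>F. \<forall>x\<in>K. cmod (\<psi> x - \<phi> x) < \<epsilon>} \<subseteq> U)"
proof -
  let ?N = "\<lambda>K \<epsilon> \<phi>. {\<psi>\<in>F. \<forall>x\<in>K. cmod (\<psi> x - \<phi> x) < \<epsilon>}"
  let ?P = "\<lambda>U. U \<subseteq> F \<and> (\<forall>\<phi>\<in>U. \<exists>K \<epsilon>. compact K \<and> K \<subseteq> A \<and> \<epsilon> > 0 \<and> ?N K \<epsilon> \<phi> \<subseteq> U)"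
  have inter: "?P (S \<inter> T)" if S: "?P S" and T: "?P T" for S T
  proof (intro conjI ballI)
    show "S \<inter> T \<subseteq> F" using S by blast
  next
    fix \<phi> assume "\<phi> \<in> S \<inter> T"
    then obtain K \<epsilon> L \<delta> where *: "compact K" "K \<subseteq> A" "\<epsilon> > 0" "?N K \<epsilon> \<phi> \<subseteq> S"
      "compact L" "L \<subseteq> A" "\<delta> > 0" "?N L \<delta> \<phi> \<subseteq> T"
      using conjunct2[OF S, rule_format, of \<phi>] conjunct2[OF T, rule_format, of \<phi>] by auto
    have "?N (K \<union> L) (min \<epsilon> \<delta>) \<phi> \<subseteq> ?N K \<epsilon> \<phi> \<inter> ?N L \<delta> \<phi>" by auto
    then have "?N (K \<union> L) (min \<epsilon> \<delta>) \<phi> \<subseteq> S \<inter> T"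
      by (rule order_trans) (rule Int_mono[OF *(4,8)])
    moreover have "compact (K \<union> L)" "K \<union> L \<subseteq> A" "min \<epsilon> \<delta> > 0"
      using * by (auto intro: compact_Un)
    ultimately show "\<exists>K \<epsilon>. compact K \<and> K \<subseteq> A \<and> \<epsilon> > 0 \<and> ?N K \<epsilon> \<phi> \<subseteq> S \<inter> T"
      by (intro exI[of _ "K \<union> L"] exI[of _ "min \<epsilon> \<delta>"]) simp
  qed
  have union: "?P (\<Union>\<K>)" if \<K>: "\<forall>S\<in>\<K>. ?P S" for \<K>
  proof (intro conjI ballI)
    show "\<Union>\<K> \<subseteq> F" using \<K> by blast
  next
    fix \<phi> assume "\<phi> \<in> \<Union>\<K>"
    then obtain S where S: "S \<in> \<K>" "\<phi> \<in> S" by blast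
    then obtain K \<epsilon> where *: "compact K" "K \<subseteq> A" "\<epsilon> > 0" "?N K \<epsilon> \<phi> \<subseteq> S"
      using conjunct2[OF bspec[OF \<K> S(1)], rule_format, OF S(2)] by auto
    have "S \<subseteq> \<Union>\<K>" using S by blast
    with * show "\<exists>K \<epsilon>. compact K \<and> K \<subseteq> A \<and> \<epsilon> > 0 \<and> ?N K \<epsilon> \<phi> \<subseteq> \<Union>\<K>"
      by (intro exI[of _ K] exI[of _ \<epsilon>]) simp
  qed
  have "istopology ?P"
    unfolding istopology_def
    by (rule conjI, intro allI impI, erule (1) inter, intro allI impI, erule union)
  then show ?thesis
    unfolding tau_k_def by (simp add: topology_inverse')
qed

lemma topspace_tau_k [simp]: "topspace (tau_k A F) = F"
proof -
  have "openin (tau_k A F) F"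
    unfolding openin_tau_k by (auto intro!: exI[of _ "{}"] exI[of _ "1::real"])
  then show ?thesis
    by (meson openin_subset openin_tau_k openin_topspace subset_antisym)
qed


section \<open>Von Neumann algebras and their preduals\<close>

lemma bounded_linear_scaleC: "bounded_linear (\<lambda>x::'a::complex_normed_space. c *\<^sub>C x)"
  by (rule bounded_linear_intro[of _ "cmod c"])
    (auto simp: scaleC_add_right norm_scaleC scaleR_eq_scaleC scaleC_scaleC mult.commute)

instantiation blinfun :: (real_normed_vector, complex_normed_space) complex_normed_space
begin

lift_definition scaleC_blinfun :: "complex \<Rightarrow> ('a \<Rightarrow>\<^sub>L 'b) \<Rightarrow> ('a \<Rightarrow>\<^sub>L 'b)" is "\<lambda>c f x. c *\<^sub>C f x"
  by (rule bounded_linear_compose[OF bounded_linear_scaleC])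

instance
proof
  fix a b :: complex and r :: real and x y :: "'a \<Rightarrow>\<^sub>L 'b"
  show "a *\<^sub>C (x + y) = a *\<^sub>C x + a *\<^sub>C y"
    by transfer (simp add: scaleC_add_right)
  show "(a + b) *\<^sub>C x = a *\<^sub>C x + b *\<^sub>C x"
    by transfer (simp add: scaleC_add_left)
  show "a *\<^sub>C b *\<^sub>C x = (a * b) *\<^sub>C x"
    by transfer (simp add: scaleC_scaleC)
  show "r *\<^sub>R x = complex_of_real r *\<^sub>C x"
    by transfer (simp add: scaleR_eq_scaleC)
  have le: "norm (a *\<^sub>C x) \<le> cmod a * norm x" for a and x :: "'a \<Rightarrow>\<^sub>L 'b"
  proof (rule norm_blinfun_bound)
    fix v
    have "norm (blinfun_apply (a *\<^sub>C x) v) = cmod a * norm (blinfun_apply x v)"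
      by (simp add: scaleC_blinfun.rep_eq norm_scaleC)
    also have "\<dots> \<le> cmod a * norm x * norm v"
      by (simp add: mult.assoc mult_left_mono norm_blinfun)
    finally show "norm (blinfun_apply (a *\<^sub>C x) v) \<le> cmod a * norm x * norm v" .
  qed simp
  show "norm (a *\<^sub>C x) = cmod a * norm x"
  proof (cases "a = 0")
    case True
    then show ?thesis using le[of a x] by simp
  next
    case False
    have one: "1 *\<^sub>C x = x"
      by transfer (simp add: scaleC_one)
    have "inverse a *\<^sub>C a *\<^sub>C x = (inverse a * a) *\<^sub>C x"
      by transfer (simp add: scaleC_scaleC)
    then have "inverse a *\<^sub>C a *\<^sub>C x = x"
      using False one by simp
    then have "norm x \<le> cmod (inverse a) * norm (a *\<^sub>C x)"
      using le[of "inverse a" "a *\<^sub>C x"] by metis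
    then have "cmod a * norm x \<le> cmod a * (cmod (inverse a) * norm (a *\<^sub>C x))"
      by (rule mult_left_mono) simp
    also have "\<dots> = norm (a *\<^sub>C x)"
      using False by (simp add: norm_inverse)
    finally have "cmod a * norm x \<le> norm (a *\<^sub>C x)" .
    then show ?thesis using le[of a x] by simp
  qed
qed

end

text \<open>
  The type of bounded operators in the library consists of the bounded \<^emph>\<open>real\<close>-linear maps, with
  the operator norm.
\<close>

definition bounded_operators :: "('h::chilbert_space \<Rightarrow>\<^sub>L 'h) set" where
  "bounded_operators = {T. \<forall>c x. blinfun_apply T (c *\<^sub>C x) = c *\<^sub>C blinfun_apply T x}"

definition is_adjoint :: "('h::chilbert_space \<Rightarrow>\<^sub>L 'h) \<Rightarrow> ('h \<Rightarrow>\<^sub>L 'h) \<Rightarrow> bool" where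
  "is_adjoint S T \<longleftrightarrow> (\<forall>x y. cinner (blinfun_apply T x) y = cinner x (blinfun_apply S y))"

definition von_neumann_algebra :: "('h::chilbert_space \<Rightarrow>\<^sub>L 'h) set \<Rightarrow> bool" where
  "von_neumann_algebra M \<longleftrightarrow>
     M \<subseteq> bounded_operators \<and> id_blinfun \<in> M \<and>
     (\<forall>S\<in>M. \<forall>T\<in>M. S + T \<in> M \<and> S o\<^sub>L T \<in> M) \<and>
     (\<forall>c. \<forall>T\<in>M. c *\<^sub>C T \<in> M) \<and>
     (\<forall>T\<in>M. \<exists>S\<in>M. is_adjoint S T) \<and>
     closedin strong_operator_topology M"

definition commutative_operators :: "('h::chilbert_space \<Rightarrow>\<^sub>L 'h) set \<Rightarrow> bool" where
  "commutative_operators M \<longleftrightarrow> (\<forall>S\<in>M. \<forall>T\<in>M. S o\<^sub>L T = T o\<^sub>L S)"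

text \<open>
  The ultraweak (sigma-weak) topology is the initial topology of the functionals
  \<open>T \<mapsto> (\<Sum>n. \<langle>T (\<xi> n), \<eta> n\<rangle>)\<close> for square-summable sequences \<open>\<xi>\<close>, \<open>\<eta>\<close>; the predual of a von Neumann
  algebra is the space of its ultraweakly continuous linear functionals.
\<close>

definition square_summable :: "(nat \<Rightarrow> 'h::chilbert_space) set" where
  "square_summable = {\<xi>. summable (\<lambda>n. (norm (\<xi> n))\<^sup>2)}"

definition ultraweak_topology :: "('h::chilbert_space \<Rightarrow>\<^sub>L 'h) topology" where
  "ultraweak_topology = pullback_topology UNIV
     (\<lambda>T. \<lambda>(\<xi>, \<eta>) \<in> square_summable \<times> square_summable. \<Sum>n. cinner (blinfun_apply T (\<xi> n)) (\<eta> n))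
     (product_topology (\<lambda>_. euclidean) (square_summable \<times> square_summable))"

definition predual :: "('h::chilbert_space \<Rightarrow>\<^sub>L 'h) set \<Rightarrow> (('h \<Rightarrow>\<^sub>L 'h) \<Rightarrow> complex) set" where
  "predual M = {\<phi> \<in> extensional M.
     clinear_on M \<phi> \<and> continuous_map (subtopology ultraweak_topology M) euclidean \<phi>}"


section \<open>Hilbert spaces with an explicit carrier\<close>

text \<open>
  Unitary representability quantifies existentially over Hilbert spaces, which is not possible
  over types; there a Hilbert space is a structure on a carrier set.
\<close>

record 'v inner_space =
  vectors :: "'v set"
  vadd :: "'v \<Rightarrow> 'v \<Rightarrow> 'v"
  vzero :: 'v
  vscale :: "complex \<Rightarrow> 'v \<Rightarrow> 'v"
  vinner :: "'v \<Rightarrow> 'v \<Rightarrow> complex"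

definition vnorm :: "'v inner_space \<Rightarrow> 'v \<Rightarrow> real" where
  "vnorm H x = sqrt (Re (vinner H x x))"

text \<open>The value 0 off the carrier is immaterial; \<^locale>\<open>Metric_space\<close> wants a total distance function.\<close>

definition vdist :: "'v inner_space \<Rightarrow> 'v \<Rightarrow> 'v \<Rightarrow> real" where
  "vdist H x y =
     (if x \<in> vectors H \<and> y \<in> vectors H then vnorm H (vadd H x (vscale H (-1) y)) else 0)"

locale complex_inner_space =
  fixes H :: "'v inner_space"
  assumes vadd_group: "comm_group \<lparr>carrier = vectors H, mult = vadd H, one = vzero H\<rparr>"
    and vscale_closed: "x \<in> vectors H \<Longrightarrow> vscale H a x \<in> vectors H"
    and vscale_add_right: "x \<in> vectors H \<Longrightarrow> y \<in> vectors H \<Longrightarrow>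
      vscale H a (vadd H x y) = vadd H (vscale H a x) (vscale H a y)"
    and vscale_add_left: "x \<in> vectors H \<Longrightarrow>
      vscale H (a + b) x = vadd H (vscale H a x) (vscale H b x)"
    and vscale_vscale: "x \<in> vectors H \<Longrightarrow> vscale H a (vscale H b x) = vscale H (a * b) x"
    and vscale_one: "x \<in> vectors H \<Longrightarrow> vscale H 1 x = x"
    and vinner_add_left: "x \<in> vectors H \<Longrightarrow> y \<in> vectors H \<Longrightarrow> z \<in> vectors H \<Longrightarrow>
      vinner H (vadd H x y) z = vinner H x z + vinner H y z"
    and vinner_scale_left: "x \<in> vectors H \<Longrightarrow> y \<in> vectors H \<Longrightarrow>
      vinner H (vscale H a x) y = a * vinner H x y"
    and vinner_commute: "x \<in> vectors H \<Longrightarrow> y \<in> vectors H \<Longrightarrow>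
      vinner H y x = cnj (vinner H x y)"
    and vinner_nonneg: "x \<in> vectors H \<Longrightarrow> 0 \<le> Re (vinner H x x)"
    and vinner_definite: "x \<in> vectors H \<Longrightarrow> vinner H x x = 0 \<Longrightarrow> x = vzero H"

locale complex_hilbert_space = complex_inner_space +
  assumes complete: "Metric_space.mcomplete (vectors H) (vdist H)"

context complex_inner_space
begin

interpretation V: comm_group "\<lparr>carrier = vectors H, mult = vadd H, one = vzero H\<rparr>"
  by (rule vadd_group)

lemma vadd_closed: "x \<in> vectors H \<Longrightarrow> y \<in> vectors H \<Longrightarrow> vadd H x y \<in> vectors H"
  using V.m_closed by simp

lemma vadd_assoc: "x \<in> vectors H \<Longrightarrow> y \<in> vectors H \<Longrightarrow> z \<in> vectors H \<Longrightarrow>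
    vadd H (vadd H x y) z = vadd H x (vadd H y z)"
  using V.m_assoc by simp

lemma vadd_commute: "x \<in> vectors H \<Longrightarrow> y \<in> vectors H \<Longrightarrow> vadd H x y = vadd H y x"
  using V.m_comm by simp

lemma vzero_closed: "vzero H \<in> vectors H"
  using V.one_closed by simp

lemma vadd_vzero: "x \<in> vectors H \<Longrightarrow> vadd H (vzero H) x = x"
  using V.l_one by simp

lemma vscale_zero: assumes "x \<in> vectors H" shows "vscale H 0 x = vzero H"
proof -
  have "vadd H (vscale H 0 x) (vscale H 0 x) = vscale H 0 x"
    using vscale_add_left[OF assms, of 0 0] by simp
  then show ?thesis
    using V.l_cancel_one[of "vscale H 0 x" "vscale H 0 x"] vscale_closed[OF assms] by simp
qed

lemma vadd_neg: assumes "x \<in> vectors H" shows "vadd H (vscale H (-1) x) x = vzero H"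
  using vscale_add_left[OF assms, of "-1" 1] vscale_one[OF assms] vscale_zero[OF assms] by simp

lemma vinner_self_eq_0: assumes "x \<in> vectors H" "Re (vinner H x x) = 0" shows "x = vzero H"
proof -
  have "Im (vinner H x x) = 0"
    using arg_cong[OF vinner_commute[OF assms(1) assms(1)], of Im] by simp
  then show ?thesis
    using assms vinner_definite by (simp add: complex_eq_iff)
qed

lemma vinner_zero_left: assumes "x \<in> vectors H" shows "vinner H (vzero H) x = 0"
  using vinner_scale_left[OF vzero_closed assms, of 0] vscale_zero[OF vzero_closed] by simp

lemma Re_vinner_add_scale:
  assumes "x \<in> vectors H" "y \<in> vectors H"
  shows "Re (vinner H (vadd H x (vscale H (of_real t) y)) (vadd H x (vscale H (of_real t) y))) =
    Re (vinner H x x) + 2 * t * Re (vinner H x y) + t\<^sup>2 * Re (vinner H y y)"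
proof -
  have y': "vscale H (of_real t) y \<in> vectors H" using assms vscale_closed by blast
  have *: "vinner H u (vadd H x (vscale H (of_real t) y)) = vinner H u x + of_real t * vinner H u y"
    if u: "u \<in> vectors H" for u
  proof -
    have "vinner H u (vadd H x (vscale H (of_real t) y)) =
        cnj (vinner H x u + of_real t * vinner H y u)"
      using vinner_commute[of "vadd H x (vscale H (of_real t) y)" u] vadd_closed assms u y'
      by (simp add: vinner_add_left vinner_scale_left)
    also have "\<dots> = vinner H u x + of_real t * vinner H u y"
      using vinner_commute[of x u] vinner_commute[of y u] assms u by simp
    finally show ?thesis .
  qed
  have "Re (vinner H y x) = Re (vinner H x y)"
    using vinner_commute[of x y] assms by simp
  moreover have "vadd H x (vscale H (of_real t) y) \<in> vectors H"
    using vadd_closed assms y' by blast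
  ultimately show ?thesis
    using assms y' by (simp add: vinner_add_left vinner_scale_left * algebra_simps power2_eq_square)
qed

lemma Re_vinner_le:
  assumes "x \<in> vectors H" "y \<in> vectors H"
  shows "Re (vinner H x y) \<le> sqrt (Re (vinner H x x)) * sqrt (Re (vinner H y y))"
proof (cases "Re (vinner H y y) = 0")
  case True
  then have "vinner H x y = 0"
    using vinner_self_eq_0 assms vinner_zero_left vinner_commute[of y x] by simp
  then show ?thesis by (simp add: True)
next
  case False
  let ?a = "Re (vinner H x x)" and ?b = "Re (vinner H x y)" and ?c = "Re (vinner H y y)"
  have c: "?c > 0" using False vinner_nonneg[OF assms(2)] by simp
  have "0 \<le> ?a + 2 * (- ?b / ?c) * ?b + (- ?b / ?c)\<^sup>2 * ?c"
    using Re_vinner_add_scale[OF assms, of "- ?b / ?c"] vinner_nonneg vadd_closed vscale_closed assms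
    by metis
  also have "\<dots> = ?a - ?b\<^sup>2 / ?c"
    using c by (simp add: power2_eq_square field_simps)
  finally have "?b\<^sup>2 \<le> ?a * ?c" using c by (simp add: field_simps)
  then have "\<bar>?b\<bar> \<le> sqrt (?a * ?c)" by (rule real_le_rsqrt[of "\<bar>?b\<bar>", simplified])
  then show ?thesis by (simp add: real_sqrt_mult)
qed

lemma vnorm_triangle:
  assumes "x \<in> vectors H" "y \<in> vectors H"
  shows "sqrt (Re (vinner H (vadd H x y) (vadd H x y))) \<le>
    sqrt (Re (vinner H x x)) + sqrt (Re (vinner H y y))"
proof (rule real_le_lsqrt)
  have "Re (vinner H (vadd H x y) (vadd H x y)) =
      Re (vinner H x x) + 2 * Re (vinner H x y) + Re (vinner H y y)"
    using Re_vinner_add_scale[OF assms, of 1] vscale_one assms by simp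
  also have "\<dots> \<le> (sqrt (Re (vinner H x x)) + sqrt (Re (vinner H y y)))\<^sup>2"
    using Re_vinner_le[OF assms] vinner_nonneg assms by (simp add: power2_sum)
  finally show "Re (vinner H (vadd H x y) (vadd H x y)) \<le>
    (sqrt (Re (vinner H x x)) + sqrt (Re (vinner H y y)))\<^sup>2" .
qed (use assms vinner_nonneg in auto)

lemma vdist_eq_0_iff:
  assumes "x \<in> vectors H" "y \<in> vectors H"
  shows "vdist H x y = 0 \<longleftrightarrow> x = y"
proof
  have y': "vscale H (-1) y \<in> vectors H" using assms vscale_closed by blast
  assume "vdist H x y = 0"
  then have *: "vadd H x (vscale H (-1) y) = vzero H"
    using assms y' vinner_self_eq_0 vadd_closed by (simp add: vdist_def vnorm_def)
  have "x = vadd H x (vadd H (vscale H (-1) y) y)"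
    using assms vadd_neg vadd_vzero vadd_commute vzero_closed by metis
  also have "\<dots> = y"
    using assms y' * vadd_assoc vadd_vzero by metis
  finally show "x = y" .
next
  assume "x = y"
  then show "vdist H x y = 0"
    using assms vadd_neg vadd_commute vscale_closed vinner_zero_left vzero_closed
    by (metis (mono_tags, lifting) real_sqrt_zero vdist_def vnorm_def zero_complex.sel(1))
qed

lemma vdist_commute: "vdist H x y = vdist H y x"
proof (cases "x \<in> vectors H \<and> y \<in> vectors H")
  case True
  let ?d = "vadd H x (vscale H (-1) y)"
  have d: "?d \<in> vectors H" using True vadd_closed vscale_closed by blast
  have "vadd H y (vscale H (-1) x) = vscale H (-1) ?d"
    using True by (simp add: vscale_add_right vscale_vscale vscale_one vscale_closed vadd_commute)
  moreover have "vnorm H (vscale H (-1) ?d) = vnorm H ?d"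
  proof -
    have "vinner H (vscale H (-1) ?d) (vscale H (-1) ?d) = - vinner H ?d (vscale H (-1) ?d)"
      using vinner_scale_left[OF d vscale_closed[OF d], of "-1"] by simp
    also have "\<dots> = - cnj (vinner H (vscale H (-1) ?d) ?d)"
      using vinner_commute[OF vscale_closed[OF d] d] by simp
    also have "\<dots> = cnj (vinner H ?d ?d)"
      using vinner_scale_left[OF d d, of "-1"] by simp
    finally show ?thesis by (simp add: vnorm_def)
  qed
  ultimately show ?thesis using True by (simp add: vdist_def)
qed (auto simp: vdist_def)

lemma vdist_triangle:
  assumes "x \<in> vectors H" "y \<in> vectors H" "z \<in> vectors H"
  shows "vdist H x z \<le> vdist H x y + vdist H y z"
proof -
  let ?n = "vscale H (-1)"
  have n: "?n y \<in> vectors H" "?n z \<in> vectors H" using assms vscale_closed by auto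
  have "vadd H (vadd H x (?n y)) (vadd H y (?n z)) = vadd H x (vadd H (vadd H (?n y) y) (?n z))"
    using assms n by (simp add: vadd_assoc vadd_closed)
  also have "\<dots> = vadd H x (?n z)"
    using assms n by (simp add: vadd_neg vadd_vzero)
  finally show ?thesis
    using vnorm_triangle[of "vadd H x (?n y)" "vadd H y (?n z)"] assms n
    by (simp add: vdist_def vnorm_def vadd_closed)
qed

lemma Metric_space_vdist: "Metric_space (vectors H) (vdist H)"
proof
  show "0 \<le> vdist H x y" for x y
    using vinner_nonneg vadd_closed vscale_closed by (simp add: vdist_def vnorm_def)
qed (use vdist_commute vdist_eq_0_iff vdist_triangle in auto)

end

text \<open>The type-class Hilbert spaces are the Hilbert spaces whose carrier is a whole type.\<close>

lemma complex_hilbert_space_UNIV: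
  "complex_hilbert_space \<lparr>vectors = (UNIV :: 'h::chilbert_space set), vadd = (+), vzero = 0,
     vscale = (*\<^sub>C), vinner = cinner\<rparr>"
proof -
  let ?H = "\<lparr>vectors = (UNIV :: 'h set), vadd = (+), vzero = 0, vscale = (*\<^sub>C), vinner = cinner\<rparr>"
  have neg: "(-1) *\<^sub>C x = - x" for x :: 'h
    using scaleR_eq_scaleC[of "-1" x] by simp
  let ?G = "\<lparr>carrier = (UNIV :: 'h set), mult = (+), one = 0\<rparr>"
  have "\<exists>y\<in>carrier ?G. y \<otimes>\<^bsub>?G\<^esub> x = \<one>\<^bsub>?G\<^esub>" for x
    by (auto intro: exI[of _ "- x"])
  then have "comm_group ?G"
    by (intro comm_groupI) (auto simp: algebra_simps)
  then interpret complex_inner_space ?H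
    by (intro complex_inner_space.intro)
      (auto simp: scaleC_add_right scaleC_add_left scaleC_scaleC scaleC_one cinner_add_left
         cinner_scaleC_left cinner_self intro: cinner_commute)
  have "vdist ?H = dist"
    by (auto simp: fun_eq_iff vdist_def vnorm_def neg cinner_self dist_norm)
  then have "Metric_space.mcomplete (vectors ?H) (vdist ?H)"
    using complete_UNIV by (simp add: mcomplete_iff_complete)
  then show ?thesis by unfold_locales
qed


section \<open>Unitary representability\<close>

definition unitary_group :: "'v inner_space \<Rightarrow> ('v \<Rightarrow> 'v) monoid" where
  "unitary_group H =
     \<lparr>carrier = {U \<in> extensional (vectors H). bij_betw U (vectors H) (vectors H) \<and>
        (\<forall>x\<in>vectors H. \<forall>y\<in>vectors H. U (vadd H x y) = vadd H (U x) (U y)) \<and>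
        (\<forall>a. \<forall>x\<in>vectors H. U (vscale H a x) = vscale H a (U x)) \<and>
        (\<forall>x\<in>vectors H. \<forall>y\<in>vectors H. vinner H (U x) (U y) = vinner H x y)},
      mult = compose (vectors H), one = (\<lambda>x\<in>vectors H. x)\<rparr>"

text \<open>
  The strong operator topology is the topology of pointwise convergence in norm. Unitaries are
  extensional functions, so it is a subspace topology of a product over the carrier.
\<close>

definition unitary_strong_topology :: "'v inner_space \<Rightarrow> ('v \<Rightarrow> 'v) topology" where
  "unitary_strong_topology H = subtopology
     (product_topology (\<lambda>_. Metric_space.mtopology (vectors H) (vdist H)) (vectors H))
     (carrier (unitary_group H))"

definition topological_group :: "('g, 'b) monoid_scheme \<Rightarrow> 'g topology \<Rightarrow> bool" where
  "topological_group G T \<longleftrightarrow> group G \<and> topspace T = carrier G \<and>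
     continuous_map (prod_topology T T) T (\<lambda>(x, y). x \<otimes>\<^bsub>G\<^esub> y) \<and>
     continuous_map T T (\<lambda>x. inv\<^bsub>G\<^esub> x)"

text \<open>
  The Hilbert space is sought among those whose vectors are functions \<open>'g \<times> 'g set \<Rightarrow> complex\<close>. This
  is no restriction. Let \<open>G\<close> be topologically isomorphic to a group of unitaries on an arbitrary
  Hilbert space \<open>K\<close>. For each neighbourhood \<open>N\<close> of the identity, finitely many vectors
  \<open>v\<^sub>1, \<dots>, v\<^sub>k\<close> of \<open>K\<close> control a strong neighbourhood inside \<open>N\<close>; let \<open>K\<^sub>N\<close> be the cyclic subspace
  of \<open>K\<^sup>k\<close> generated by \<open>\<xi>\<^sub>N = (v\<^sub>1, \<dots>, v\<^sub>k)\<close>. The Hilbert sum of the \<open>K\<^sub>N\<close> still carries a topological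
  embedding of \<open>G\<close>, and as each \<open>\<xi>\<^sub>N\<close> is cyclic, sending \<open>w\<close> to the function
  \<open>(g, N) \<mapsto> \<langle>w\<^sub>N, g \<xi>\<^sub>N\<rangle>\<close> identifies it with a space of functions of this type.
\<close>

definition unitarily_representable :: "('g, 'b) monoid_scheme \<Rightarrow> 'g topology \<Rightarrow> bool" where
  "unitarily_representable G T \<longleftrightarrow> topological_group G T \<and>
     (\<exists>(H :: ('g \<times> 'g set \<Rightarrow> complex) inner_space) S \<rho>.
        complex_hilbert_space H \<and> subgroup S (unitary_group H) \<and>
        \<rho> \<in> iso G ((unitary_group H)\<lparr>carrier := S\<rparr>) \<and>
        homeomorphic_map T (subtopology (unitary_strong_topology H) S) \<rho>)"

end

theory Submission
  imports Defs
begin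

text \<open>
  Both groups consist of bounded functionals on a space \<open>E\<close> (the algebra \<open>A\<close>, or \<open>\<M>\<close>), with uniform
  convergence on compact sets. Two facts give the result.

  A Hausdorff topological group is unitarily representable as soon as each neighbourhood of the
  identity contains a set \<open>{g. 1 - \<psi> g < \<delta>}\<close> for a positive definite function \<open>\<psi>\<close> that is continuous at the
  identity and takes the value 1 there (\<open>unitarily_representable_if_positive_definite\<close>). The Hilbert space
  is the reproducing kernel Hilbert space of the kernels \<open>\<psi> (h\<inverse> g)\<close>, taken together for all
  neighbourhoods; the group acts on it by translation.

  Such functions are obtained in the form \<open>exp (- q)\<close>, where \<open>q \<phi> = \<Sum>j. \<bar>Re (\<phi> (x j))\<bar> + \<bar>Im (\<phi> (x j))\<bar>\<close>
  for suitable elements \<open>x j\<close> of \<open>E\<close>. They are positive definite because \<open>exp (- \<bar>s - t\<bar>)\<close> is a positive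
  definite kernel on the line (\<open>negative_kernel_abs\<close>). What remains is to find, for each compact set
  \<open>K\<close>, a seminorm \<open>q\<close> of this kind that dominates the supremum over \<open>K\<close> and is dominated by the
  supremum over another compact set. Here commutativity enters. If \<open>A\<close> is the algebra of continuous
  functions on a compact space, a finite set of functions is approximated by combinations of a partition of
  unity \<open>h\<^sub>1, \<dots>, h\<^sub>n\<close>, and the norm of \<open>\<Sum>i. a\<^sub>i h\<^sub>i\<close> is at most \<open>max \<bar>a\<^sub>i\<bar>\<close>; dually,
  \<open>\<Sum>i. \<bar>\<phi> h\<^sub>i\<bar>\<close> controls \<open>\<phi>\<close> on this set and is controlled by \<open>\<phi>\<close> on the combinations of the \<open>h\<^sub>i\<close>
  with unimodular coefficients. Repeating this for the residuals expands every element of \<open>K\<close> in a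
  series over such partitions (\<open>cube_spanned_compact_expansion\<close>). Up to scaling and the removal of scalar
  parts, the \<open>x j\<close> are the elements of all these partitions.

  The partitions of unity come from algebra, without the Gelfand representation: for commuting
  self-adjoint contractions \<open>f\<^sub>1, \<dots>, f\<^sub>k\<close> the products of the elements \<open>(1 \<plusminus> f\<^sub>j) / 2\<close>, one for each choice of
  signs, sum to 1, and each \<open>f\<^sub>j\<close> is a combination of them with coefficients 1 and -1
  (\<open>partition_exists\<close>). The norm estimate for their combinations needs only that sums of squares of
  commuting self-adjoint operators are again squares, which follows from the existence of a square root of
  \<open>1 - z\<close> for \<open>\<parallel>z\<parallel> \<le> 1\<close>. In an algebra \<open>A\<close> without unit the argument takes place in the algebra of
  multipliers of \<open>A\<close>.
\<close>

section \<open>Positive elements and partitions of unity\<close>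

interpretation blinfun_compose: bounded_bilinear "(o\<^sub>L)"
  by (rule bounded_bilinear_blinfun_compose)

lemma blinfun_compose_assoc: "(u o\<^sub>L v) o\<^sub>L w = u o\<^sub>L (v o\<^sub>L w)"
  by (rule blinfun_eqI) simp

lemma blinfun_compose_id [simp]: "id_blinfun o\<^sub>L u = u" "u o\<^sub>L id_blinfun = u"
  by (auto intro: blinfun_eqI)

notation blinfun_compose (infixl \<open>\<cdot>\<close> 70)

text \<open>
  The self-adjoint part of a unital commutative C*-algebra of operators. The involution enters only
  through the inequality \<open>\<parallel>u\<parallel>\<^sup>2 \<le> \<parallel>u\<^sup>2 + v\<^sup>2\<parallel>\<close>, so the same development serves operators on a Hilbert
  space and multiplication operators on a C*-algebra without unit, whose underlying Banach space
  carries no inner product.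
\<close>

locale real_commutative_cstar =
  fixes R :: "('v::banach \<Rightarrow>\<^sub>L 'v) set"
  assumes add: "u \<in> R \<Longrightarrow> v \<in> R \<Longrightarrow> u + v \<in> R"
    and scaleR: "u \<in> R \<Longrightarrow> r *\<^sub>R u \<in> R"
    and one: "id_blinfun \<in> R"
    and mult: "u \<in> R \<Longrightarrow> v \<in> R \<Longrightarrow> u \<cdot> v \<in> R"
    and commute: "u \<in> R \<Longrightarrow> v \<in> R \<Longrightarrow> u \<cdot> v = v \<cdot> u"
    and closed: "closed R"
    and norm_sum_squares: "u \<in> R \<Longrightarrow> v \<in> R \<Longrightarrow> (norm u)\<^sup>2 \<le> norm (u \<cdot> u + v \<cdot> v)"
begin

lemma diff: "u \<in> R \<Longrightarrow> v \<in> R \<Longrightarrow> u - v \<in> R"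
  using add[of u "(-1) *\<^sub>R v"] scaleR[of v "-1"] by simp

lemma zero: "0 \<in> R"
  using scaleR[OF one, of 0] by simp

lemma sum: "(\<And>i. i \<in> I \<Longrightarrow> f i \<in> R) \<Longrightarrow> sum f I \<in> R"
  by (induction I rule: infinite_finite_induct) (auto intro: add zero)

lemma norm_one_le: "norm (id_blinfun :: 'v \<Rightarrow>\<^sub>L 'v) \<le> 1"
  by (rule norm_blinfun_bound) auto

text \<open>
  Squares play the part of the positive elements. That they form a convex cone closed under products
  is what replaces the Gelfand representation below.
\<close>

definition positive :: "('v \<Rightarrow>\<^sub>L 'v) \<Rightarrow> bool" where
  "positive x \<longleftrightarrow> (\<exists>u\<in>R. x = u \<cdot> u)"

lemma positive_mem: "positive x \<Longrightarrow> x \<in> R"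
  by (auto simp: positive_def intro: mult)

lemma norm_square_le_one:
  assumes "u \<in> R" "v \<in> R" "u \<cdot> u + v \<cdot> v = id_blinfun" shows "norm u \<le> 1"
proof -
  have "(norm u)\<^sup>2 \<le> 1"
    using norm_sum_squares[OF assms(1,2)] norm_one_le assms(3) by simp
  then show ?thesis by (simp add: abs_square_le_1[of "norm u", simplified])
qed

text \<open>
  The binomial series of \<open>sqrt (1 - z)\<close>, summed by an iteration. A fixed point \<open>l\<close> of
  \<open>y \<mapsto> (z + y\<^sup>2) / 2\<close> satisfies \<open>(1 - l)\<^sup>2 = 1 - z\<close>. The iteration started at 0 is dominated, step by
  step, by the scalar iteration for \<open>z = 1\<close>, which increases and is bounded by 1; the factorization
  \<open>a\<^sup>2 - b\<^sup>2 = (a - b) (a + b)\<close> that gives this domination needs commutativity.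
\<close>

lemma positive_one_minus:
  assumes z: "z \<in> R" "norm z \<le> 1" shows "positive (id_blinfun - z)"
proof -
  define b where "b = rec_nat (0 :: 'v \<Rightarrow>\<^sub>L 'v) (\<lambda>_ y. (1/2) *\<^sub>R (z + y \<cdot> y))"
  define \<beta> where "\<beta> = rec_nat (0 :: real) (\<lambda>_ y. (1 + y\<^sup>2) / 2)"
  have b0: "b 0 = 0" and bS: "\<And>n. b (Suc n) = (1/2) *\<^sub>R (z + b n \<cdot> b n)"
    by (simp_all add: b_def)
  have \<beta>0: "\<beta> 0 = 0" and \<beta>S: "\<And>n. \<beta> (Suc n) = (1 + (\<beta> n)\<^sup>2) / 2"
    by (simp_all add: \<beta>_def)
  have bR: "b n \<in> R" for n
    by (induction n) (auto simp: b0 bS intro!: zero scaleR add mult z)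
  have \<beta>01: "0 \<le> \<beta> n \<and> \<beta> n \<le> 1" for n
  proof (induction n)
    case (Suc n)
    then have "(\<beta> n)\<^sup>2 \<le> 1" by (simp add: power_le_one)
    then show ?case by (simp add: \<beta>S)
  qed (simp add: \<beta>0)
  have bn: "norm (b n) \<le> \<beta> n" for n
  proof (induction n)
    case (Suc n)
    have "norm (z + b n \<cdot> b n) \<le> norm z + norm (b n) * norm (b n)"
      by (rule order_trans[OF norm_triangle_ineq]) (simp add: norm_blinfun_compose)
    also have "\<dots> \<le> 1 + \<beta> n * \<beta> n"
      using Suc z \<beta>01 by (intro add_mono mult_mono) auto
    finally show ?case by (simp add: bS \<beta>S power2_eq_square)
  qed (simp add: b0 \<beta>0)
  have step: "norm (b (Suc n) - b n) \<le> \<beta> (Suc n) - \<beta> n" for n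
  proof (induction n)
    case 0
    show ?case using z by (simp add: b0 bS \<beta>0 \<beta>S)
  next
    case (Suc n)
    have "b (Suc (Suc n)) - b (Suc n) = (1/2) *\<^sub>R (b (Suc n) \<cdot> b (Suc n) - b n \<cdot> b n)"
      unfolding bS[of "Suc n"] bS[of n] by (simp only: scaleR_diff_right[symmetric]) simp
    also have "b (Suc n) \<cdot> b (Suc n) - b n \<cdot> b n = (b (Suc n) - b n) \<cdot> (b (Suc n) + b n)"
      using commute[OF bR[of n] bR[of "Suc n"]]
      by (simp add: blinfun_compose.add_right blinfun_compose.diff_left)
    finally have "norm (b (Suc (Suc n)) - b (Suc n)) \<le>
        (1/2) * (norm (b (Suc n) - b n) * norm (b (Suc n) + b n))"
      using norm_blinfun_compose[of "b (Suc n) - b n" "b (Suc n) + b n"] by simp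
    also have "\<dots> \<le> (1/2) * ((\<beta> (Suc n) - \<beta> n) * (\<beta> (Suc n) + \<beta> n))"
      using Suc bn[of n] bn[of "Suc n"] norm_triangle_ineq[of "b (Suc n)" "b n"]
      by (intro mult_left_mono mult_mono) (use order_trans[OF norm_ge_zero Suc] in auto)
    also have "\<dots> = \<beta> (Suc (Suc n)) - \<beta> (Suc n)"
      by (simp only: \<beta>S[of "Suc n"] \<beta>S[of n]) (simp add: power2_eq_square field_simps)
    finally show ?case .
  qed
  have far: "norm (b (n + k) - b n) \<le> \<beta> (n + k) - \<beta> n" for n k
  proof (induction k)
    case (Suc k)
    have "norm (b (n + Suc k) - b n) \<le> norm (b (Suc (n + k)) - b (n + k)) + norm (b (n + k) - b n)"
      using norm_triangle_ineq[of "b (Suc (n + k)) - b (n + k)" "b (n + k) - b n"] by simp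
    then show ?case using step[of "n + k"] Suc by simp
  qed simp
  have "incseq \<beta>"
    by (rule incseq_SucI) (use order_trans[OF norm_ge_zero step] in auto)
  then have "convergent \<beta>"
    using \<beta>01 by (intro Bseq_mono_convergent BseqI'[of _ 1]) (auto simp: incseq_def)
  then have "Cauchy \<beta>" by (simp add: Cauchy_convergent_iff)
  have "Cauchy b"
  proof (rule CauchyI')
    fix e :: real assume "e > 0"
    with \<open>Cauchy \<beta>\<close> obtain N where N: "\<And>m n. m \<ge> N \<Longrightarrow> n \<ge> N \<Longrightarrow> norm (\<beta> m - \<beta> n) < e"
      unfolding Cauchy_iff by blast
    have "dist (b m) (b n) < e" if "m \<ge> N" "n > m" for m n
      using far[of m "n - m"] N[of n m] that by (simp add: dist_norm norm_minus_commute)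
    then show "\<exists>M. \<forall>m\<ge>M. \<forall>n>m. dist (b m) (b n) < e" by blast
  qed
  then obtain l where l: "b \<longlonglongrightarrow> l" using Cauchy_convergent convergent_def by blast
  have lR: "l \<in> R" using closed bR l closed_sequentially by blast
  have "(\<lambda>n. b (Suc n)) \<longlonglongrightarrow> (1/2) *\<^sub>R (z + l \<cdot> l)"
    unfolding bS using l by (intro tendsto_intros blinfun_compose.tendsto)
  then have "l = (1/2) *\<^sub>R (z + l \<cdot> l)"
    using LIMSEQ_unique LIMSEQ_Suc[OF l] by blast
  then have "2 *\<^sub>R l = z + l \<cdot> l" by (metis scaleR_half_double scaleR_scaleR mult_2 scaleR_2 scaleR_add_right)
  then have "id_blinfun - z = (id_blinfun - l) \<cdot> (id_blinfun - l)"
    by (simp add: blinfun_compose.diff_left blinfun_compose.diff_right scaleR_2 algebra_simps)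
  then show ?thesis unfolding positive_def using diff[OF one lR] by blast
qed

lemma norm_one_minus_positive:
  assumes "positive x" "norm x \<le> 1" shows "norm (id_blinfun - x) \<le> 1"
proof -
  obtain u where u: "u \<in> R" "x = u \<cdot> u" using assms by (auto simp: positive_def)
  obtain w where w: "w \<in> R" "id_blinfun - x = w \<cdot> w"
    using positive_one_minus[OF positive_mem] assms by (auto simp: positive_def)
  have "w \<cdot> w + u \<cdot> u = id_blinfun" using w(2) u(2) by (simp add: algebra_simps)
  then have "norm w \<le> 1" using norm_square_le_one w u by blast
  then show ?thesis
    unfolding w(2) using norm_blinfun_compose[of w w] mult_le_one[of "norm w" "norm w"] by simp
qed

lemma positive_scaleR: assumes "positive x" "0 \<le> t" shows "positive (t *\<^sub>R x)"
proof -
  obtain u where "u \<in> R" "x = u \<cdot> u" using assms by (auto simp: positive_def)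
  then show ?thesis unfolding positive_def using assms
    by (intro bexI[of _ "sqrt t *\<^sub>R u"])
      (auto simp: blinfun_compose.scaleR_left blinfun_compose.scaleR_right intro: scaleR)
qed

text \<open>
  If \<open>\<parallel>x\<parallel> \<le> t\<close> and \<open>x\<close> is a square, then \<open>\<parallel>1 - x / t\<parallel> \<le> 1\<close>. This condition passes to averages and, by
  the square root of \<open>1 - z\<close>, characterizes squares up to scaling; hence sums of squares are squares.
\<close>

lemma positive_add: assumes x: "positive x" and y: "positive y" shows "positive (x + y)"
proof -
  define t where "t = norm x + norm y + 1"
  have t: "t > 0" "norm x \<le> t" "norm y \<le> t" by (auto simp: t_def intro!: add_nonneg_pos)
  let ?z = "id_blinfun - (1 / (2 * t)) *\<^sub>R (x + y)"
  have "norm (id_blinfun - (1 / t) *\<^sub>R v) \<le> 1" if "positive v" "norm v \<le> t" for v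
    using that t by (intro norm_one_minus_positive positive_scaleR) (auto simp: field_simps)
  then have "norm ((1/2) *\<^sub>R (id_blinfun - (1 / t) *\<^sub>R x) + (1/2) *\<^sub>R (id_blinfun - (1 / t) *\<^sub>R y)) \<le> 1/2 + 1/2"
    using x y t by (intro norm_triangle_le add_mono) auto
  also have "(1/2) *\<^sub>R (id_blinfun - (1 / t) *\<^sub>R x) + (1/2) *\<^sub>R (id_blinfun - (1 / t) *\<^sub>R y) = ?z"
  proof -
    have "(1/2) *\<^sub>R (id_blinfun :: 'v \<Rightarrow>\<^sub>L 'v) + (1/2) *\<^sub>R id_blinfun = id_blinfun"
      by (simp flip: scaleR_left.add)
    then show ?thesis by (simp add: algebra_simps)
  qed
  finally have "norm ?z \<le> 1" by simp
  moreover have "?z \<in> R" using x y by (intro diff scaleR add one positive_mem)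
  ultimately have "positive (id_blinfun - ?z)" by (rule positive_one_minus[rotated])
  then have "positive ((1 / (2 * t)) *\<^sub>R (x + y))" by simp
  then have "positive ((2 * t) *\<^sub>R ((1 / (2 * t)) *\<^sub>R (x + y)))"
    by (rule positive_scaleR) (use t in simp)
  moreover have "2 * t * (1 / (2 * t)) = 1" using t by simp
  ultimately show ?thesis by (simp only: scaleR_scaleR scaleR_one)
qed

lemma positive_mult: assumes "positive x" "positive y" shows "positive (x \<cdot> y)"
proof -
  obtain u v where uv: "u \<in> R" "x = u \<cdot> u" "v \<in> R" "y = v \<cdot> v"
    using assms by (auto simp: positive_def)
  have "x \<cdot> y = (u \<cdot> v) \<cdot> (u \<cdot> v)"
    using commute[OF uv(1,3)] uv by (metis blinfun_compose_assoc)
  then show ?thesis unfolding positive_def using mult uv by blast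
qed

lemma positive_zero: "positive 0"
  unfolding positive_def by (rule bexI[OF _ zero]) simp

lemma positive_sum: "(\<And>i. i \<in> I \<Longrightarrow> positive (f i)) \<Longrightarrow> positive (sum f I)"
  by (induction I rule: infinite_finite_induct) (auto intro: positive_add positive_zero)

text \<open>
  Since \<open>1 - f\<^sup>2 = (1 - f) (1 + f)\<close> is a square \<open>w\<^sup>2\<close>, the identity \<open>f\<^sup>2 + w\<^sup>2 = 1\<close> bounds \<open>f\<close>.
\<close>

lemma norm_le_one_if_between:
  assumes f: "f \<in> R" "positive (id_blinfun - f)" "positive (id_blinfun + f)" shows "norm f \<le> 1"
proof -
  have "positive ((id_blinfun - f) \<cdot> (id_blinfun + f))" using f by (intro positive_mult)
  then obtain w where w: "w \<in> R" "(id_blinfun - f) \<cdot> (id_blinfun + f) = w \<cdot> w"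
    by (auto simp: positive_def)
  have "f \<cdot> f + w \<cdot> w = id_blinfun"
    unfolding w(2)[symmetric]
    by (simp add: blinfun_compose.diff_left blinfun_compose.add_right)
  then show ?thesis using norm_square_le_one f w by blast
qed

text \<open>
  For a partition of unity \<open>h\<close> both \<open>1 - f\<close> and \<open>1 + f\<close>, for \<open>f = \<Sum>i. a i h i\<close>, are combinations of the
  \<open>h i\<close> with the nonnegative coefficients \<open>1 - a i\<close> and \<open>1 + a i\<close>.
\<close>

lemma norm_combination_le_one:
  assumes h: "\<And>i. i < n \<Longrightarrow> positive (h i)" "(\<Sum>i<n. h i) = id_blinfun"
    and a: "\<And>i. i < n \<Longrightarrow> \<bar>a i\<bar> \<le> (1::real)"
  shows "norm (\<Sum>i<n. a i *\<^sub>R h i) \<le> 1"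
proof (rule norm_le_one_if_between)
  show "(\<Sum>i<n. a i *\<^sub>R h i) \<in> R"
    using h by (intro sum scaleR positive_mem) auto
  have *: "positive (\<Sum>i<n. (1 + s * a i) *\<^sub>R h i)" if "\<bar>s\<bar> = 1" for s
  proof (intro positive_sum positive_scaleR)
    fix i assume "i \<in> {..<n}"
    then have "\<bar>s * a i\<bar> \<le> 1" using a that by (simp add: abs_mult)
    then show "0 \<le> 1 + s * a i" by linarith
  qed (use h in auto)
  have "(\<Sum>i<n. (1 + s * a i) *\<^sub>R h i) = id_blinfun + s *\<^sub>R (\<Sum>i<n. a i *\<^sub>R h i)" for s
    by (simp add: scaleR_left.add sum.distrib h(2) scaleR_right.sum)
  from *[of "-1"] *[of 1] this[of "-1"] this[of 1]
  show "positive (id_blinfun - (\<Sum>i<n. a i *\<^sub>R h i))" "positive (id_blinfun + (\<Sum>i<n. a i *\<^sub>R h i))"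
    by simp_all
qed

end

lemma sum_lessThan_double:
  "(\<Sum>i<2 * n. f i) = (\<Sum>i<n. f (2 * i) + f (2 * i + 1))" for f :: "nat \<Rightarrow> 'a::comm_monoid_add"
  by (induction n) (auto simp: ac_simps)

text \<open>
  A finite subset of the unit ball is contained in the image of the cube \<open>[-1, 1]\<^sup>n\<close> under a linear map
  of norm at most 2 from \<open>n\<close>-dimensional \<open>l\<^sup>\<infinity>\<close>. Dually, the functionals are controlled by norms of
  \<open>l\<^sup>1\<close>-type. It is through this property that commutativity enters the construction of the
  representation.
\<close>

definition cube_spanned :: "'e::real_normed_vector set \<Rightarrow> bool" where
  "cube_spanned J \<longleftrightarrow> (\<forall>F. finite F \<longrightarrow> F \<subseteq> J \<inter> cball 0 1 \<longrightarrow>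
     (\<exists>n (h :: nat \<Rightarrow> 'e). (\<forall>i<n. h i \<in> J) \<and>
        (\<forall>f\<in>F. \<exists>a :: nat \<Rightarrow> real. (\<forall>i<n. \<bar>a i\<bar> \<le> 1) \<and> f = (\<Sum>i<n. a i *\<^sub>R h i)) \<and>
        (\<forall>a :: nat \<Rightarrow> real. (\<forall>i<n. \<bar>a i\<bar> \<le> 1) \<longrightarrow> norm (\<Sum>i<n. a i *\<^sub>R h i) \<le> 2)))"

context real_commutative_cstar
begin

text \<open>
  For commuting self-adjoint contractions \<open>f\<^sub>1, \<dots>, f\<^sub>k\<close> the \<open>2\<^sup>k\<close> products of the elements
  \<open>(1 \<plusminus> f\<^sub>j) / 2\<close> are positive and sum to 1, and \<open>f\<^sub>j\<close> is their sum with the signs chosen for \<open>f\<^sub>j\<close>.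
  The scalars \<open>t i\<close> are the constant terms of these products: removing them leads into an algebra
  \<open>J\<close> without unit that contains the \<open>f\<^sub>j\<close>, and the condition that \<open>\<Sum>i. a i t i = 0\<close> ensures that
  this changes no \<open>f\<^sub>j\<close>.
\<close>

lemma partition_exists:
  assumes J: "J \<subseteq> R" "\<And>u v. u \<in> J \<Longrightarrow> v \<in> J \<Longrightarrow> u + v \<in> J" "\<And>r u. u \<in> J \<Longrightarrow> r *\<^sub>R u \<in> J"
      "\<And>u v. u \<in> J \<Longrightarrow> v \<in> J \<Longrightarrow> u \<cdot> v \<in> J"
    and F: "finite F" "F \<subseteq> J \<inter> cball 0 1" and ne: "0 \<in> J"
  shows "\<exists>(n::nat) h t. (\<forall>i<n. positive (h i) \<and> h i - t i *\<^sub>R id_blinfun \<in> J \<and> 0 \<le> t i) \<and>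
    (\<Sum>i<n. h i) = id_blinfun \<and> (\<Sum>i<n. t i) = 1 \<and>
    (\<forall>f\<in>F. \<exists>a. (\<forall>i<n. \<bar>a i\<bar> \<le> (1::real)) \<and> f = (\<Sum>i<n. a i *\<^sub>R h i) \<and> (\<Sum>i<n. a i * t i) = 0)"
  using F
proof (induction F)
  case empty
  show ?case
    by (intro exI[of _ "1::nat"] exI[of _ "\<lambda>_. id_blinfun"] exI[of _ "\<lambda>_. 1"])
      (use positive_one_minus[OF zero] ne in simp)
next
  case (insert f F)
  then obtain n :: nat and h t where
    ht: "\<forall>i<n. positive (h i) \<and> h i - t i *\<^sub>R id_blinfun \<in> J \<and> 0 \<le> t i"
    and sums: "(\<Sum>i<n. h i) = id_blinfun" "(\<Sum>i<n. t i) = 1"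
    and FF: "\<forall>f\<in>F. \<exists>a. (\<forall>i<n. \<bar>a i\<bar> \<le> (1::real)) \<and> f = (\<Sum>i<n. a i *\<^sub>R h i) \<and> (\<Sum>i<n. a i * t i) = 0"
    by (auto 0 0)
  note h = ht[rule_format, THEN conjunct1] ht[rule_format, THEN conjunct2, THEN conjunct1]
    ht[rule_format, THEN conjunct2, THEN conjunct2] sums
  have f: "f \<in> J" "f \<in> R" "norm f \<le> 1" using insert J(1) by auto
  \<comment> \<open>Each old element \<open>h j\<close> splits into \<open>(1 + f) h j / 2\<close> at index \<open>2 j\<close> and
    \<open>(1 - f) h j / 2\<close> at index \<open>2 j + 1\<close>.\<close>
  define s where "s i = (if even i then 1 else - 1 :: real)" for i :: nat
  define g where "g i = ((1/2) *\<^sub>R (id_blinfun + s i *\<^sub>R f)) \<cdot> h (i div 2)" for i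
  define t' where "t' i = t (i div 2) / 2" for i
  have s: "\<bar>s i\<bar> = 1" "s (2 * i) = 1" "s (Suc (2 * i)) = - 1" for i by (auto simp: s_def)
  have gsum: "g (2 * i) + g (Suc (2 * i)) = h i" "g (2 * i) - g (Suc (2 * i)) = f \<cdot> h i" for i
  proof -
    have 1: "(1/2) *\<^sub>R v + (1/2) *\<^sub>R v = v" for v :: "'v \<Rightarrow>\<^sub>L 'v"
      by (simp flip: scaleR_left.add)
    show "g (2 * i) + g (Suc (2 * i)) = h i" "g (2 * i) - g (Suc (2 * i)) = f \<cdot> h i"
      using 1[of "h i"] 1[of "f \<cdot> h i"]
      by (simp_all add: g_def s blinfun_compose.diff_left blinfun_compose.add_left
          blinfun_compose.scaleR_left scaleR_add_right scaleR_diff_right)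
  qed
  have half: "i div 2 < n" if "i < 2 * n" for i using that by auto
  have 1: "positive (g i)" if "i < 2 * n" for i
  proof -
    have "positive (id_blinfun - (- s i) *\<^sub>R f)"
      by (rule positive_one_minus) (use scaleR[OF f(2), of "- s i"] f s in \<open>simp_all\<close>)
    then show ?thesis unfolding g_def using h(1)[OF half[OF that]]
      by (intro positive_mult positive_scaleR) auto
  qed
  have 2: "g i - t' i *\<^sub>R id_blinfun \<in> J" if "i < 2 * n" for i
  proof -
    let ?j = "i div 2"
    let ?x = "h ?j - t ?j *\<^sub>R id_blinfun"
    have "g i - t' i *\<^sub>R id_blinfun = (1/2) *\<^sub>R ?x + (s i / 2 * t ?j) *\<^sub>R f + (s i / 2) *\<^sub>R (f \<cdot> ?x)"
      by (simp add: g_def t'_def blinfun_compose.diff_right blinfun_compose.add_left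
          blinfun_compose.scaleR_left blinfun_compose.scaleR_right algebra_simps)
    also have "\<dots> \<in> J" using h(2)[OF half[OF that]] f by (intro J(2,3,4))
    finally show ?thesis .
  qed
  have 3: "0 \<le> t' i" if "i < 2 * n" for i using h(3)[OF half[OF that]] by (simp add: t'_def)
  have 4: "(\<Sum>i<2*n. g i) = id_blinfun" by (simp add: sum_lessThan_double gsum h(4))
  have 5: "(\<Sum>i<2*n. t' i) = 1" by (simp add: sum_lessThan_double t'_def h(5))
  have 6: "\<exists>a. (\<forall>i<2*n. \<bar>a i\<bar> \<le> 1) \<and> f' = (\<Sum>i<2*n. a i *\<^sub>R g i) \<and> (\<Sum>i<2*n. a i * t' i) = 0"
    if f': "f' \<in> insert f F" for f'
  proof (cases "f' = f")
    case True
    have "(\<Sum>i<2*n. s i *\<^sub>R g i) = f \<cdot> (\<Sum>i<n. h i)"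
      by (simp add: sum_lessThan_double s gsum blinfun_compose.sum_right)
    then have "(\<Sum>i<2*n. s i *\<^sub>R g i) = f" by (simp add: h(4))
    moreover have "(\<Sum>i<2*n. s i * t' i) = 0" by (simp add: sum_lessThan_double s t'_def)
    ultimately show ?thesis using s True by (intro exI[of _ s]) auto
  next
    case False
    then obtain a where a: "\<And>i. i < n \<Longrightarrow> \<bar>a i\<bar> \<le> (1::real)" "f' = (\<Sum>i<n. a i *\<^sub>R h i)"
      "(\<Sum>i<n. a i * t i) = 0" using FF f' by blast
    have "(\<Sum>i<2*n. a (i div 2) *\<^sub>R g i) = f'"
      by (simp add: sum_lessThan_double gsum a(2) flip: scaleR_add_right)
    moreover have "(\<Sum>i<2*n. a (i div 2) * t' i) = 0"
      using a(3) by (simp add: sum_lessThan_double t'_def)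
    ultimately show ?thesis using a(1) half by (intro exI[of _ "\<lambda>i. a (i div 2)"]) auto
  qed
  show ?case
    by (intro exI[of _ "2 * n"] exI[of _ g] exI[of _ t'] conjI allI impI ballI 4 5 6)
      (simp_all only: 1 2 3)
qed

text \<open>
  Removing the constant terms of a partition of unity costs at most \<open>\<Sum>i. t i = 1\<close> in norm, whence the
  constant 2.
\<close>

lemma cube_spanned_subalgebra:
  assumes J: "J \<subseteq> R" "0 \<in> J" "\<And>u v. u \<in> J \<Longrightarrow> v \<in> J \<Longrightarrow> u + v \<in> J"
      "\<And>r u. u \<in> J \<Longrightarrow> r *\<^sub>R u \<in> J" "\<And>u v. u \<in> J \<Longrightarrow> v \<in> J \<Longrightarrow> u \<cdot> v \<in> J"
  shows "cube_spanned J"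
  unfolding cube_spanned_def
proof (intro allI impI)
  fix F :: "('v \<Rightarrow>\<^sub>L 'v) set" assume F: "finite F" "F \<subseteq> J \<inter> cball 0 1"
  obtain n :: nat and h t where
    ht: "\<forall>i<n. positive (h i) \<and> h i - t i *\<^sub>R id_blinfun \<in> J \<and> 0 \<le> t i"
    and sums: "(\<Sum>i<n. h i) = id_blinfun" "(\<Sum>i<n. t i) = 1"
    and FF: "\<forall>f\<in>F. \<exists>a. (\<forall>i<n. \<bar>a i\<bar> \<le> (1::real)) \<and> f = (\<Sum>i<n. a i *\<^sub>R h i) \<and> (\<Sum>i<n. a i * t i) = 0"
    using partition_exists[OF J(1,3,4,5) F J(2)] by auto
  note h = ht[rule_format, THEN conjunct1] ht[rule_format, THEN conjunct2, THEN conjunct1]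
    ht[rule_format, THEN conjunct2, THEN conjunct2] sums
  define x where "x i = h i - t i *\<^sub>R id_blinfun" for i
  have eq: "(\<Sum>i<n. a i *\<^sub>R x i) = (\<Sum>i<n. a i *\<^sub>R h i) - (\<Sum>i<n. a i * t i) *\<^sub>R id_blinfun" for a
    by (simp add: x_def scaleR_diff_right sum_subtractf scaleR_sum_left)
  have bound: "norm (\<Sum>i<n. a i *\<^sub>R x i) \<le> 2" if a: "\<And>i. i < n \<Longrightarrow> \<bar>a i\<bar> \<le> 1" for a
  proof -
    have "\<bar>\<Sum>i<n. a i * t i\<bar> \<le> (\<Sum>i<n. t i)"
      using a h(3) by (intro order_trans[OF sum_abs] sum_mono) (auto simp: abs_mult mult_left_le_one_le)
    then have "\<bar>\<Sum>i<n. a i * t i\<bar> * norm (id_blinfun :: 'v \<Rightarrow>\<^sub>L 'v) \<le> 1 * 1"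
      using h(5) norm_one_le by (intro mult_mono) auto
    then show ?thesis unfolding eq
      using norm_combination_le_one[OF h(1,4), of a] a
        norm_triangle_ineq4[of "\<Sum>i<n. a i *\<^sub>R h i" "(\<Sum>i<n. a i * t i) *\<^sub>R id_blinfun"] by simp
  qed
  have repr: "\<exists>a. (\<forall>i<n. \<bar>a i\<bar> \<le> 1) \<and> f = (\<Sum>i<n. a i *\<^sub>R x i)" if "f \<in> F" for f
    using bspec[OF FF that] by (auto simp: eq)
  show "\<exists>(n::nat) h. (\<forall>i<n. h i \<in> J) \<and>
        (\<forall>f\<in>F. \<exists>a. (\<forall>i<n. \<bar>a i\<bar> \<le> 1) \<and> f = (\<Sum>i<n. a i *\<^sub>R h i)) \<and>
        (\<forall>a. (\<forall>i<n. \<bar>a i\<bar> \<le> 1) \<longrightarrow> norm (\<Sum>i<n. a i *\<^sub>R h i) \<le> 2)"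
    by (intro exI[of _ n] exI[of _ x]) (use h(2) bound repr in \<open>auto simp: x_def\<close>)
qed

end

section \<open>Reproducing kernel Hilbert spaces\<close>

definition psd_on :: "'x set \<Rightarrow> ('x \<Rightarrow> 'x \<Rightarrow> real) \<Rightarrow> bool" where
  "psd_on X k \<longleftrightarrow> (\<forall>x\<in>X. \<forall>y\<in>X. k y x = k x y) \<and>
     (\<forall>S c. finite S \<longrightarrow> S \<subseteq> X \<longrightarrow> 0 \<le> (\<Sum>x\<in>S. \<Sum>y\<in>S. c x * c y * k x y))"

lemma discriminant_le:
  fixes a b c :: real
  assumes "\<And>t. 0 \<le> a + 2 * t * b + t\<^sup>2 * c" "0 \<le> c"
  shows "b\<^sup>2 \<le> a * c"
proof (cases "c = 0")
  case True
  have "b = 0"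
  proof (rule ccontr)
    assume "b \<noteq> 0"
    then show False using assms(1)[of "- (a + 1) / (2 * b)"] True by (simp add: field_simps)
  qed
  then show ?thesis using True by simp
next
  case False
  then have "c > 0" using assms by simp
  then show ?thesis using assms(1)[of "- b / c"] by (simp add: field_simps power2_eq_square)
qed

text \<open>
  The reproducing kernel Hilbert space of a kernel \<open>k\<close>: the completion of the span of the functions
  \<open>k x\<close>, realized as a space of functions on the domain of \<open>k\<close>. A finite linear combination of
  the \<open>k x\<close> is given by a list of coefficients and points, so that sums are concatenations and no
  vector space of combinations has to be set up; \<open>val\<close> is the function that a list stands for,
  \<open>form\<close> the (possibly degenerate) inner product.
\<close>

locale psd_kernel =
  fixes k :: "'x \<Rightarrow> 'x \<Rightarrow> real"
  assumes psd: "psd_on UNIV k"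
begin

definition val :: "(complex \<times> 'x) list \<Rightarrow> 'x \<Rightarrow> complex" where
  "val c y = (\<Sum>(a, x)\<leftarrow>c. a * of_real (k x y))"

definition form :: "(complex \<times> 'x) list \<Rightarrow> (complex \<times> 'x) list \<Rightarrow> complex" where
  "form c d = (\<Sum>(b, y)\<leftarrow>d. cnj b * val c y)"

definition smul :: "complex \<Rightarrow> (complex \<times> 'x) list \<Rightarrow> (complex \<times> 'x) list" where
  "smul a = map (\<lambda>(b, x). (a * b, x))"

definition nrm :: "(complex \<times> 'x) list \<Rightarrow> real" where
  "nrm c = sqrt (Re (form c c))"

definition sub :: "(complex \<times> 'x) list \<Rightarrow> (complex \<times> 'x) list \<Rightarrow> (complex \<times> 'x) list" where
  "sub c d = c @ smul (-1) d"

lemma k_commute: "k y x = k x y"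
  using psd by (auto simp: psd_on_def)

lemma val_Nil [simp]: "val [] y = 0" by (simp add: val_def)
lemma val_Cons: "val (p # c) y = fst p * of_real (k (snd p) y) + val c y"
  by (simp add: val_def case_prod_unfold)
lemma val_append: "val (c @ d) y = val c y + val d y"
  by (simp add: val_def)
lemma val_smul: "val (smul a c) y = a * val c y"
  by (induction c) (auto simp: val_Cons smul_def algebra_simps)
lemma val_sub: "val (sub c d) y = val c y - val d y"
  by (simp add: sub_def val_append val_smul)

lemma form_Nil_right [simp]: "form c [] = 0" by (simp add: form_def)
lemma form_Cons_right: "form c (p # d) = cnj (fst p) * val c (snd p) + form c d"
  by (simp add: form_def case_prod_unfold)
lemma form_append_right: "form c (d @ e) = form c d + form c e"
  by (simp add: form_def)
lemma form_append_left: "form (c @ d) e = form c e + form d e"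
  by (induction e) (auto simp: form_Cons_right val_append algebra_simps)
lemma form_smul_left: "form (smul a c) d = a * form c d"
  by (induction d) (auto simp: form_Cons_right val_smul algebra_simps)
lemma form_smul_right: "form c (smul a d) = cnj a * form c d"
  by (induction d) (auto simp: form_Cons_right smul_def algebra_simps)
lemma form_sub_left: "form (sub c d) e = form c e - form d e"
  by (simp add: sub_def form_append_left form_smul_left)
lemma form_sub_right: "form c (sub d e) = form c d - form c e"
  by (simp add: sub_def form_append_right form_smul_right)
lemma form_Nil_left [simp]: "form [] d = 0"
  by (induction d) (auto simp: form_Cons_right)

lemma form_point: "form c [(1, y)] = val c y"
  by (simp add: form_Cons_right)

lemma form_commute: "form d c = cnj (form c d)"
proof (induction c)
  case (Cons p c)
  have "form [p] d = fst p * cnj (val d (snd p))"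
    by (induction d) (auto simp: form_Cons_right val_Cons algebra_simps k_commute)
  moreover have "form (p # c) d = form [p] d + form c d"
    using form_append_left[of "[p]" c d] by simp
  ultimately show ?case using Cons by (simp add: form_Cons_right)
qed simp

text \<open>
  Collects the coefficients that belong to the same point; a list may repeat points, whereas
  positive semidefiniteness speaks of sums over sets.
\<close>

lemma sum_list_by_points:
  fixes g :: "'x \<Rightarrow> complex"
  assumes "finite S" "snd ` set c \<subseteq> S"
  shows "(\<Sum>(a, x)\<leftarrow>c. h a * g x) = (\<Sum>x\<in>S. (\<Sum>(a, x')\<leftarrow>c. if x' = x then h a else 0) * g x)"
  using assms(2)
proof (induction c)
  case (Cons p c)
  obtain a x0 where p: "p = (a, x0)" by force
  have "(\<Sum>x\<in>S. (if x0 = x then h a else 0) * g x) = (\<Sum>x\<in>S. if x0 = x then h a * g x0 else 0)"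
    by (intro sum.cong) auto
  also have "\<dots> = h a * g x0" using Cons.prems assms(1) p by simp
  finally show ?case using Cons by (simp add: p distrib_right sum.distrib)
qed simp

lemma form_self_nonneg: "0 \<le> Re (form c c)"
proof -
  let ?S = "snd ` set c"
  define C where "C x = (\<Sum>(a, x')\<leftarrow>c. if x' = x then a else 0)" for x
  have cnjC: "cnj (C x) = (\<Sum>(a, x')\<leftarrow>c. if x' = x then cnj a else 0)" for x
    unfolding C_def by (induction c) auto
  have "val c y = (\<Sum>x\<in>?S. C x * of_real (k x y))" for y
    unfolding val_def C_def using sum_list_by_points[of ?S c "\<lambda>a. a"] by simp
  then have "form c c = (\<Sum>y\<in>?S. cnj (C y) * (\<Sum>x\<in>?S. C x * of_real (k x y)))"
    unfolding form_def cnjC using sum_list_by_points[of ?S c cnj] by simp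
  then have "Re (form c c) = (\<Sum>y\<in>?S. \<Sum>x\<in>?S. Re (C y) * Re (C x) * k x y) +
      (\<Sum>y\<in>?S. \<Sum>x\<in>?S. Im (C y) * Im (C x) * k x y)"
    by (simp add: sum_distrib_left sum.distrib[symmetric] algebra_simps)
  also have "\<dots> = (\<Sum>y\<in>?S. \<Sum>x\<in>?S. Re (C y) * Re (C x) * k y x) +
      (\<Sum>y\<in>?S. \<Sum>x\<in>?S. Im (C y) * Im (C x) * k y x)"
    by (simp add: k_commute)
  also have "\<dots> \<ge> 0"
    using psd by (intro add_nonneg_nonneg) (auto simp: psd_on_def)
  finally show ?thesis .
qed

lemma nrm_nonneg: "0 \<le> nrm c" by (simp add: nrm_def form_self_nonneg)
lemma nrm_power2: "(nrm c)\<^sup>2 = Re (form c c)" by (simp add: nrm_def form_self_nonneg)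

lemma nrm_smul: "nrm (smul a c) = cmod a * nrm c"
proof -
  have "form (smul a c) (smul a c) = of_real ((cmod a)\<^sup>2) * form c c"
    using complex_norm_square[of a] by (simp add: form_smul_left form_smul_right mult.assoc)
  then show ?thesis by (simp add: nrm_def real_sqrt_mult)
qed

lemma Re_form_le: "Re (form c d) \<le> nrm c * nrm d"
proof -
  have "0 \<le> Re (form c c) + 2 * t * Re (form c d) + t\<^sup>2 * Re (form d d)" for t
  proof -
    have "Re (form d c) = Re (form c d)" using form_commute[of d c] by simp
    then show ?thesis
      using form_self_nonneg[of "c @ smul (of_real t) d"]
      by (simp add: form_append_left form_append_right form_smul_left form_smul_right
          power2_eq_square algebra_simps)
  qed
  then have "(Re (form c d))\<^sup>2 \<le> (nrm c * nrm d)\<^sup>2"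
    using discriminant_le form_self_nonneg by (simp add: power_mult_distrib nrm_power2)
  then show ?thesis using nrm_nonneg by (simp add: power2_le_iff_abs_le abs_le_iff)
qed

lemma form_Cauchy_Schwarz: "cmod (form c d) \<le> nrm c * nrm d"
proof (cases "form c d = 0")
  case True
  then show ?thesis by (simp add: nrm_nonneg)
next
  case False
  let ?w = "form c d"
  let ?a = "cnj ?w / of_real (cmod ?w)"
  have "form (smul ?a c) d = of_real (cmod ?w)"
    using False by (simp add: form_smul_left complex_norm_square[symmetric] power2_eq_square
        mult.commute[of "cnj _"])
  then have "cmod ?w \<le> cmod ?a * nrm c * nrm d"
    using Re_form_le[of "smul ?a c" d] by (simp add: nrm_smul)
  then show ?thesis using False by (simp add: norm_divide)
qed

lemma nrm_append: "nrm (c @ d) \<le> nrm c + nrm d"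
proof (rule power2_le_imp_le)
  have "Re (form d c) = Re (form c d)" using form_commute[of d c] by simp
  then have "(nrm (c @ d))\<^sup>2 = (nrm c)\<^sup>2 + 2 * Re (form c d) + (nrm d)\<^sup>2"
    by (simp add: nrm_power2 form_append_left form_append_right)
  then show "(nrm (c @ d))\<^sup>2 \<le> (nrm c + nrm d)\<^sup>2"
    using Re_form_le[of c d] by (simp add: power2_sum)
qed (simp add: nrm_nonneg)

lemma nrm_cong: "(\<And>e. form c e = form d e) \<Longrightarrow> nrm c = nrm d"
  unfolding nrm_def by (metis form_commute)

lemma nrm_sub_commute: "nrm (sub c d) = nrm (sub d c)"
proof -
  have "nrm (sub c d) = nrm (smul (-1) (sub d c))"
    by (rule nrm_cong) (simp add: form_sub_left form_smul_left)
  then show ?thesis by (simp add: nrm_smul)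
qed

lemma nrm_le_sub: "nrm c \<le> nrm (sub c d) + nrm d"
proof -
  have "nrm c = nrm (sub c d @ d)"
    by (rule nrm_cong) (simp add: form_sub_left form_append_left)
  then show ?thesis using nrm_append by simp
qed

text \<open>
  A point of the completion is the pointwise limit \<open>f\<close> of a sequence of combinations that is Cauchy
  for the seminorm. The pointwise limits exist for every Cauchy sequence because evaluation at \<open>y\<close> is the
  inner product with \<open>k y\<close>.
\<close>

definition represents :: "('x \<Rightarrow> complex) \<Rightarrow> (nat \<Rightarrow> (complex \<times> 'x) list) \<Rightarrow> bool" where
  "represents f s \<longleftrightarrow> (\<forall>e>0. \<exists>N. \<forall>m\<ge>N. \<forall>n\<ge>N. nrm (sub (s m) (s n)) < e) \<and>
     (\<forall>y. (\<lambda>n. val (s n) y) \<longlonglongrightarrow> f y)"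

lemma representsD_Cauchy:
  "represents f s \<Longrightarrow> e > 0 \<Longrightarrow> \<exists>N. \<forall>m\<ge>N. \<forall>n\<ge>N. nrm (sub (s m) (s n)) < e"
  by (simp add: represents_def)

lemma representsD_val: "represents f s \<Longrightarrow> (\<lambda>n. val (s n) y) \<longlonglongrightarrow> f y"
  by (simp add: represents_def)

lemma represents_const: "represents (val c) (\<lambda>_. c)"
proof -
  have "nrm (sub c c) = 0" by (simp add: nrm_def form_sub_left)
  then show ?thesis by (simp add: represents_def)
qed

lemma represents_add:
  assumes "represents f s" "represents g t"
  shows "represents (\<lambda>x. f x + g x) (\<lambda>n. s n @ t n)"
  unfolding represents_def
proof (intro conjI allI impI)
  fix e :: real assume "e > 0"
  then obtain M N where M: "\<forall>m\<ge>M. \<forall>n\<ge>M. nrm (sub (s m) (s n)) < e / 2"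
    and N: "\<forall>m\<ge>N. \<forall>n\<ge>N. nrm (sub (t m) (t n)) < e / 2"
    using representsD_Cauchy[OF assms(1), of "e/2"] representsD_Cauchy[OF assms(2), of "e/2"] by auto
  have "nrm (sub (s m @ t m) (s n @ t n)) < e" if "m \<ge> max M N" "n \<ge> max M N" for m n
  proof -
    have "nrm (sub (s m @ t m) (s n @ t n)) = nrm (sub (s m) (s n) @ sub (t m) (t n))"
      by (rule nrm_cong) (simp add: form_sub_left form_append_left)
    also have "\<dots> \<le> nrm (sub (s m) (s n)) + nrm (sub (t m) (t n))" by (rule nrm_append)
    also have "\<dots> < e" using M[rule_format, of m n] N[rule_format, of m n] that by simp
    finally show ?thesis .
  qed
  then show "\<exists>N. \<forall>m\<ge>N. \<forall>n\<ge>N. nrm (sub (s m @ t m) (s n @ t n)) < e" by blast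
next
  fix y show "(\<lambda>n. val (s n @ t n) y) \<longlonglongrightarrow> f y + g y"
    unfolding val_append by (intro tendsto_add representsD_val assms)
qed

lemma represents_smul:
  assumes "represents f s" shows "represents (\<lambda>x. a * f x) (\<lambda>n. smul a (s n))"
  unfolding represents_def
proof (intro conjI allI impI)
  fix e :: real assume "e > 0"
  then have "e / (cmod a + 1) > 0" by (simp add: add_nonneg_pos)
  then obtain N where N: "\<forall>m\<ge>N. \<forall>n\<ge>N. nrm (sub (s m) (s n)) < e / (cmod a + 1)"
    using representsD_Cauchy[OF assms] by blast
  have "nrm (sub (smul a (s m)) (smul a (s n))) < e" if "m \<ge> N" "n \<ge> N" for m n
  proof -
    have "nrm (sub (smul a (s m)) (smul a (s n))) = nrm (smul a (sub (s m) (s n)))"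
      by (rule nrm_cong) (simp add: form_sub_left form_smul_left algebra_simps)
    also have "\<dots> \<le> (cmod a + 1) * nrm (sub (s m) (s n))"
      by (simp add: nrm_smul nrm_nonneg mult_right_mono)
    also have "\<dots> < e"
      using N[rule_format, OF that] add_nonneg_pos[OF norm_ge_zero[of a], of 1]
      by (simp add: pos_less_divide_eq mult.commute)
    finally show ?thesis .
  qed
  then show "\<exists>N. \<forall>m\<ge>N. \<forall>n\<ge>N. nrm (sub (smul a (s m)) (smul a (s n))) < e" by blast
next
  fix y show "(\<lambda>n. val (smul a (s n)) y) \<longlonglongrightarrow> a * f y"
    unfolding val_smul by (intro tendsto_intros representsD_val assms)
qed

lemma represents_sub:
  assumes "represents f s" "represents g t"
  shows "represents (\<lambda>x. f x - g x) (\<lambda>n. sub (s n) (t n))"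
  using represents_add[OF assms(1) represents_smul[OF assms(2), of "-1"]] by (simp add: sub_def)

lemma represents_bounded:
  assumes "represents f s" shows "\<exists>M>0. \<forall>\<^sub>F n in sequentially. nrm (s n) \<le> M"
proof -
  obtain N where N: "\<forall>m\<ge>N. \<forall>n\<ge>N. nrm (sub (s m) (s n)) < 1"
    using representsD_Cauchy[OF assms, of 1] by auto
  have "\<forall>n\<ge>N. nrm (s n) \<le> 1 + nrm (s N)"
    using N nrm_le_sub[of _ "s N"] by (meson add_right_mono less_imp_le order_refl order_trans)
  then show ?thesis
    by (intro exI[of _ "1 + nrm (s N)"]) (auto simp: eventually_sequentially nrm_nonneg add_pos_nonneg)
qed

lemma form_tendsto_fixed:
  assumes "\<And>y. (\<lambda>n. val (s n) y) \<longlonglongrightarrow> f y"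
  shows "(\<lambda>n. form (s n) d) \<longlonglongrightarrow> (\<Sum>(b, y)\<leftarrow>d. cnj b * f y)"
  by (induction d) (auto simp: form_Cons_right intro!: tendsto_intros assms)

text \<open>
  The inner product of the completion is well defined because a Cauchy sequence with pointwise limit 0
  is a null sequence. Fixing a late term \<open>s N\<close>, the seminorm squared of \<open>s n\<close> is
  \<open>\<langle>s n, s n - s N\<rangle> + \<langle>s n, s N\<rangle>\<close>: the first summand is small by the Cauchy property, and the second tends
  to 0 since it is a fixed finite combination of values of \<open>s n\<close>.
\<close>

lemma represents_zero:
  assumes "represents (\<lambda>_. 0) s" shows "(\<lambda>n. nrm (s n)) \<longlonglongrightarrow> 0"
proof -
  obtain M where M: "M > 0" "\<forall>\<^sub>F n in sequentially. nrm (s n) \<le> M"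
    using represents_bounded[OF assms] by auto
  have "(\<lambda>n. (nrm (s n))\<^sup>2) \<longlonglongrightarrow> 0"
  proof (rule LIMSEQ_I)
    fix e :: real assume e: "e > 0"
    then have "e / (2 * M) > 0" using M by simp
    then obtain N where N: "\<forall>m\<ge>N. \<forall>n\<ge>N. nrm (sub (s m) (s n)) < e / (2 * M)"
      using representsD_Cauchy[OF assms] by blast
    have "(\<lambda>n. form (s n) (s N)) \<longlonglongrightarrow> (\<Sum>(b, y)\<leftarrow>s N. cnj b * 0)"
      by (rule form_tendsto_fixed) (rule representsD_val[OF assms])
    then have "(\<lambda>n. form (s n) (s N)) \<longlonglongrightarrow> 0" by (simp add: case_prod_unfold)
    then have "\<forall>\<^sub>F n in sequentially. cmod (form (s n) (s N)) < e / 2"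
      using e by (auto dest!: tendstoD[of _ _ _ "e/2"])
    with M(2) eventually_ge_at_top[of N]
    have "\<forall>\<^sub>F n in sequentially. norm ((nrm (s n))\<^sup>2 - 0) < e"
    proof eventually_elim
      case (elim n)
      have "(nrm (s n))\<^sup>2 = Re (form (s n) (sub (s n) (s N))) + Re (form (s n) (s N))"
        by (simp add: nrm_power2 form_sub_right)
      also have "\<dots> \<le> nrm (s n) * nrm (sub (s n) (s N)) + cmod (form (s n) (s N))"
        using Re_form_le complex_Re_le_cmod by (intro add_mono)
      also have "\<dots> \<le> M * (e / (2 * M)) + cmod (form (s n) (s N))"
        using elim N M(1) by (intro add_right_mono mult_mono) (auto simp: nrm_nonneg less_imp_le)
      also have "\<dots> < e" using elim M(1) by simp
      finally show ?case by simp
    qed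
    then show "\<exists>no. \<forall>n\<ge>no. norm ((nrm (s n))\<^sup>2 - 0) < e" by (simp add: eventually_sequentially)
  qed
  then have "(\<lambda>n. sqrt ((nrm (s n))\<^sup>2)) \<longlonglongrightarrow> sqrt 0" by (rule tendsto_real_sqrt)
  then show ?thesis by (simp add: nrm_nonneg)
qed

definition ip :: "('x \<Rightarrow> complex) \<Rightarrow> ('x \<Rightarrow> complex) \<Rightarrow> complex" where
  "ip f g = lim (\<lambda>n. form ((SOME s. represents f s) n) ((SOME t. represents g t) n))"

lemma form_diff_le:
  "cmod (form c d - form c' d') \<le> nrm (sub c c') * nrm d + nrm c' * nrm (sub d d')"
proof -
  have "form c d - form c' d' = form (sub c c') d + form c' (sub d d')"
    by (simp add: form_sub_left form_sub_right)
  then show ?thesis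
    using norm_triangle_ineq[of "form (sub c c') d" "form c' (sub d d')"]
      form_Cauchy_Schwarz[of "sub c c'" d] form_Cauchy_Schwarz[of c' "sub d d'"] by simp
qed

lemma form_tendsto_ip:
  assumes f: "represents f s" and g: "represents g t"
  shows "(\<lambda>n. form (s n) (t n)) \<longlonglongrightarrow> ip f g"
proof -
  define s' where "s' = (SOME s. represents f s)"
  define t' where "t' = (SOME t. represents g t)"
  have f': "represents f s'" and g': "represents g t'"
    unfolding s'_def t'_def using f g by (metis someI_ex)+
  obtain M where M: "M > 0" "\<forall>\<^sub>F n in sequentially. nrm (s' n) \<le> M"
    using represents_bounded[OF f'] by auto
  obtain L where L: "L > 0" "\<forall>\<^sub>F n in sequentially. nrm (t' n) \<le> L"
    using represents_bounded[OF g'] by auto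
  have "Cauchy (\<lambda>n. form (s' n) (t' n))"
  proof (rule CauchyI)
    fix e :: real assume e: "e > 0"
    obtain N1 where N1: "\<forall>m\<ge>N1. \<forall>n\<ge>N1. nrm (sub (s' m) (s' n)) < e / (2 * L)"
      using representsD_Cauchy[OF f', of "e / (2 * L)"] e L by auto
    obtain N2 where N2: "\<forall>m\<ge>N2. \<forall>n\<ge>N2. nrm (sub (t' m) (t' n)) < e / (2 * M)"
      using representsD_Cauchy[OF g', of "e / (2 * M)"] e M by auto
    obtain N3 where N3: "\<forall>n\<ge>N3. nrm (s' n) \<le> M \<and> nrm (t' n) \<le> L"
      using eventually_conj[OF M(2) L(2)] by (auto simp: eventually_sequentially)
    have "norm (form (s' m) (t' m) - form (s' n) (t' n)) < e"
      if "m \<ge> max N1 (max N2 N3)" "n \<ge> max N1 (max N2 N3)" for m n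
    proof -
      have "norm (form (s' m) (t' m) - form (s' n) (t' n)) \<le>
          nrm (sub (s' m) (s' n)) * nrm (t' m) + nrm (s' n) * nrm (sub (t' m) (t' n))"
        by (rule form_diff_le)
      also have "\<dots> \<le> nrm (sub (s' m) (s' n)) * L + M * nrm (sub (t' m) (t' n))"
        using N3 that by (intro add_mono mult_mono) (auto simp: nrm_nonneg M L less_imp_le)
      also have "\<dots> < e / (2 * L) * L + M * (e / (2 * M))"
        using N1 N2 that M L by (intro add_strict_mono mult_strict_right_mono mult_strict_left_mono) auto
      also have "\<dots> = e" using M L by simp
      finally show ?thesis .
    qed
    then show "\<exists>N. \<forall>m\<ge>N. \<forall>n\<ge>N. norm (form (s' m) (t' m) - form (s' n) (t' n)) < e" by blast
  qed
  then have lim: "(\<lambda>n. form (s' n) (t' n)) \<longlonglongrightarrow> ip f g"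
    unfolding ip_def s'_def[symmetric] t'_def[symmetric]
    by (simp add: Cauchy_convergent convergent_LIMSEQ_iff[symmetric])
  obtain L' where L': "L' > 0" "\<forall>\<^sub>F n in sequentially. nrm (t n) \<le> L'"
    using represents_bounded[OF g] by auto
  have s0: "(\<lambda>n. nrm (sub (s n) (s' n))) \<longlonglongrightarrow> 0" and t0: "(\<lambda>n. nrm (sub (t n) (t' n))) \<longlonglongrightarrow> 0"
    using represents_sub[OF f f'] represents_sub[OF g g'] by (auto intro: represents_zero)
  have "(\<lambda>n. form (s n) (t n) - form (s' n) (t' n)) \<longlonglongrightarrow> 0"
  proof (rule Lim_null_comparison)
    show "(\<lambda>n. nrm (sub (s n) (s' n)) * L' + M * nrm (sub (t n) (t' n))) \<longlonglongrightarrow> 0"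
      using s0 t0 by (auto intro!: tendsto_eq_intros)
    show "\<forall>\<^sub>F n in sequentially. norm (form (s n) (t n) - form (s' n) (t' n)) \<le>
        nrm (sub (s n) (s' n)) * L' + M * nrm (sub (t n) (t' n))"
      using M(2) L'(2)
    proof eventually_elim
      case (elim n)
      then have "nrm (sub (s n) (s' n)) * nrm (t n) + nrm (s' n) * nrm (sub (t n) (t' n)) \<le>
          nrm (sub (s n) (s' n)) * L' + M * nrm (sub (t n) (t' n))"
        by (intro add_mono mult_mono) (auto simp: nrm_nonneg M L' less_imp_le)
      then show ?case using form_diff_le[of "s n" "t n" "s' n" "t' n"] by linarith
    qed
  qed
  from tendsto_add[OF this lim] show ?thesis by simp
qed

definition rkhs :: "('x \<Rightarrow> complex) inner_space" where
  "rkhs = \<lparr>vectors = {f. \<exists>s. represents f s}, vadd = (\<lambda>f g x. f x + g x), vzero = (\<lambda>_. 0),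
     vscale = (\<lambda>a f x. a * f x), vinner = ip\<rparr>"

lemma rkhs_simps [simp]:
  "vectors rkhs = {f. \<exists>s. represents f s}" "vadd rkhs f g = (\<lambda>x. f x + g x)" "vzero rkhs = (\<lambda>_. 0)"
  "vscale rkhs a f = (\<lambda>x. a * f x)" "vinner rkhs = ip"
  by (simp_all add: rkhs_def)

lemma ip_eqI:
  assumes "represents f s" "represents g t" "(\<lambda>n. form (s n) (t n)) \<longlonglongrightarrow> l" shows "ip f g = l"
  using form_tendsto_ip[OF assms(1,2)] assms(3) LIMSEQ_unique by blast

sublocale complex_inner_space rkhs
proof (rule complex_inner_space.intro)
  let ?G = "\<lparr>carrier = vectors rkhs, mult = vadd rkhs, one = vzero rkhs\<rparr>"
  have "represents (\<lambda>_. 0) (\<lambda>_. [])"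
    using represents_const[of "[]"] by (simp add: represents_def)
  moreover have "\<exists>y\<in>carrier ?G. y \<otimes>\<^bsub>?G\<^esub> x = \<one>\<^bsub>?G\<^esub>" if "x \<in> carrier ?G" for x
    using that represents_smul[of x _ "-1"] by (intro bexI[of _ "\<lambda>y. - x y"]) auto
  ultimately show "comm_group ?G"
    by (intro comm_groupI) (auto simp: algebra_simps intro: represents_add)
next
  fix x y z assume "x \<in> vectors rkhs" "y \<in> vectors rkhs" "z \<in> vectors rkhs"
  then obtain s t r where r: "represents x s" "represents y t" "represents z r" by auto
  show "vinner rkhs (vadd rkhs x y) z = vinner rkhs x z + vinner rkhs y z"
    using represents_add[OF r(1,2)] r
    by (auto simp: form_append_left intro!: ip_eqI tendsto_add form_tendsto_ip)
next
  fix x y a assume "x \<in> vectors rkhs" "y \<in> vectors rkhs"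
  then obtain s t where r: "represents x s" "represents y t" by auto
  show "vinner rkhs (vscale rkhs a x) y = a * vinner rkhs x y"
    using represents_smul[OF r(1)] r
    by (auto simp: form_smul_left intro!: ip_eqI tendsto_intros form_tendsto_ip)
  have "(\<lambda>n. form (t n) (s n)) \<longlonglongrightarrow> cnj (ip x y)"
    using tendsto_cnj[OF form_tendsto_ip[OF r]] by (simp flip: form_commute)
  then show "vinner rkhs y x = cnj (vinner rkhs x y)"
    using r by (auto intro: ip_eqI)
next
  fix x assume "x \<in> vectors rkhs"
  then obtain s where r: "represents x s" by auto
  have lim: "(\<lambda>n. Re (form (s n) (s n))) \<longlonglongrightarrow> Re (ip x x)"
    by (intro tendsto_Re form_tendsto_ip r)
  then show "0 \<le> Re (vinner rkhs x x)"
    by (auto intro!: LIMSEQ_le_const form_self_nonneg)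
  assume "vinner rkhs x x = 0"
  then have "(\<lambda>n. nrm (s n)) \<longlonglongrightarrow> 0"
    using tendsto_real_sqrt[OF lim] by (simp add: nrm_def)
  then have *: "(\<lambda>n. nrm (s n) * nrm [(1, y)]) \<longlonglongrightarrow> 0" for y
    by (rule tendsto_mult_left_zero)
  have "(\<lambda>n. val (s n) y) \<longlonglongrightarrow> 0" for y
    using form_Cauchy_Schwarz[of "s _" "[(1, y)]"]
    by (intro Lim_null_comparison[OF _ *[of y]]) (auto simp: form_point)
  then show "x = vzero rkhs"
    using representsD_val[OF r] LIMSEQ_unique by fastforce
qed (auto simp: algebra_simps intro: represents_add represents_smul)

lemma vdist_rkhs_tendsto:
  assumes "represents f s" "represents g t"
  shows "(\<lambda>n. nrm (sub (s n) (t n))) \<longlonglongrightarrow> vdist rkhs f g"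
proof -
  have "vdist rkhs f g = sqrt (Re (ip (\<lambda>x. f x - g x) (\<lambda>x. f x - g x)))"
    using assms by (auto simp: vdist_def vnorm_def)
  moreover have "(\<lambda>n. nrm (sub (s n) (t n))) \<longlonglongrightarrow> \<dots>"
    unfolding nrm_def
    by (intro tendsto_real_sqrt tendsto_Re form_tendsto_ip represents_sub assms)
  ultimately show ?thesis by simp
qed

lemma val_mem: "val c \<in> vectors rkhs"
  using represents_const by auto

lemma vdist_val: "vdist rkhs (val c) (val d) = nrm (sub c d)"
  using vdist_rkhs_tendsto[OF represents_const[of c] represents_const[of d]] LIMSEQ_unique tendsto_const
  by blast

lemma dense:
  assumes f: "f \<in> vectors rkhs" and e: "e > 0" shows "\<exists>c. vdist rkhs f (val c) < e"
proof -
  obtain s where s: "represents f s" using f by auto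
  obtain N where N: "\<forall>m\<ge>N. \<forall>n\<ge>N. nrm (sub (s m) (s n)) < e / 2"
    using representsD_Cauchy[OF s, of "e/2"] e by auto
  have "vdist rkhs f (val (s N)) \<le> e / 2"
    using vdist_rkhs_tendsto[OF s represents_const[of "s N"]]
    by (rule LIMSEQ_le_const2) (use N in \<open>auto intro!: exI[of _ N] less_imp_le\<close>)
  then show ?thesis using e by (intro exI[of _ "s N"]) simp
qed

text \<open>
  A Cauchy sequence \<open>\<sigma>\<close> is approximated by combinations \<open>c n\<close> with error \<open>1 / (n + 1)\<close>; these form a
  Cauchy sequence of combinations, and the function that it represents is the limit of \<open>\<sigma>\<close>.
\<close>

lemma complex_hilbert_space_rkhs: "complex_hilbert_space rkhs"
proof
  interpret M: Metric_space "vectors rkhs" "vdist rkhs" by (rule Metric_space_vdist)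
  show "M.mcomplete"
    unfolding M.mcomplete_def
  proof (intro allI impI)
    fix \<sigma> assume \<sigma>: "M.MCauchy \<sigma>"
    then have mem: "\<sigma> n \<in> vectors rkhs" for n unfolding M.MCauchy_def by blast
    have "\<exists>c. vdist rkhs (\<sigma> n) (val c) < inverse (Suc n)" for n
      by (rule dense[OF mem]) simp
    then obtain c where c: "\<And>n. vdist rkhs (\<sigma> n) (val (c n)) < inverse (Suc n)" by metis
    have cauchy: "\<exists>N. \<forall>m\<ge>N. \<forall>n\<ge>N. nrm (sub (c m) (c n)) < e" if e: "e > 0" for e
    proof -
      obtain N1 where N1: "\<And>m n. m \<ge> N1 \<Longrightarrow> n \<ge> N1 \<Longrightarrow> vdist rkhs (\<sigma> m) (\<sigma> n) < e / 3"
        using \<sigma> e unfolding M.MCauchy_def by (meson divide_pos_pos zero_less_numeral)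
      obtain N2 where N2: "inverse (Suc N2) < e / 3" using e reals_Archimedean[of "e/3"] by auto
      have small: "vdist rkhs (\<sigma> n) (val (c n)) < e / 3" if "n \<ge> N2" for n
      proof -
        have "inverse (Suc n) \<le> inverse (Suc N2)" using that by (simp add: le_imp_inverse_le)
        then show ?thesis using c[of n] N2 by linarith
      qed
      have "nrm (sub (c m) (c n)) < e" if "m \<ge> max N1 N2" "n \<ge> max N1 N2" for m n
        using vdist_triangle[OF val_mem mem val_mem, of "c m" "c n" m]
          vdist_triangle[OF mem mem val_mem, of m "c n" n]
          vdist_commute[of "val (c m)" "\<sigma> m"] small[of m] small[of n] N1[of m n] that
        by (simp add: vdist_val)
      then show ?thesis by blast
    qed
    have "convergent (\<lambda>n. val (c n) y)" for y
    proof (rule Cauchy_convergent, rule CauchyI)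
      fix e :: real assume "e > 0"
      then have "e / (nrm [(1, y)] + 1) > 0" by (simp add: nrm_nonneg add_nonneg_pos)
      then obtain N where N: "\<forall>m\<ge>N. \<forall>n\<ge>N. nrm (sub (c m) (c n)) < e / (nrm [(1, y)] + 1)"
        using cauchy by blast
      have "norm (val (c m) y - val (c n) y) < e" if "m \<ge> N" "n \<ge> N" for m n
      proof -
        have "norm (val (c m) y - val (c n) y) \<le> nrm (sub (c m) (c n)) * nrm [(1, y)]"
          using form_Cauchy_Schwarz[of "sub (c m) (c n)" "[(1, y)]"] by (simp add: form_point val_sub)
        also have "\<dots> \<le> nrm (sub (c m) (c n)) * (nrm [(1, y)] + 1)"
          by (simp add: nrm_nonneg mult_left_mono)
        also have "\<dots> < e" using N[rule_format, OF that]
          by (simp add: pos_less_divide_eq nrm_nonneg add_nonneg_pos)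
        finally show ?thesis .
      qed
      then show "\<exists>M. \<forall>m\<ge>M. \<forall>n\<ge>M. norm (val (c m) y - val (c n) y) < e" by blast
    qed
    then obtain f where f: "\<And>y. (\<lambda>n. val (c n) y) \<longlonglongrightarrow> f y"
      unfolding convergent_def by metis
    have r: "represents f c" using cauchy f by (simp add: represents_def)
    then have fm: "f \<in> vectors rkhs" by auto
    show "\<exists>x. limitin M.mtopology \<sigma> x sequentially"
    proof (intro exI[of _ f], unfold M.limitin_metric, intro conjI allI impI)
      fix e :: real assume e: "e > 0"
      obtain N1 where N1: "\<forall>m\<ge>N1. \<forall>n\<ge>N1. nrm (sub (c m) (c n)) < e / 3"
        using cauchy[of "e/3"] e by auto
      obtain N2 where N2: "inverse (Suc N2) < e / 3" using e reals_Archimedean[of "e/3"] by auto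
      have "vdist rkhs (\<sigma> n) f < e" if n: "n \<ge> max N1 N2" for n
      proof -
        have "vdist rkhs f (val (c n)) \<le> e / 3"
          using vdist_rkhs_tendsto[OF r represents_const[of "c n"]]
          by (rule LIMSEQ_le_const2) (use N1 n in \<open>auto intro!: exI[of _ N1] less_imp_le\<close>)
        moreover have "vdist rkhs (\<sigma> n) (val (c n)) < e / 3"
        proof -
          have "inverse (Suc n) \<le> inverse (Suc N2)" using n by (simp add: le_imp_inverse_le)
          then show ?thesis using c[of n] N2 by linarith
        qed
        ultimately show ?thesis
          using vdist_triangle[OF mem val_mem fm, of n "c n"] vdist_commute[of f "val (c n)"] e by linarith
      qed
      then show "\<forall>\<^sub>F n in sequentially. \<sigma> n \<in> vectors rkhs \<and> vdist rkhs (\<sigma> n) f < e"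
        using mem unfolding eventually_sequentially by blast
    qed (rule fm)
  qed
qed

end

section \<open>Unitary representations from positive definite functions\<close>

text \<open>
  Its feature space is the orthogonal sum of those of the kernels \<open>\<kappa> N\<close>: the quadratic form splits
  into one summand for each index \<open>N\<close>.
\<close>

lemma psd_on_blocks:
  fixes X :: "'a set" and \<kappa> :: "'b \<Rightarrow> 'a \<Rightarrow> 'a \<Rightarrow> real"
  assumes \<kappa>: "\<And>N. psd_on X (\<kappa> N)"
  shows "psd_on UNIV (\<lambda>(g, N) (h, N'). if g \<in> X \<and> h \<in> X \<and> N = N' then \<kappa> N g h else 0)"
    (is "psd_on UNIV ?k")
  unfolding psd_on_def
proof (intro conjI ballI allI impI)
  show "?k y x = ?k x y" for x y
    using \<kappa> by (auto simp: psd_on_def split: prod.split)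
next
  fix S :: "('a \<times> 'b) set" and c :: "'a \<times> 'b \<Rightarrow> real"
  assume S: "finite S"
  define A where "A = fst ` S \<inter> X"
  define P where "P = snd ` S"
  have fin: "finite A" "finite P" using S by (auto simp: A_def P_def)
  define d where "d x = (if x \<in> S then c x else 0)" for x
  \<comment> \<open>Extending the coefficients by 0 to a product set lets the two coordinates be summed separately.\<close>
  have "(\<Sum>x\<in>S. \<Sum>y\<in>S. c x * c y * ?k x y) = (\<Sum>x\<in>S. \<Sum>y\<in>A \<times> P. d x * d y * ?k x y)"
  proof (rule sum.cong[OF refl])
    fix x assume x: "x \<in> S"
    have "(\<Sum>y\<in>S. c x * c y * ?k x y) = (\<Sum>y\<in>S \<inter> (A \<times> P). c x * c y * ?k x y)"
      by (rule sum.mono_neutral_right)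
        (use S in \<open>auto simp: A_def P_def split: prod.splits intro: rev_image_eqI\<close>)
    also have "\<dots> = (\<Sum>y\<in>S \<inter> (A \<times> P). d x * d y * ?k x y)"
      using x by (intro sum.cong) (auto simp: d_def)
    also have "\<dots> = (\<Sum>y\<in>A \<times> P. d x * d y * ?k x y)"
      using fin by (intro sum.mono_neutral_left) (auto simp: d_def)
    finally show "(\<Sum>y\<in>S. c x * c y * ?k x y) = (\<Sum>y\<in>A \<times> P. d x * d y * ?k x y)" .
  qed
  also have "\<dots> = (\<Sum>x\<in>S \<inter> (A \<times> P). \<Sum>y\<in>A \<times> P. d x * d y * ?k x y)"
    by (rule sum.mono_neutral_right)
      (use S in \<open>auto simp: A_def P_def split: prod.splits if_splits intro!: sum.neutral intro: rev_image_eqI\<close>)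
  also have "\<dots> = (\<Sum>x\<in>A \<times> P. \<Sum>y\<in>A \<times> P. d x * d y * ?k x y)"
    using fin by (intro sum.mono_neutral_left) (auto simp: d_def intro!: sum.neutral)
  also have "\<dots> = (\<Sum>g\<in>A. \<Sum>N\<in>P. \<Sum>h\<in>A. \<Sum>N'\<in>P. d (g, N) * d (h, N') * ?k (g, N) (h, N'))"
    by (simp add: sum.cartesian_product')
  also have "\<dots> = (\<Sum>g\<in>A. \<Sum>N\<in>P. \<Sum>h\<in>A. d (g, N) * d (h, N) * \<kappa> N g h)"
  proof (intro sum.cong refl)
    fix g N h assume *: "g \<in> A" "N \<in> P" "h \<in> A"
    have "(\<Sum>N'\<in>P. d (g, N) * d (h, N') * ?k (g, N) (h, N')) =
        (\<Sum>N'\<in>P. if N' = N then d (g, N) * d (h, N) * \<kappa> N g h else 0)"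
      using * by (intro sum.cong) (auto simp: A_def)
    then show "(\<Sum>N'\<in>P. d (g, N) * d (h, N') * ?k (g, N) (h, N')) = d (g, N) * d (h, N) * \<kappa> N g h"
      using fin * by simp
  qed
  also have "\<dots> = (\<Sum>N\<in>P. \<Sum>g\<in>A. \<Sum>h\<in>A. d (g, N) * d (h, N) * \<kappa> N g h)"
    by (rule sum.swap)
  also have "\<dots> \<ge> 0"
  proof (rule sum_nonneg)
    fix N
    have "A \<subseteq> X" by (auto simp: A_def)
    then show "0 \<le> (\<Sum>g\<in>A. \<Sum>h\<in>A. d (g, N) * d (h, N) * \<kappa> N g h)"
      using \<kappa>[of N] fin unfolding psd_on_def
      by (elim conjE allE[of _ A] allE[of _ "\<lambda>g. d (g, N)"]) simp
  qed
  finally show "0 \<le> (\<Sum>x\<in>S. \<Sum>y\<in>S. c x * c y * ?k x y)" .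
qed

text \<open>
  A bijection \<open>\<tau>\<close> with inverse \<open>\<tau>'\<close> that preserves the kernel acts on the Hilbert space by the unitary
  \<open>f \<mapsto> f \<circ> \<tau>'\<close>, which sends the combination with points \<open>x\<close> to the one with points \<open>\<tau> x\<close>.
\<close>

context psd_kernel
begin

lemma
  assumes \<tau>: "\<And>x. \<tau> (\<tau>' x) = x" and k: "\<And>x y. k (\<tau> x) (\<tau> y) = k x y"
  shows val_map: "val (map (apsnd \<tau>) c) = val c \<circ> \<tau>'"
    and form_map: "(\<And>x. \<tau>' (\<tau> x) = x) \<Longrightarrow> form (map (apsnd \<tau>) c) (map (apsnd \<tau>) d) = form c d"
proof -
  have "k (\<tau> x) y = k x (\<tau>' y)" for x y using k[of x "\<tau>' y"] \<tau> by simp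
  then have *: "val (map (apsnd \<tau>) c) y = val c (\<tau>' y)" for y
    by (induction c) (auto simp: val_Cons)
  then show "val (map (apsnd \<tau>) c) = val c \<circ> \<tau>'" by auto
  assume "\<And>x. \<tau>' (\<tau> x) = x"
  then show "form (map (apsnd \<tau>) c) (map (apsnd \<tau>) d) = form c d"
    by (induction d) (auto simp: form_Cons_right *)
qed

lemma sub_map: "sub (map (apsnd \<tau>) c) (map (apsnd \<tau>) d) = map (apsnd \<tau>) (sub c d)"
  by (auto simp: sub_def smul_def)

lemma represents_map:
  assumes \<tau>: "\<And>x. \<tau> (\<tau>' x) = x" "\<And>x. \<tau>' (\<tau> x) = x" and k: "\<And>x y. k (\<tau> x) (\<tau> y) = k x y"
    and f: "represents f s"
  shows "represents (f \<circ> \<tau>') (\<lambda>n. map (apsnd \<tau>) (s n))"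
proof -
  have "nrm (sub (map (apsnd \<tau>) c) (map (apsnd \<tau>) d)) = nrm (sub c d)" for c d
    unfolding sub_map nrm_def using form_map[OF \<tau>(1) k \<tau>(2)] by simp
  then show ?thesis
    using f by (simp add: represents_def val_map[OF \<tau>(1) k])
qed

lemma ip_comp:
  assumes \<tau>: "\<And>x. \<tau> (\<tau>' x) = x" "\<And>x. \<tau>' (\<tau> x) = x" and k: "\<And>x y. k (\<tau> x) (\<tau> y) = k x y"
    and "f \<in> vectors rkhs" "g \<in> vectors rkhs"
  shows "ip (f \<circ> \<tau>') (g \<circ> \<tau>') = ip f g"
proof -
  obtain s t where r: "represents f s" "represents g t" using assms by auto
  show ?thesis
    by (rule ip_eqI[OF represents_map[OF \<tau> k r(1)] represents_map[OF \<tau> k r(2)]])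
      (simp add: form_map[OF \<tau>(1) k \<tau>(2)] form_tendsto_ip[OF r])
qed

lemma comp_mem:
  assumes \<tau>: "\<And>x. \<tau> (\<tau>' x) = x" "\<And>x. \<tau>' (\<tau> x) = x" and k: "\<And>x y. k (\<tau> x) (\<tau> y) = k x y"
    and f: "f \<in> vectors rkhs"
  shows "f \<circ> \<tau>' \<in> vectors rkhs"
  using f represents_map[OF \<tau> k] by auto

lemma comp_unitary:
  assumes \<tau>: "\<And>x. \<tau> (\<tau>' x) = x" "\<And>x. \<tau>' (\<tau> x) = x" and k: "\<And>x y. k (\<tau> x) (\<tau> y) = k x y"
  shows "(\<lambda>f\<in>vectors rkhs. f \<circ> \<tau>') \<in> carrier (unitary_group rkhs)"
proof -
  have k': "k (\<tau>' x) (\<tau>' y) = k x y" for x y using k[of "\<tau>' x" "\<tau>' y"] \<tau> by simp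
  have "bij_betw (\<lambda>f. f \<circ> \<tau>') (vectors rkhs) (vectors rkhs)"
    by (rule bij_betw_byWitness[where f' = "\<lambda>f. f \<circ> \<tau>"])
      (use comp_mem[OF \<tau> k] comp_mem[OF \<tau>(2,1) k'] \<tau> in \<open>auto simp: fun_eq_iff simp del: rkhs_simps(1)\<close>)
  then have "bij_betw (\<lambda>f\<in>vectors rkhs. f \<circ> \<tau>') (vectors rkhs) (vectors rkhs)"
    by (simp only: bij_betw_restrict_eq)
  then show ?thesis
    using vadd_closed vscale_closed ip_comp[OF \<tau> k]
    by (simp add: unitary_group_def fun_eq_iff comp_def del: rkhs_simps(1))
qed

lemma vdist_comp:
  assumes \<tau>: "\<And>x. \<tau> (\<tau>' x) = x" "\<And>x. \<tau>' (\<tau> x) = x" and k: "\<And>x y. k (\<tau> x) (\<tau> y) = k x y"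
    and fg: "f \<in> vectors rkhs" "g \<in> vectors rkhs"
  shows "vdist rkhs (f \<circ> \<tau>') (g \<circ> \<tau>') = vdist rkhs f g"
proof -
  let ?d = "\<lambda>x. f x + (-1) * g x"
  have "?d \<in> vectors rkhs"
    using vadd_closed[OF fg(1) vscale_closed[OF fg(2), of "-1"]] by simp
  then have "ip (?d \<circ> \<tau>') (?d \<circ> \<tau>') = ip ?d ?d" by (intro ip_comp[OF \<tau> k])
  then show ?thesis
    using fg comp_mem[OF \<tau> k]
    by (simp add: vdist_def vnorm_def comp_def del: rkhs_simps(1))
qed

lemma nrm_sub_points: "nrm (sub [(a, x)] [(a, y)]) = cmod a * sqrt (k x x + k y y - 2 * k x y)"
proof -
  have "form (sub [(a, x)] [(a, y)]) (sub [(a, x)] [(a, y)]) =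
      a * cnj a * of_real (k x x + k y y - 2 * k x y)"
    by (simp add: form_sub_left form_sub_right form_Cons_right val_Cons val_sub k_commute[of y x] algebra_simps)
  also have "\<dots> = of_real ((cmod a)\<^sup>2 * (k x x + k y y - 2 * k x y))"
    by (simp add: complex_norm_square[symmetric])
  finally show ?thesis by (simp add: nrm_def real_sqrt_mult)
qed

end

lemma topological_group_translation:
  assumes "topological_group G T" "a \<in> carrier G" "b \<in> carrier G"
  shows "continuous_map T T (\<lambda>g. a \<otimes>\<^bsub>G\<^esub> (g \<otimes>\<^bsub>G\<^esub> b))"
proof -
  have m: "continuous_map (prod_topology T T) T (\<lambda>(x, y). x \<otimes>\<^bsub>G\<^esub> y)" and c: "topspace T = carrier G"
    using assms by (auto simp: topological_group_def)
  have "continuous_map T T (\<lambda>g. g \<otimes>\<^bsub>G\<^esub> b)"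
    using continuous_map_compose[OF _ m, of T "\<lambda>g. (g, b)"] assms c
    by (simp add: continuous_map_pairwise comp_def)
  moreover have "continuous_map T T (\<lambda>g. a \<otimes>\<^bsub>G\<^esub> g)"
    using continuous_map_compose[OF _ m, of T "\<lambda>g. (a, g)"] assms c
    by (simp add: continuous_map_pairwise comp_def)
  ultimately show ?thesis
    using continuous_map_compose[of T T "\<lambda>g. g \<otimes>\<^bsub>G\<^esub> b" T "\<lambda>g. a \<otimes>\<^bsub>G\<^esub> g"] by (simp add: comp_def)
qed

text \<open>
  The Gelfand-Naimark-Segal construction for all neighbourhoods of the identity at once. Each
  neighbourhood \<open>N\<close> contributes a positive definite function \<open>\<psi>\<close>, and \<open>G\<close> acts by left translation on
  the reproducing kernel Hilbert space of the kernel \<open>\<psi> (h\<inverse> g)\<close> on the disjoint union of the copies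
  \<open>G \<times> {N}\<close> of \<open>G\<close>. The vectors \<open>k (g, N)\<close> at two points \<open>g\<close>, \<open>h\<close> of the same copy have squared distance
  \<open>2 (1 - \<psi> (g\<inverse> h))\<close>. Continuity of \<open>\<psi>\<close> at the identity therefore makes the orbits of these vectors, and
  by density all orbits, continuous; conversely an operator that moves \<open>k (1, N)\<close> only a little
  comes from an element of \<open>N\<close>.
\<close>

theorem unitarily_representable_if_positive_definite:
  fixes G :: "('g, 'b) monoid_scheme" and T :: "'g topology"
  assumes tg: "topological_group G T"
    and sep: "\<And>g. g \<in> carrier G \<Longrightarrow> g \<noteq> \<one>\<^bsub>G\<^esub> \<Longrightarrow> \<exists>N. openin T N \<and> \<one>\<^bsub>G\<^esub> \<in> N \<and> g \<notin> N"
    and pd: "\<And>N. openin T N \<Longrightarrow> \<one>\<^bsub>G\<^esub> \<in> N \<Longrightarrow>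
      \<exists>\<psi>. psd_on (carrier G) (\<lambda>g h. \<psi> (inv\<^bsub>G\<^esub> h \<otimes>\<^bsub>G\<^esub> g)) \<and> \<psi> \<one>\<^bsub>G\<^esub> = 1 \<and>
        (\<forall>\<epsilon>>0. \<exists>U. openin T U \<and> \<one>\<^bsub>G\<^esub> \<in> U \<and> (\<forall>g\<in>U. 1 - \<psi> g < \<epsilon>)) \<and>
        (\<exists>\<delta>>0. \<forall>g\<in>carrier G. 1 - \<psi> g < \<delta> \<longrightarrow> g \<in> N)"
  shows "unitarily_representable G T"
proof -
  interpret G: group G using tg by (simp add: topological_group_def)
  have topT: "topspace T = carrier G" using tg by (simp add: topological_group_def)
  let ?good = "\<lambda>\<psi>. psd_on (carrier G) (\<lambda>g h. \<psi> (inv\<^bsub>G\<^esub> h \<otimes>\<^bsub>G\<^esub> g)) \<and> \<psi> \<one>\<^bsub>G\<^esub> = 1 \<and>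
        (\<forall>\<epsilon>>0. \<exists>U. openin T U \<and> \<one>\<^bsub>G\<^esub> \<in> U \<and> (\<forall>g\<in>U. 1 - \<psi> g < \<epsilon>))"
  have one: "?good (\<lambda>_. 1)"
  proof (intro conjI allI impI)
    have "(\<Sum>x\<in>S. \<Sum>y\<in>S. c x * c y * 1) = (\<Sum>x\<in>S. c x)\<^sup>2" for S and c :: "'g \<Rightarrow> real"
      by (simp add: power2_eq_square sum_product)
    then show "psd_on (carrier G) (\<lambda>g h. 1)" by (auto simp: psd_on_def)
    show "\<exists>U. openin T U \<and> \<one>\<^bsub>G\<^esub> \<in> U \<and> (\<forall>g\<in>U. 1 - 1 < \<epsilon>)" if "\<epsilon> > 0" for \<epsilon> :: real
      using that topT by (intro exI[of _ "carrier G"]) (use openin_topspace[of T] in simp)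
  qed simp
  \<comment> \<open>The kernel is indexed by all sets \<open>N\<close>; those that are not open neighbourhoods of the identity
    get the trivial function 1.\<close>
  have "\<exists>\<psi>. ?good \<psi> \<and> (openin T N \<and> \<one>\<^bsub>G\<^esub> \<in> N \<longrightarrow> (\<exists>\<delta>>0. \<forall>g\<in>carrier G. 1 - \<psi> g < \<delta> \<longrightarrow> g \<in> N))" for N
  proof (cases "openin T N \<and> \<one>\<^bsub>G\<^esub> \<in> N")
    case True
    then show ?thesis using pd[of N] by (simp only: simp_thms) metis
  next
    case False
    show ?thesis by (rule exI[of _ "\<lambda>_. 1"]) (use False one in blast)
  qed
  then obtain \<Psi> where \<Psi>: "\<And>N. ?good (\<Psi> N)"
    and \<Psi>N: "\<And>N. openin T N \<Longrightarrow> \<one>\<^bsub>G\<^esub> \<in> N \<Longrightarrow> \<exists>\<delta>>0. \<forall>g\<in>carrier G. 1 - \<Psi> N g < \<delta> \<longrightarrow> g \<in> N"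
    by metis
  define k where "k = (\<lambda>(g, N) (h, N'). if g \<in> carrier G \<and> h \<in> carrier G \<and> N = N'
      then \<Psi> N (inv\<^bsub>G\<^esub> h \<otimes>\<^bsub>G\<^esub> g) else 0)"
  interpret K: psd_kernel k
    unfolding k_def by unfold_locales (rule psd_on_blocks, use \<Psi> in blast)
  let ?H = K.rkhs and ?V = "vectors K.rkhs"
  \<comment> \<open>Left translation, extended by the identity off the group so that it is a bijection of the type.\<close>
  define \<tau> where "\<tau> g = (\<lambda>(h, N). (if h \<in> carrier G then g \<otimes>\<^bsub>G\<^esub> h else h, N :: 'g set))" for g
  have \<tau>_mult: "\<tau> g (\<tau> h x) = \<tau> (g \<otimes>\<^bsub>G\<^esub> h) x" if "g \<in> carrier G" "h \<in> carrier G" for g h x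
    using that by (auto simp: \<tau>_def G.m_assoc split: prod.split)
  have \<tau>_one: "\<tau> \<one>\<^bsub>G\<^esub> x = x" for x by (auto simp: \<tau>_def split: prod.split)
  have \<tau>_inv: "\<tau> g (\<tau> (inv\<^bsub>G\<^esub> g) x) = x" "\<tau> (inv\<^bsub>G\<^esub> g) (\<tau> g x) = x" if "g \<in> carrier G" for g x
    using that by (simp_all add: \<tau>_mult \<tau>_one)
  have \<tau>_k: "k (\<tau> g x) (\<tau> g y) = k x y" if g: "g \<in> carrier G" for g x y
  proof -
    have "inv\<^bsub>G\<^esub> (g \<otimes>\<^bsub>G\<^esub> h') \<otimes>\<^bsub>G\<^esub> (g \<otimes>\<^bsub>G\<^esub> h) = inv\<^bsub>G\<^esub> h' \<otimes>\<^bsub>G\<^esub> h" if "h \<in> carrier G" "h' \<in> carrier G" for h h'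
      using that g by (simp add: G.inv_mult_group G.m_assoc) (simp add: G.m_assoc[symmetric])
    then show ?thesis using g by (auto simp: k_def \<tau>_def split: prod.split)
  qed
  note \<tau>s = \<tau>_inv \<tau>_k
  define \<rho> where "\<rho> g = (\<lambda>f\<in>?V. f \<circ> \<tau> (inv\<^bsub>G\<^esub> g))" for g
  let ?S = "\<rho> ` carrier G"
  have \<rho>_unitary: "\<rho> g \<in> carrier (unitary_group ?H)" if "g \<in> carrier G" for g
    unfolding \<rho>_def by (rule K.comp_unitary[of "\<tau> g"]) (use that \<tau>s in auto)
  have \<rho>_mem: "f \<circ> \<tau> (inv\<^bsub>G\<^esub> g) \<in> ?V" if "g \<in> carrier G" "f \<in> ?V" for g f
    by (rule K.comp_mem[of "\<tau> g"]) (use that \<tau>s in auto)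
  have \<rho>_mult: "\<rho> (g \<otimes>\<^bsub>G\<^esub> h) = compose ?V (\<rho> g) (\<rho> h)" if "g \<in> carrier G" "h \<in> carrier G" for g h
    using that \<rho>_mem by (auto simp: \<rho>_def compose_def fun_eq_iff \<tau>_mult G.inv_mult_group simp del: K.rkhs_simps(1))
  have \<rho>_one: "\<rho> \<one>\<^bsub>G\<^esub> = (\<lambda>x\<in>?V. x)"
    by (auto simp: \<rho>_def fun_eq_iff \<tau>_one simp del: K.rkhs_simps(1))
  have subgroup: "subgroup ?S (unitary_group ?H)"
  proof
    show "?S \<subseteq> carrier (unitary_group ?H)" using \<rho>_unitary by blast
    show "\<one>\<^bsub>unitary_group ?H\<^esub> \<in> ?S"
      using \<rho>_one by (force simp: unitary_group_def simp del: K.rkhs_simps(1))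
    fix x y assume "x \<in> ?S" "y \<in> ?S"
    then obtain g h where gh: "g \<in> carrier G" "x = \<rho> g" "h \<in> carrier G" "y = \<rho> h" by auto
    then have "x \<otimes>\<^bsub>unitary_group ?H\<^esub> y = \<rho> (g \<otimes>\<^bsub>G\<^esub> h)"
      by (simp add: \<rho>_mult unitary_group_def del: K.rkhs_simps(1))
    then show "x \<otimes>\<^bsub>unitary_group ?H\<^esub> y \<in> ?S" using gh by simp
  next
    fix x assume "x \<in> ?S"
    then obtain g where g: "g \<in> carrier G" "x = \<rho> g" by auto
    have 1: "compose ?V (\<rho> g) (\<rho> (inv\<^bsub>G\<^esub> g)) = (\<lambda>x\<in>?V. x)" "compose ?V (\<rho> (inv\<^bsub>G\<^esub> g)) (\<rho> g) = (\<lambda>x\<in>?V. x)"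
      using g \<rho>_mult[of g "inv\<^bsub>G\<^esub> g"] \<rho>_mult[of "inv\<^bsub>G\<^esub> g" g] \<rho>_one by simp_all
    have "inv\<^bsub>unitary_group ?H\<^esub> x = \<rho> (inv\<^bsub>G\<^esub> g)"
      unfolding m_inv_def[of "unitary_group ?H"]
    proof (rule the_equality)
      show "\<rho> (inv\<^bsub>G\<^esub> g) \<in> carrier (unitary_group ?H) \<and>
          x \<otimes>\<^bsub>unitary_group ?H\<^esub> \<rho> (inv\<^bsub>G\<^esub> g) = \<one>\<^bsub>unitary_group ?H\<^esub> \<and>
          \<rho> (inv\<^bsub>G\<^esub> g) \<otimes>\<^bsub>unitary_group ?H\<^esub> x = \<one>\<^bsub>unitary_group ?H\<^esub>"
        using 1 g \<rho>_unitary by (simp add: unitary_group_def del: K.rkhs_simps(1))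
      fix y assume y: "y \<in> carrier (unitary_group ?H) \<and> x \<otimes>\<^bsub>unitary_group ?H\<^esub> y = \<one>\<^bsub>unitary_group ?H\<^esub> \<and>
          y \<otimes>\<^bsub>unitary_group ?H\<^esub> x = \<one>\<^bsub>unitary_group ?H\<^esub>"
      then have y': "y \<in> extensional ?V" "y \<in> ?V \<rightarrow> ?V" "compose ?V (\<rho> g) y = (\<lambda>x\<in>?V. x)"
        using g by (auto simp: unitary_group_def bij_betw_def simp del: K.rkhs_simps(1))
      have "y v = \<rho> (inv\<^bsub>G\<^esub> g) v" if v: "v \<in> ?V" for v
      proof -
        have yv: "y v \<in> ?V" using y' v by blast
        have "\<rho> (inv\<^bsub>G\<^esub> g) (\<rho> g (y v)) = y v"
          using fun_cong[OF 1(2), of "y v"] yv by (simp add: compose_def del: K.rkhs_simps(1))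
        moreover have "\<rho> g (y v) = v"
          using fun_cong[OF y'(3), of v] v by (simp add: compose_def del: K.rkhs_simps(1))
        ultimately show ?thesis by simp
      qed
      then show "y = \<rho> (inv\<^bsub>G\<^esub> g)"
        using y'(1) by (intro extensionalityI[of _ ?V]) (auto simp: \<rho>_def simp del: K.rkhs_simps(1))
    qed
    then show "inv\<^bsub>unitary_group ?H\<^esub> x \<in> ?S" using g by simp
  qed
  have \<rho>_val: "\<rho> g (K.val c) = K.val (map (apsnd (\<tau> g)) c)" if "g \<in> carrier G" for g c
    using K.val_map[of "\<tau> g" "\<tau> (inv\<^bsub>G\<^esub> g)" c] that \<tau>s K.val_mem[of c]
    by (simp add: \<rho>_def del: K.rkhs_simps(1))
  have \<rho>_isometry: "vdist ?H (\<rho> g f) (\<rho> g f') = vdist ?H f f'" if "g \<in> carrier G" "f \<in> ?V" "f' \<in> ?V" for g f f'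
    using that K.vdist_comp[of "\<tau> g" "\<tau> (inv\<^bsub>G\<^esub> g)" f f'] \<tau>s by (simp add: \<rho>_def del: K.rkhs_simps(1))
  have kk: "k (g, N) (g, N) + k (h, N) (h, N) - 2 * k (h, N) (g, N) = 2 * (1 - \<Psi> N (inv\<^bsub>G\<^esub> g \<otimes>\<^bsub>G\<^esub> h))"
    if "g \<in> carrier G" "h \<in> carrier G" for g h N
    using that \<Psi>[of N] by (simp add: k_def)
  have \<rho>_point: "vdist ?H (\<rho> h (K.val [(1, (\<one>\<^bsub>G\<^esub>, N))])) (\<rho> g (K.val [(1, (\<one>\<^bsub>G\<^esub>, N))])) =
      sqrt (2 * (1 - \<Psi> N (inv\<^bsub>G\<^esub> g \<otimes>\<^bsub>G\<^esub> h)))" if "g \<in> carrier G" "h \<in> carrier G" for g h N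
    using that kk[of g h N] by (simp add: \<rho>_val K.vdist_val K.nrm_sub_points \<tau>_def algebra_simps)
  have inj: "inj_on \<rho> (carrier G)"
  proof (rule inj_onI, rule ccontr)
    fix g h assume gh: "g \<in> carrier G" "h \<in> carrier G" "\<rho> g = \<rho> h" "g \<noteq> h"
    let ?x = "inv\<^bsub>G\<^esub> g \<otimes>\<^bsub>G\<^esub> h"
    have "?x \<noteq> \<one>\<^bsub>G\<^esub>" using gh G.inv_equality G.inv_inv by (metis G.inv_closed)
    then obtain N where N: "openin T N" "\<one>\<^bsub>G\<^esub> \<in> N" "?x \<notin> N" using sep[of ?x] gh by auto
    then obtain \<delta> where \<delta>: "\<delta> > 0" "\<forall>g\<in>carrier G. 1 - \<Psi> N g < \<delta> \<longrightarrow> g \<in> N" using \<Psi>N by blast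
    have mem: "\<rho> h (K.val [(1, (\<one>\<^bsub>G\<^esub>, N))]) \<in> ?V"
      using gh by (simp add: \<rho>_val K.val_mem del: K.rkhs_simps(1))
    have "sqrt (2 * (1 - \<Psi> N ?x)) = 0"
      using \<rho>_point[OF gh(1,2), of N] gh(3) K.vdist_eq_0_iff[OF mem mem] by simp
    then have "?x \<in> N" using \<delta> gh by simp
    then show False using N by simp
  qed
  have iso: "\<rho> \<in> iso G ((unitary_group ?H)\<lparr>carrier := ?S\<rparr>)"
    using inj \<rho>_mult by (auto simp: iso_def hom_def bij_betw_def unitary_group_def simp del: K.rkhs_simps(1))
  interpret M: Metric_space ?V "vdist ?H" by (rule K.Metric_space_vdist)
  \<comment> \<open>Continuity of the orbits of combinations, by induction on their length.\<close>
  have orbit_points: "\<exists>U. openin T U \<and> g0 \<in> U \<and>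
      (\<forall>g\<in>U. K.nrm (K.sub (map (apsnd (\<tau> g)) c) (map (apsnd (\<tau> g0)) c)) < \<epsilon>)"
    if g0: "g0 \<in> carrier G" and "\<epsilon> > 0" for g0 \<epsilon> c
    using \<open>\<epsilon> > 0\<close>
  proof (induction c arbitrary: \<epsilon>)
    case Nil
    then show ?case using g0 openin_topspace[of T]
      by (intro exI[of _ "carrier G"]) (auto simp: K.nrm_def K.sub_def K.smul_def topT)
  next
    case (Cons p c)
    obtain U where U: "openin T U" "g0 \<in> U"
      "\<forall>g\<in>U. K.nrm (K.sub (map (apsnd (\<tau> g)) c) (map (apsnd (\<tau> g0)) c)) < \<epsilon> / 2"
      using Cons.IH[of "\<epsilon> / 2"] Cons.prems by auto
    obtain a h N where p: "p = (a, (h, N))" by (cases p) auto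
    have "\<exists>W. openin T W \<and> g0 \<in> W \<and> (\<forall>g\<in>W. K.nrm (K.sub [apsnd (\<tau> g) p] [apsnd (\<tau> g0) p]) < \<epsilon> / 2)"
    proof (cases "h \<in> carrier G")
      case False
      then show ?thesis using g0 Cons.prems openin_topspace[of T]
        by (intro exI[of _ "carrier G"]) (auto simp: p \<tau>_def K.nrm_sub_points topT)
    next
      case True
      \<comment> \<open>Chosen so that \<open>(cmod a + 1) * sqrt (2 * \<eta>) = \<epsilon> / 2\<close>.\<close>
      define \<eta> where "\<eta> = (\<epsilon> / (2 * (cmod a + 1)))\<^sup>2 / 2"
      have a: "cmod a + 1 > 0" by (simp add: add_nonneg_pos)
      then have "\<eta> > 0" using Cons.prems by (simp add: \<eta>_def)
      then obtain W where W: "openin T W" "\<one>\<^bsub>G\<^esub> \<in> W" "\<forall>g\<in>W. 1 - \<Psi> N g < \<eta>"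
        using \<Psi>[of N] by blast
      let ?f = "\<lambda>g. inv\<^bsub>G\<^esub> (g0 \<otimes>\<^bsub>G\<^esub> h) \<otimes>\<^bsub>G\<^esub> (g \<otimes>\<^bsub>G\<^esub> h)"
      let ?W = "{g \<in> topspace T. ?f g \<in> W}"
      have "openin T ?W"
        using topological_group_translation[OF tg, of "inv\<^bsub>G\<^esub> (g0 \<otimes>\<^bsub>G\<^esub> h)" h] g0 True W(1)
        by (intro openin_continuous_map_preimage) auto
      moreover have "g0 \<in> ?W" using g0 True W(2) topT by simp
      moreover have "K.nrm (K.sub [apsnd (\<tau> g) p] [apsnd (\<tau> g0) p]) < \<epsilon> / 2" if "g \<in> ?W" for g
      proof -
        have g: "g \<in> carrier G" using that topT by simp
        have "K.nrm (K.sub [apsnd (\<tau> g) p] [apsnd (\<tau> g0) p]) = cmod a * sqrt (2 * (1 - \<Psi> N (?f g)))"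
          using kk[of "g0 \<otimes>\<^bsub>G\<^esub> h" "g \<otimes>\<^bsub>G\<^esub> h" N] g g0 True
          by (simp add: p \<tau>_def K.nrm_sub_points algebra_simps)
        also have "\<dots> \<le> cmod a * sqrt (2 * \<eta>)"
          using W(3) that by (intro mult_left_mono) (auto intro: less_imp_le)
        also have "\<dots> = cmod a * (\<epsilon> / (2 * (cmod a + 1)))"
          using Cons.prems a by (simp add: \<eta>_def)
        also have "\<dots> < \<epsilon> / 2" using Cons.prems a by (simp add: field_simps)
        finally show ?thesis .
      qed
      ultimately show ?thesis by blast
    qed
    then obtain W where W: "openin T W" "g0 \<in> W"
      "\<forall>g\<in>W. K.nrm (K.sub [apsnd (\<tau> g) p] [apsnd (\<tau> g0) p]) < \<epsilon> / 2" by blast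
    have split: "map (apsnd (\<tau> g)) (p # c) = [apsnd (\<tau> g) p] @ map (apsnd (\<tau> g)) c" for g by simp
    have "K.nrm (K.sub (map (apsnd (\<tau> g)) (p # c)) (map (apsnd (\<tau> g0)) (p # c))) < \<epsilon>" if "g \<in> U \<inter> W" for g
    proof -
      have "K.nrm (K.sub (map (apsnd (\<tau> g)) (p # c)) (map (apsnd (\<tau> g0)) (p # c))) =
          K.nrm (K.sub [apsnd (\<tau> g) p] [apsnd (\<tau> g0) p] @ K.sub (map (apsnd (\<tau> g)) c) (map (apsnd (\<tau> g0)) c))"
        by (intro K.nrm_cong) (simp add: split K.form_sub_left K.form_append_left del: list.map append.simps)
      also have "\<dots> \<le> K.nrm (K.sub [apsnd (\<tau> g) p] [apsnd (\<tau> g0) p]) +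
          K.nrm (K.sub (map (apsnd (\<tau> g)) c) (map (apsnd (\<tau> g0)) c))" by (rule K.nrm_append)
      also have "\<dots> < \<epsilon> / 2 + \<epsilon> / 2" using U(3) W(3) that by (intro add_strict_mono) auto
      finally show ?thesis by simp
    qed
    then show ?case using U W by (intro exI[of _ "U \<inter> W"]) auto
  qed
  have cont: "continuous_map T (unitary_strong_topology ?H) \<rho>"
    unfolding unitary_strong_topology_def continuous_map_in_subtopology
  proof (intro conjI)
    show "\<rho> \<in> topspace T \<rightarrow> carrier (unitary_group ?H)" using \<rho>_unitary topT by auto
    show "continuous_map T (product_topology (\<lambda>_. M.mtopology) ?V) \<rho>"
      unfolding continuous_map_componentwise
    proof (intro conjI ballI)
      show "\<rho> ` topspace T \<subseteq> extensional ?V" by (auto simp: \<rho>_def simp del: K.rkhs_simps(1))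
      fix f assume f: "f \<in> ?V"
      show "continuous_map T M.mtopology (\<lambda>g. \<rho> g f)"
        unfolding M.continuous_map_to_metric
      proof (intro ballI allI impI)
        fix g0 and \<epsilon> :: real assume g0: "g0 \<in> topspace T" and \<epsilon>: "\<epsilon> > 0"
        obtain c where c: "vdist ?H f (K.val c) < \<epsilon> / 3" using K.dense[OF f, of "\<epsilon>/3"] \<epsilon> by auto
        obtain U where U: "openin T U" "g0 \<in> U"
          "\<forall>g\<in>U. K.nrm (K.sub (map (apsnd (\<tau> g)) c) (map (apsnd (\<tau> g0)) c)) < \<epsilon> / 3"
          using orbit_points[of g0 "\<epsilon> / 3" c] g0 topT \<epsilon> by auto
        have mem: "\<rho> g f' \<in> ?V" if "g \<in> carrier G" "f' \<in> ?V" for g f'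
          using \<rho>_mem[OF that] that by (simp add: \<rho>_def del: K.rkhs_simps(1))
        have "\<rho> g f \<in> M.mball (\<rho> g0 f) \<epsilon>" if "g \<in> U" for g
        proof -
          have g: "g \<in> carrier G" "g0 \<in> carrier G" using that openin_subset[OF U(1)] topT g0 by auto
          note v = K.val_mem[of c]
          have "vdist ?H (\<rho> g0 (K.val c)) (\<rho> g (K.val c)) < \<epsilon> / 3"
            using bspec[OF U(3) that] g by (simp only: \<rho>_val K.vdist_val K.nrm_sub_commute[of "map (apsnd (\<tau> g0)) c"])
          then have "vdist ?H (\<rho> g0 f) (\<rho> g f) < \<epsilon>"
            using K.vdist_triangle[OF mem[OF g(2) f] mem[OF g(2) v] mem[OF g(1) f]]
              K.vdist_triangle[OF mem[OF g(2) v] mem[OF g(1) v] mem[OF g(1) f]]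
              \<rho>_isometry[OF g(2) f v] \<rho>_isometry[OF g(1) v f] K.vdist_commute[of "K.val c" f] c
            by linarith
          then show ?thesis using mem[OF g(1) f] mem[OF g(2) f] by (simp add: M.in_mball del: K.rkhs_simps(1))
        qed
        then show "\<exists>U. openin T U \<and> g0 \<in> U \<and> (\<forall>g\<in>U. \<rho> g f \<in> M.mball (\<rho> g0 f) \<epsilon>)"
          using U by blast
      qed
    qed
  qed
  have topS: "topspace (subtopology (unitary_strong_topology ?H) ?S) = ?S"
    using \<rho>_unitary continuous_map_image_subset_topspace[OF cont] topT by auto
  have eval: "continuous_map (subtopology (unitary_strong_topology ?H) ?S) M.mtopology (\<lambda>V. V v)"
    if "v \<in> ?V" for v
    unfolding unitary_strong_topology_def
    by (intro continuous_map_from_subtopology continuous_map_product_projection that)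
  have open_map: "open_map T (subtopology (unitary_strong_topology ?H) ?S) \<rho>"
    unfolding open_map_def
  proof (intro allI impI)
    fix U assume U: "openin T U"
    show "openin (subtopology (unitary_strong_topology ?H) ?S) (\<rho> ` U)"
    proof (subst openin_subopen, intro ballI)
      fix x assume "x \<in> \<rho> ` U"
      then obtain g where g: "g \<in> U" "x = \<rho> g" by auto
      then have gG: "g \<in> carrier G" using U openin_subset topT by blast
      define N where "N = {h \<in> topspace T. g \<otimes>\<^bsub>G\<^esub> (h \<otimes>\<^bsub>G\<^esub> \<one>\<^bsub>G\<^esub>) \<in> U}"
      have "openin T N"
        unfolding N_def by (intro openin_continuous_map_preimage[OF _ U] topological_group_translation[OF tg] gG) simp
      moreover have "\<one>\<^bsub>G\<^esub> \<in> N" using g gG topT by (simp add: N_def)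
      ultimately obtain \<delta> where \<delta>: "\<delta> > 0" "\<forall>g\<in>carrier G. 1 - \<Psi> N g < \<delta> \<longrightarrow> g \<in> N" using \<Psi>N by blast
      define v where "v = K.val [(1, (\<one>\<^bsub>G\<^esub>, N))]"
      have v: "v \<in> ?V" unfolding v_def by (rule K.val_mem)
      have \<rho>v: "\<rho> h v \<in> ?V" if "h \<in> carrier G" for h
        using \<rho>_mem[OF that v] v by (simp add: \<rho>_def del: K.rkhs_simps(1))
      let ?W = "{V \<in> topspace (subtopology (unitary_strong_topology ?H) ?S). V v \<in> M.mball (\<rho> g v) (sqrt (2 * \<delta>))}"
      have "openin (subtopology (unitary_strong_topology ?H) ?S) ?W"
        by (rule openin_continuous_map_preimage[OF eval[OF v] M.openin_mball])
      moreover have "x \<in> ?W"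
        unfolding topS using g gG \<rho>v[OF gG] \<delta>(1) by (simp add: M.centre_in_mball_iff del: K.rkhs_simps(1))
      moreover have "?W \<subseteq> \<rho> ` U"
      proof
        fix V assume "V \<in> ?W"
        then obtain h where h: "h \<in> carrier G" "V = \<rho> h" "vdist ?H (\<rho> g v) (\<rho> h v) < sqrt (2 * \<delta>)"
          unfolding topS by (auto simp: M.in_mball simp del: K.rkhs_simps(1))
        then have "sqrt (2 * (1 - \<Psi> N (inv\<^bsub>G\<^esub> g \<otimes>\<^bsub>G\<^esub> h))) < sqrt (2 * \<delta>)"
          using \<rho>_point[OF gG h(1), of N] K.vdist_commute by (simp add: v_def)
        then have "inv\<^bsub>G\<^esub> g \<otimes>\<^bsub>G\<^esub> h \<in> N" using \<delta>(2) gG h by simp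
        then have "h \<in> U" using gG h(1) by (simp add: N_def G.m_assoc[symmetric])
        then show "V \<in> \<rho> ` U" using h by blast
      qed
      ultimately show "\<exists>W. openin (subtopology (unitary_strong_topology ?H) ?S) W \<and> x \<in> W \<and> W \<subseteq> \<rho> ` U"
        by blast
    qed
  qed
  have "homeomorphic_map T (subtopology (unitary_strong_topology ?H) ?S) \<rho>"
    by (rule bijective_open_imp_homeomorphic_map[OF continuous_map_into_subtopology[OF cont] open_map])
      (use inj topT topS in auto)
  then show ?thesis
    unfolding unitarily_representable_def using tg K.complex_hilbert_space_rkhs subgroup iso by blast
qed

section \<open>Exponentials of l1-type distances\<close>

text \<open>
  The kernels \<open>D\<close> for which Schur multiplication by \<open>exp (- D)\<close> preserves positive semidefiniteness. Stated
  this way, closure under sums is immediate.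
\<close>

definition negative_kernel :: "'x set \<Rightarrow> ('x \<Rightarrow> 'x \<Rightarrow> real) \<Rightarrow> bool" where
  "negative_kernel X D \<longleftrightarrow> (\<forall>K. psd_on X K \<longrightarrow> psd_on X (\<lambda>x y. K x y * exp (- D x y)))"

lemma indicator_initial_segments:
  "indicator {0..s} r * indicator {0..t} r = (indicator {0..min s t} r :: real)" for r s t :: real
  by (auto split: split_indicator)

text \<open>
  Multiplied by \<open>exp (s + t)\<close>, the left-hand side becomes \<open>min (exp (2 s)) (exp (2 t))\<close>, which is the
  inner product in \<open>L\<^sup>2\<close> of the indicators of two initial segments of the half-line.
\<close>

lemma exp_minus_abs_eq_integral:
  fixes s t :: real
  shows "exp (- \<bar>s - t\<bar>) =
    exp (- s) * exp (- t) * (LINT r|lborel. indicator {0..exp (2 * s)} r * indicator {0..exp (2 * t)} r)"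
  unfolding indicator_initial_segments by (auto simp: min_def abs_if mult_exp_exp)

text \<open>
  By the integral formula the quadratic form of the product kernel is an integral, over \<open>r\<close>, of
  quadratic forms of \<open>K\<close> with coefficients \<open>b r x\<close>.
\<close>

lemma negative_kernel_abs: "negative_kernel X (\<lambda>x y. \<bar>l x - l y\<bar>)"
  unfolding negative_kernel_def psd_on_def
proof (intro allI impI, elim conjE, intro conjI ballI allI impI)
  fix K :: "'a \<Rightarrow> 'a \<Rightarrow> real" and x y
  assume "\<forall>x\<in>X. \<forall>y\<in>X. K y x = K x y" "x \<in> X" "y \<in> X"
  then show "K y x * exp (- \<bar>l y - l x\<bar>) = K x y * exp (- \<bar>l x - l y\<bar>)"
    by (simp add: abs_minus_commute)
next
  fix K :: "'a \<Rightarrow> 'a \<Rightarrow> real" and S and c :: "'a \<Rightarrow> real"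
  assume K: "\<forall>S c. finite S \<longrightarrow> S \<subseteq> X \<longrightarrow> 0 \<le> (\<Sum>x\<in>S. \<Sum>y\<in>S. c x * c y * K x y)"
    and S: "finite S" "S \<subseteq> X"
  let ?i = "\<lambda>x r. indicator {0..exp (2 * l x)} r :: real"
  define b where "b r x = c x * exp (- l x) * ?i x r" for r x
  have int: "integrable lborel (\<lambda>r. ?i x r * ?i y r)" for x y
    unfolding indicator_initial_segments by simp
  have eq: "b r x * b r y * K x y = (c x * c y * K x y * exp (- l x) * exp (- l y)) * (?i x r * ?i y r)" for r x y
    by (simp add: b_def)
  have int': "integrable lborel (\<lambda>r. b r x * b r y * K x y)" for x y
    unfolding eq using int by simp
  have "c x * c y * (K x y * exp (- \<bar>l x - l y\<bar>)) = (LINT r|lborel. b r x * b r y * K x y)" for x y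
    unfolding eq exp_minus_abs_eq_integral by simp
  then have "(\<Sum>x\<in>S. \<Sum>y\<in>S. c x * c y * (K x y * exp (- \<bar>l x - l y\<bar>))) =
      (LINT r|lborel. (\<Sum>x\<in>S. \<Sum>y\<in>S. b r x * b r y * K x y))"
    using int' by (simp only: Bochner_Integration.integral_sum Bochner_Integration.integrable_sum)
  also have "\<dots> \<ge> 0" using K S by (intro Bochner_Integration.integral_nonneg) auto
  finally show "0 \<le> (\<Sum>x\<in>S. \<Sum>y\<in>S. c x * c y * (K x y * exp (- \<bar>l x - l y\<bar>)))" .
qed

lemma negative_kernel_add:
  assumes "negative_kernel X D" "negative_kernel X E"
  shows "negative_kernel X (\<lambda>x y. D x y + E x y)"
  unfolding negative_kernel_def
proof (intro allI impI)
  fix K assume "psd_on X K"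
  then have "psd_on X (\<lambda>x y. K x y * exp (- D x y) * exp (- E x y))"
    using assms by (simp add: negative_kernel_def)
  then show "psd_on X (\<lambda>x y. K x y * exp (- (D x y + E x y)))"
    by (simp add: exp_diff exp_minus field_simps)
qed

lemma negative_kernel_sum:
  "(\<And>i. i \<in> I \<Longrightarrow> negative_kernel X (D i)) \<Longrightarrow> negative_kernel X (\<lambda>x y. \<Sum>i\<in>I. D i x y)"
proof (induction I rule: infinite_finite_induct)
  case (insert i I)
  then show ?case using negative_kernel_add[of X "D i" "\<lambda>x y. \<Sum>i\<in>I. D i x y"] by simp
qed (auto simp: negative_kernel_def)

lemma psd_on_limit:
  assumes K: "\<And>n. psd_on X (K n)"
    and lim: "\<And>x y. x \<in> X \<Longrightarrow> y \<in> X \<Longrightarrow> (\<lambda>n. K n x y) \<longlonglongrightarrow> L x y"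
  shows "psd_on X L"
  unfolding psd_on_def
proof (intro conjI ballI allI impI)
  fix x y assume xy: "x \<in> X" "y \<in> X"
  then have "K n y x = K n x y" for n using K by (simp add: psd_on_def)
  then show "L y x = L x y" using LIMSEQ_unique[OF lim[OF xy]] lim[OF xy(2,1)] by simp
next
  fix S and c :: "'a \<Rightarrow> real" assume S: "finite S" "S \<subseteq> X"
  have "(\<lambda>n. \<Sum>x\<in>S. \<Sum>y\<in>S. c x * c y * K n x y) \<longlonglongrightarrow> (\<Sum>x\<in>S. \<Sum>y\<in>S. c x * c y * L x y)"
    using S by (intro tendsto_intros lim) auto
  then show "0 \<le> (\<Sum>x\<in>S. \<Sum>y\<in>S. c x * c y * L x y)"
    by (rule LIMSEQ_le_const) (use K S in \<open>simp add: psd_on_def\<close>)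
qed

lemma negative_kernel_suminf:
  assumes D: "\<And>n. negative_kernel X (D n)"
    and summable: "\<And>x y. x \<in> X \<Longrightarrow> y \<in> X \<Longrightarrow> summable (\<lambda>n. D n x y)"
  shows "negative_kernel X (\<lambda>x y. \<Sum>n. D n x y)"
  unfolding negative_kernel_def
proof (intro allI impI)
  fix K assume K: "psd_on X K"
  have "psd_on X (\<lambda>x y. K x y * exp (- (\<Sum>n<m. D n x y)))" for m
    using negative_kernel_sum[of "{..<m}" X D] D K by (simp add: negative_kernel_def)
  then show "psd_on X (\<lambda>x y. K x y * exp (- (\<Sum>n. D n x y)))"
    by (rule psd_on_limit[where K = "\<lambda>m x y. K x y * exp (- (\<Sum>n<m. D n x y))"]) (intro tendsto_intros summable_LIMSEQ summable)
qed

lemma psd_on_exp_minus: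
  assumes "negative_kernel X D" shows "psd_on X (\<lambda>x y. exp (- D x y))"
proof -
  have "(\<Sum>x\<in>S. \<Sum>y\<in>S. c x * c y * 1) = (\<Sum>x\<in>S. c x)\<^sup>2" for S and c :: "'a \<Rightarrow> real"
    by (simp add: power2_eq_square sum_product)
  then have "psd_on X (\<lambda>_ _. 1)" by (auto simp: psd_on_def)
  with assms have "psd_on X (\<lambda>x y. 1 * exp (- D x y))"
    unfolding negative_kernel_def by blast
  then show ?thesis by simp
qed

section \<open>Expansion of compact sets\<close>

lemma compact_insert_zero_UN_finite:
  fixes P :: "nat \<Rightarrow> 'a::real_normed_vector set"
  assumes P: "\<And>n. finite (P n)" "\<And>n x. x \<in> P n \<Longrightarrow> norm x \<le> c n" and c: "c \<longlonglongrightarrow> 0"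
  shows "compact (insert 0 (\<Union>n. P n))"
proof (rule compactI)
  fix C assume C: "\<forall>t\<in>C. open t" "insert 0 (\<Union>n. P n) \<subseteq> \<Union>C"
  then obtain t where t: "t \<in> C" "0 \<in> t" by auto
  then obtain e where e: "e > 0" "ball 0 e \<subseteq> t" using C(1) openE by blast
  obtain N where N: "\<And>n. n \<ge> N \<Longrightarrow> c n < e"
    using order_tendstoD(2)[OF c e(1)] by (auto simp: eventually_sequentially)
  let ?Q = "\<Union>n<N. P n"
  have fin: "finite ?Q" using P by simp
  have "?Q \<subseteq> \<Union>C" using C(2) by blast
  then obtain C' where C': "C' \<subseteq> C" "finite C'" "?Q \<subseteq> \<Union>C'"
    using compactE[OF finite_imp_compact[OF fin], of C thesis] C(1) by blast
  have "P n \<subseteq> \<Union>(insert t C')" for n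
  proof (cases "n < N")
    case True
    then show ?thesis using C'(3) by auto
  next
    case False
    then have "P n \<subseteq> ball 0 e" using P(2)[of _ n] N[of n] by (force simp: not_less)
    then show ?thesis using e by auto
  qed
  then show "\<exists>C'\<subseteq>C. finite C' \<and> insert 0 (\<Union>n. P n) \<subseteq> \<Union>C'"
    using C' t by (intro exI[of _ "insert t C'"]) auto
qed

text \<open>
  One step of the expansion: a finite \<open>r / 4\<close>-net of \<open>K\<close> consists of combinations of the \<open>h i\<close>, and
  what is left of the elements of \<open>K\<close> again forms a compact set, four times smaller.
\<close>

lemma cube_spanned_residual:
  fixes R :: "'e::real_normed_vector set"
  assumes R: "cube_spanned R" "\<And>x y. x \<in> R \<Longrightarrow> y \<in> R \<Longrightarrow> x + y \<in> R" "\<And>r x. x \<in> R \<Longrightarrow> r *\<^sub>R x \<in> R"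
    and K: "compact K" "K \<subseteq> R \<inter> cball 0 r" and r: "r > 0"
  shows "\<exists>(n::nat) h K'. (\<forall>i<n. h i \<in> R) \<and>
    (\<forall>a. (\<forall>i<n. \<bar>a i\<bar> \<le> 1) \<longrightarrow> norm (\<Sum>i<n. a i *\<^sub>R h i) \<le> 2 * r) \<and>
    compact K' \<and> K' \<subseteq> R \<inter> cball 0 (r / 4) \<and>
    (\<forall>f\<in>K. \<exists>f'\<in>K'. \<exists>a. (\<forall>i<n. \<bar>a i\<bar> \<le> 1) \<and> f = (\<Sum>i<n. a i *\<^sub>R h i) + f')"
proof -
  have "\<exists>S. finite S \<and> S \<subseteq> K \<and> K \<subseteq> (\<Union>s\<in>S. ball s (r / 4))"
    using seq_compact_imp_totally_bounded[OF compact_imp_seq_compact[OF K(1)], rule_format, of "r / 4"] r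
    by simp
  then obtain S where S: "finite S" "S \<subseteq> K" "K \<subseteq> (\<Union>s\<in>S. ball s (r / 4))"
    by blast
  let ?F = "(\<lambda>s. (1 / r) *\<^sub>R s) ` S"
  have F: "finite ?F" "?F \<subseteq> R \<inter> cball 0 1" using S(1,2) K(2) r R(3) by (auto simp: field_simps)
  obtain n :: nat and h where h: "\<forall>i<n. h i \<in> R"
      "\<forall>f\<in>?F. \<exists>a. (\<forall>i<n. \<bar>a i\<bar> \<le> 1) \<and> f = (\<Sum>i<n. a i *\<^sub>R h i)"
      "\<forall>a. (\<forall>i<n. \<bar>a i\<bar> \<le> 1) \<longrightarrow> norm (\<Sum>i<n. a i *\<^sub>R h i) \<le> 2"
    using R(1)[unfolded cube_spanned_def, rule_format, OF F] by (elim exE conjE)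
  define h' where "h' i = r *\<^sub>R h i" for i
  have h': "(\<Sum>i<n. a i *\<^sub>R h' i) = r *\<^sub>R (\<Sum>i<n. a i *\<^sub>R h i)" for a
    by (simp add: h'_def scaleR_sum_right mult.commute)
  let ?K = "(\<Union>s\<in>S. (\<lambda>f. f - s) ` K) \<inter> cball 0 (r / 4)"
  have "compact ?K"
    by (intro compact_Int_closed compact_UN S compact_continuous_image K continuous_intros) auto
  moreover have "?K \<subseteq> R \<inter> cball 0 (r / 4)"
  proof -
    have "f - s \<in> R" if "f \<in> K" "s \<in> S" for f s
      using R(2)[of f "(-1) *\<^sub>R s"] R(3)[of s "-1"] that K S by auto
    then show ?thesis by auto
  qed
  moreover have "\<exists>f'\<in>?K. \<exists>a. (\<forall>i<n. \<bar>a i\<bar> \<le> 1) \<and> f = (\<Sum>i<n. a i *\<^sub>R h' i) + f'" if f: "f \<in> K" for f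
  proof -
    obtain s where s: "s \<in> S" "norm (f - s) < r / 4" using S(3) f by (auto simp: dist_norm norm_minus_commute)
    then obtain a where a: "\<forall>i<n. \<bar>a i\<bar> \<le> 1" "(1 / r) *\<^sub>R s = (\<Sum>i<n. a i *\<^sub>R h i)" using h(2) by auto
    have "s = (\<Sum>i<n. a i *\<^sub>R h' i)" unfolding h' a(2)[symmetric] using r by simp
    then show ?thesis using s f a by (intro bexI[of _ "f - s"] exI[of _ a]) auto
  qed
  moreover have "norm (\<Sum>i<n. a i *\<^sub>R h' i) \<le> 2 * r" if "\<forall>i<n. \<bar>a i\<bar> \<le> 1" for a
    unfolding h' using h(3) that r by simp
  moreover have "\<forall>i<n. h' i \<in> R" using h(1) R(3) by (simp add: h'_def)
  ultimately show ?thesis by (intro exI[of _ n] exI[of _ h'] exI[of _ ?K]) blast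
qed

text \<open>
  A version of the theorem that a compact set lies in the closed convex hull of a null sequence, in
  which the null sequence consists of images of cubes. The compact set of residuals is expanded
  again and again. The expansion is an equality: an approximation up to a small error
  would not do, since functionals that are small on a given compact set need not be bounded in norm.
\<close>

lemma cube_spanned_compact_expansion:
  fixes R :: "'e::real_normed_vector set"
  assumes R: "cube_spanned R" "\<And>x y. x \<in> R \<Longrightarrow> y \<in> R \<Longrightarrow> x + y \<in> R" "\<And>r x. x \<in> R \<Longrightarrow> r *\<^sub>R x \<in> R"
    and K: "compact K" "K \<subseteq> R"
  obtains N :: "nat \<Rightarrow> nat" and H r where "r > 0" "\<And>n i. i < N n \<Longrightarrow> H n i \<in> R"
    "\<And>n a. (\<And>i. i < N n \<Longrightarrow> \<bar>a i\<bar> \<le> 1) \<Longrightarrow> norm (\<Sum>i<N n. a i *\<^sub>R H n i) \<le> 2 * r / 4 ^ n"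
    "\<And>f. f \<in> K \<Longrightarrow> \<exists>a. (\<forall>n. \<forall>i<N n. \<bar>a n i\<bar> \<le> 1) \<and> (\<lambda>n. \<Sum>i<N n. a n i *\<^sub>R H n i) sums f"
proof -
  obtain r where "r > 0" "\<forall>x\<in>K. norm x \<le> r"
    using compact_imp_bounded[OF K(1)] unfolding bounded_pos by blast
  then have r: "r > 0" "K \<subseteq> cball 0 r" by auto
  define good where "good t K n h K' \<longleftrightarrow> (\<forall>i<n. h i \<in> R) \<and>
      (\<forall>a. (\<forall>i<n. \<bar>a i\<bar> \<le> 1) \<longrightarrow> norm (\<Sum>i<n. a i *\<^sub>R h i) \<le> 2 * t) \<and>
      compact K' \<and> K' \<subseteq> R \<inter> cball 0 (t / 4) \<and>
      (\<forall>f\<in>K. \<exists>f'\<in>K'. \<exists>a. (\<forall>i<n. \<bar>a i\<bar> \<le> 1) \<and> f = (\<Sum>i<n. a i *\<^sub>R h i) + f')"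
    for t and K and n :: nat and h K'
  have ex: "\<exists>n h K'. good t K n h K'" if "t > 0" "compact K" "K \<subseteq> R \<inter> cball 0 t" for t K
    using cube_spanned_residual[OF R that(2,3,1)] unfolding good_def .
  obtain nn hh CC where step: "\<And>t K. t > 0 \<Longrightarrow> compact K \<Longrightarrow> K \<subseteq> R \<inter> cball 0 t \<Longrightarrow>
      good t K (nn t K) (hh t K) (CC t K)"
    using ex by metis
  define C where "C = rec_nat K (\<lambda>n. CC (r / 4 ^ n))"
  have C0: "C 0 = K" and CS: "\<And>n. C (Suc n) = CC (r / 4 ^ n) (C n)" by (simp_all add: C_def)
  define N where "N n = nn (r / 4 ^ n) (C n)" for n
  define H where "H n = hh (r / 4 ^ n) (C n)" for n
  have t: "r / 4 ^ n > 0" for n using r by simp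
  have C: "compact (C n) \<and> C n \<subseteq> R \<inter> cball 0 (r / 4 ^ n)" for n
  proof (induction n)
    case (Suc n)
    then show ?case using step[OF t[of n], of "C n"] by (simp add: CS good_def mult.commute)
  qed (use K r in \<open>auto simp: C0\<close>)
  have s: "(\<forall>i<N n. H n i \<in> R) \<and>
      (\<forall>a. (\<forall>i<N n. \<bar>a i\<bar> \<le> 1) \<longrightarrow> norm (\<Sum>i<N n. a i *\<^sub>R H n i) \<le> 2 * (r / 4 ^ n)) \<and>
      (\<forall>f\<in>C n. \<exists>f'\<in>C (Suc n). \<exists>a. (\<forall>i<N n. \<bar>a i\<bar> \<le> 1) \<and> f = (\<Sum>i<N n. a i *\<^sub>R H n i) + f')" for n
    using step[OF t[of n], of "C n"] C[of n] unfolding N_def H_def CS good_def by simp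
  define succ where "succ n f f' a \<longleftrightarrow> f' \<in> C (Suc n) \<and> (\<forall>i<N n. \<bar>a i\<bar> \<le> 1) \<and>
      f = (\<Sum>i<N n. a i *\<^sub>R H n i) + f'" for n f f' a
  \<comment> \<open>The sequence of residuals of an element, with the coefficients split off at each step.\<close>
  define pick where "pick n f = (SOME p. succ n f (fst p) (snd p))" for n f
  define nxt where "nxt n f = fst (pick n f)" for n f
  define co where "co n f = snd (pick n f)" for n f
  have "succ n f (nxt n f) (co n f)" if "f \<in> C n" for n f
  proof -
    have "\<exists>f' a. succ n f f' a" using s[of n] that unfolding succ_def by blast
    then have "\<exists>p. succ n f (fst p) (snd p)" by force
    then show ?thesis unfolding nxt_def co_def pick_def by (rule someI_ex)
  qed
  note nc = this[unfolded succ_def]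
  show thesis
  proof (rule that[of r N H])
    show "r > 0" by fact
    show "H n i \<in> R" if "i < N n" for n i using s that by blast
    show "norm (\<Sum>i<N n. a i *\<^sub>R H n i) \<le> 2 * r / 4 ^ n" if "\<And>i. i < N n \<Longrightarrow> \<bar>a i\<bar> \<le> 1" for n a
      using s[of n] that by simp
    fix f assume f: "f \<in> K"
    define g where "g = rec_nat f nxt"
    have g0: "g 0 = f" and gS: "\<And>n. g (Suc n) = nxt n (g n)" by (simp_all add: g_def)
    have gC: "g n \<in> C n" for n by (induction n) (use f nc in \<open>auto simp: g0 gS C0\<close>)
    have "f = (\<Sum>n<m. \<Sum>i<N n. co n (g n) i *\<^sub>R H n i) + g m" for m
    proof (induction m)
      case (Suc m)
      let ?S = "\<Sum>n<m. \<Sum>i<N n. co n (g n) i *\<^sub>R H n i"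
      have "g m = (\<Sum>i<N m. co m (g m) i *\<^sub>R H m i) + g (Suc m)"
        using nc[OF gC[of m]] unfolding gS by blast
      then have "?S + g m = ?S + ((\<Sum>i<N m. co m (g m) i *\<^sub>R H m i) + g (Suc m))"
        by (rule arg_cong)
      with Suc show ?case by (simp only: sum.lessThan_Suc add.assoc)
    qed (simp add: g0)
    then have part: "(\<Sum>n<m. \<Sum>i<N n. co n (g n) i *\<^sub>R H n i) = f - g m" for m
      unfolding eq_diff_eq by (rule sym)
    have "norm (g m) \<le> r * (1 / 4) ^ m" for m
      using gC[of m] C[of m] by (auto simp: power_one_over field_simps)
    moreover have "(\<lambda>m. r * (1 / 4) ^ m) \<longlonglongrightarrow> 0"
      by (intro tendsto_mult_right_zero LIMSEQ_realpow_zero) auto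
    ultimately have "g \<longlonglongrightarrow> 0" by (intro Lim_null_comparison[of g]) auto
    then have "(\<lambda>m. f - g m) \<longlonglongrightarrow> f" using tendsto_diff[OF tendsto_const] by fastforce
    then have "(\<lambda>n. \<Sum>i<N n. co n (g n) i *\<^sub>R H n i) sums f" by (simp add: sums_def part)
    moreover have "\<forall>n. \<forall>i<N n. \<bar>co n (g n) i\<bar> \<le> 1" using nc gC by blast
    ultimately show "\<exists>a. (\<forall>n. \<forall>i<N n. \<bar>a n i\<bar> \<le> 1) \<and> (\<lambda>n. \<Sum>i<N n. a n i *\<^sub>R H n i) sums f"
      by (intro exI[of _ "\<lambda>n. co n (g n)"]) simp
  qed
qed

section \<open>Groups of functionals with uniform convergence on compact sets\<close>

lemma scaleR_mem_if_scaleC: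
  assumes "\<And>c x. x \<in> E \<Longrightarrow> c *\<^sub>C x \<in> E" "x \<in> E" shows "r *\<^sub>R x \<in> (E :: 'e::complex_normed_space set)"
  using assms by (simp add: scaleR_eq_scaleC)

text \<open>
  The common setting of the two parts: a group \<open>F\<close> of bounded linear functionals on a subspace \<open>E\<close> of
  a complex normed space, with the topology of uniform convergence on compact subsets of \<open>E\<close>.
\<close>

locale bounded_functionals =
  fixes E :: "'e::complex_normed_space set" and F :: "('e \<Rightarrow> complex) set"
  assumes E_zero: "0 \<in> E"
    and E_add: "x \<in> E \<Longrightarrow> y \<in> E \<Longrightarrow> x + y \<in> E"
    and E_scaleC: "x \<in> E \<Longrightarrow> c *\<^sub>C x \<in> E"
    and F_extensional: "\<phi> \<in> F \<Longrightarrow> \<phi> \<in> extensional E"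
    and F_linear: "\<phi> \<in> F \<Longrightarrow> clinear_on E \<phi>"
    and F_bounded: "\<phi> \<in> F \<Longrightarrow> \<exists>B. \<forall>x\<in>E. cmod (\<phi> x) \<le> B * norm x"
    and F_zero: "(\<lambda>x\<in>E. 0) \<in> F"
    and F_add: "\<phi> \<in> F \<Longrightarrow> \<psi> \<in> F \<Longrightarrow> (\<lambda>x\<in>E. \<phi> x + \<psi> x) \<in> F"
    and F_neg: "\<phi> \<in> F \<Longrightarrow> (\<lambda>x\<in>E. - \<phi> x) \<in> F"
begin

abbreviation G where "G \<equiv> additive_group E F"
abbreviation T where "T \<equiv> tau_k E F"

lemma G_simps [simp]: "carrier G = F" "\<phi> \<otimes>\<^bsub>G\<^esub> \<psi> = (\<lambda>x\<in>E. \<phi> x + \<psi> x)" "\<one>\<^bsub>G\<^esub> = (\<lambda>x\<in>E. 0)"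
  by (simp_all add: additive_group_def)

lemma E_scaleR: "x \<in> E \<Longrightarrow> r *\<^sub>R x \<in> E"
  by (rule scaleR_mem_if_scaleC[OF E_scaleC])

lemma E_diff: "x \<in> E \<Longrightarrow> y \<in> E \<Longrightarrow> x - y \<in> E"
  using E_add[OF _ E_scaleR[of y "-1"], of x] by simp

lemma E_sum: "(\<And>i. i \<in> I \<Longrightarrow> f i \<in> E) \<Longrightarrow> sum f I \<in> E"
  by (induction I rule: infinite_finite_induct) (auto intro: E_zero E_add)

lemma F_app_add: "\<phi> \<in> F \<Longrightarrow> x \<in> E \<Longrightarrow> y \<in> E \<Longrightarrow> \<phi> (x + y) = \<phi> x + \<phi> y"
  using F_linear by (simp add: clinear_on_def)

lemma F_app_scaleC: "\<phi> \<in> F \<Longrightarrow> x \<in> E \<Longrightarrow> \<phi> (c *\<^sub>C x) = c * \<phi> x"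
  using F_linear by (simp add: clinear_on_def)

lemma F_app_scaleR: "\<phi> \<in> F \<Longrightarrow> x \<in> E \<Longrightarrow> \<phi> (r *\<^sub>R x) = of_real r * \<phi> x"
  by (simp add: scaleR_eq_scaleC F_app_scaleC)

lemma F_app_zero: "\<phi> \<in> F \<Longrightarrow> \<phi> 0 = 0"
  using F_app_scaleR[OF _ E_zero, of \<phi> 0] by simp

lemma F_app_diff: "\<phi> \<in> F \<Longrightarrow> x \<in> E \<Longrightarrow> y \<in> E \<Longrightarrow> \<phi> (x - y) = \<phi> x - \<phi> y"
  using F_app_add[OF _ _ E_scaleR[of y "-1"], of \<phi> x] F_app_scaleR[of \<phi> y "-1"] by simp

lemma F_app_sum: "\<phi> \<in> F \<Longrightarrow> (\<And>i. i \<in> I \<Longrightarrow> f i \<in> E) \<Longrightarrow> \<phi> (sum f I) = (\<Sum>i\<in>I. \<phi> (f i))"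
  by (induction I rule: infinite_finite_induct) (auto simp: F_app_zero F_app_add E_sum)

lemma F_bound_pos: assumes "\<phi> \<in> F" obtains B where "B > 0" "\<And>x. x \<in> E \<Longrightarrow> cmod (\<phi> x) \<le> B * norm x"
proof -
  obtain B where B: "\<forall>x\<in>E. cmod (\<phi> x) \<le> B * norm x" using F_bounded[OF assms] by blast
  have "cmod (\<phi> x) \<le> (\<bar>B\<bar> + 1) * norm x" if "x \<in> E" for x
    using B that mult_right_mono[of B "\<bar>B\<bar> + 1" "norm x"] by fastforce
  then show thesis using that[of "\<bar>B\<bar> + 1"] by simp
qed

lemma F_continuous_on: assumes "\<phi> \<in> F" shows "continuous_on E \<phi>"
proof -
  obtain B where B: "B > 0" "\<And>x. x \<in> E \<Longrightarrow> cmod (\<phi> x) \<le> B * norm x" using F_bound_pos[OF assms] by auto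
  have "dist (\<phi> x) (\<phi> y) \<le> B * dist x y" if "x \<in> E" "y \<in> E" for x y
    using B(2)[OF E_diff[OF that]] assms that by (simp add: dist_norm F_app_diff)
  then have "B-lipschitz_on E \<phi>" using B(1) by (intro lipschitz_onI) auto
  then show ?thesis by (rule lipschitz_on_continuous_on)
qed

lemma group_G: "group G"
proof (rule groupI)
  fix \<phi> assume "\<phi> \<in> carrier G"
  then have \<phi>: "\<phi> \<in> F" by simp
  show "\<one>\<^bsub>G\<^esub> \<otimes>\<^bsub>G\<^esub> \<phi> = \<phi>"
    using F_extensional[OF \<phi>] by (auto simp: fun_eq_iff extensional_def)
  show "\<exists>\<psi>\<in>carrier G. \<psi> \<otimes>\<^bsub>G\<^esub> \<phi> = \<one>\<^bsub>G\<^esub>"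
    using F_neg[OF \<phi>] by (intro bexI[of _ "\<lambda>x\<in>E. - \<phi> x"]) (auto simp: fun_eq_iff)
qed (auto intro: F_add F_zero simp: fun_eq_iff)

lemma inv_G: assumes "\<phi> \<in> F" shows "inv\<^bsub>G\<^esub> \<phi> = (\<lambda>x\<in>E. - \<phi> x)"
proof -
  have "(\<lambda>x\<in>E. - \<phi> x) \<otimes>\<^bsub>G\<^esub> \<phi> = \<one>\<^bsub>G\<^esub>" by (auto simp: fun_eq_iff)
  then show ?thesis
    using group.inv_equality[OF group_G, of "\<lambda>x\<in>E. - \<phi> x" \<phi>] assms F_neg by simp
qed

definition nbhd :: "'e set \<Rightarrow> real \<Rightarrow> ('e \<Rightarrow> complex) \<Rightarrow> ('e \<Rightarrow> complex) set" where
  "nbhd K \<epsilon> \<phi> = {\<psi>\<in>F. \<forall>x\<in>K. cmod (\<psi> x - \<phi> x) < \<epsilon>}"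

text \<open>
  The supremum over the compact set \<open>K\<close> is attained, so it stays strictly below \<open>\<epsilon>\<close> and leaves room for
  a smaller neighbourhood.
\<close>

lemma openin_nbhd:
  assumes K: "compact K" "K \<subseteq> E" and \<phi>: "\<phi> \<in> F" and \<epsilon>: "\<epsilon> > 0"
  shows "openin T (nbhd K \<epsilon> \<phi>)"
  unfolding openin_tau_k
proof (intro conjI ballI)
  show "nbhd K \<epsilon> \<phi> \<subseteq> F" by (auto simp: nbhd_def)
  fix \<psi> assume \<psi>: "\<psi> \<in> nbhd K \<epsilon> \<phi>"
  then have \<psi>F: "\<psi> \<in> F" by (simp add: nbhd_def)
  have "\<exists>m<\<epsilon>. \<forall>x\<in>K. cmod (\<psi> x - \<phi> x) \<le> m"
  proof (cases "K = {}")
    case True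
    then show ?thesis using \<epsilon> by (intro exI[of _ 0]) auto
  next
    case False
    have "continuous_on K (\<lambda>x. cmod (\<psi> x - \<phi> x))"
      using F_continuous_on[OF \<phi>] F_continuous_on[OF \<psi>F] K(2)
      by (intro continuous_intros) (auto intro: continuous_on_subset)
    then obtain x0 where "x0 \<in> K" "\<forall>x\<in>K. cmod (\<psi> x - \<phi> x) \<le> cmod (\<psi> x0 - \<phi> x0)"
      using continuous_attains_sup[OF K(1) False] by blast
    then show ?thesis using \<psi> by (auto simp: nbhd_def)
  qed
  then obtain m where m: "m < \<epsilon>" "\<forall>x\<in>K. cmod (\<psi> x - \<phi> x) \<le> m" by blast
  have "cmod (\<theta> x - \<phi> x) < \<epsilon>" if "x \<in> K" "cmod (\<theta> x - \<psi> x) < \<epsilon> - m" for \<theta> x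
    using norm_triangle_ineq[of "\<theta> x - \<psi> x" "\<psi> x - \<phi> x"] m(2) that by fastforce
  then show "\<exists>K' \<epsilon>'. compact K' \<and> K' \<subseteq> E \<and> 0 < \<epsilon>' \<and>
      {\<theta> \<in> F. \<forall>x\<in>K'. cmod (\<theta> x - \<psi> x) < \<epsilon>'} \<subseteq> nbhd K \<epsilon> \<phi>"
    using K m(1) by (intro exI[of _ K] exI[of _ "\<epsilon> - m"]) (auto simp: nbhd_def)
qed

lemma nbhd_self: "\<phi> \<in> F \<Longrightarrow> \<epsilon> > 0 \<Longrightarrow> \<phi> \<in> nbhd K \<epsilon> \<phi>"
  by (simp add: nbhd_def)

lemma openin_nbhdE:
  assumes "openin T U" "\<phi> \<in> U"
  obtains K \<epsilon> where "compact K" "K \<subseteq> E" "\<epsilon> > 0" "nbhd K \<epsilon> \<phi> \<subseteq> U"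
proof -
  have "\<exists>K \<epsilon>. compact K \<and> K \<subseteq> E \<and> \<epsilon> > 0 \<and> nbhd K \<epsilon> \<phi> \<subseteq> U"
    using assms unfolding openin_tau_k nbhd_def by blast
  then show thesis using that by blast
qed

lemma topological_group_tau_k: "topological_group G T"
  unfolding topological_group_def
proof (intro conjI group_G)
  show "topspace T = carrier G" by simp
  show "continuous_map (prod_topology T T) T (\<lambda>(x, y). x \<otimes>\<^bsub>G\<^esub> y)"
    unfolding continuous_map_eq_topcontinuous_at topcontinuous_at_def
  proof (intro ballI conjI allI impI)
    fix p assume p: "p \<in> topspace (prod_topology T T)"
    then obtain \<phi> \<psi> where p_eq: "p = (\<phi>, \<psi>)" and F: "\<phi> \<in> F" "\<psi> \<in> F" by auto
    show "p \<in> topspace (prod_topology T T)" by fact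
    show "(\<lambda>(x, y). x \<otimes>\<^bsub>G\<^esub> y) \<in> topspace (prod_topology T T) \<rightarrow> topspace T" by (auto intro: F_add)
    fix V assume V: "openin T V \<and> (case p of (x, y) \<Rightarrow> x \<otimes>\<^bsub>G\<^esub> y) \<in> V"
    then obtain K \<epsilon> where K: "compact K" "K \<subseteq> E" "\<epsilon> > 0" "nbhd K \<epsilon> (\<lambda>x\<in>E. \<phi> x + \<psi> x) \<subseteq> V"
      using openin_nbhdE[of V "\<lambda>x\<in>E. \<phi> x + \<psi> x"] by (auto simp: p_eq)
    let ?U = "nbhd K (\<epsilon> / 2) \<phi> \<times> nbhd K (\<epsilon> / 2) \<psi>"
    have "openin (prod_topology T T) ?U"
      using K F by (simp add: openin_prod_Times_iff openin_nbhd)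
    moreover have "p \<in> ?U" using F K(3) by (simp add: p_eq nbhd_self)
    moreover have "(case y of (x, y) \<Rightarrow> x \<otimes>\<^bsub>G\<^esub> y) \<in> V" if y: "y \<in> ?U" for y
    proof -
      obtain \<phi>' \<psi>' where y_eq: "y = (\<phi>', \<psi>')" by force
      have "cmod (\<phi>' x + \<psi>' x - (\<phi> x + \<psi> x)) < \<epsilon>" if "x \<in> K" for x
      proof -
        have "cmod (\<phi>' x - \<phi> x) < \<epsilon> / 2" "cmod (\<psi>' x - \<psi> x) < \<epsilon> / 2"
          using y that by (auto simp: y_eq nbhd_def)
        then show ?thesis
          using norm_triangle_ineq[of "\<phi>' x - \<phi> x" "\<psi>' x - \<psi> x"] by (simp add: algebra_simps)
      qed
      then have "(\<lambda>x\<in>E. \<phi>' x + \<psi>' x) \<in> nbhd K \<epsilon> (\<lambda>x\<in>E. \<phi> x + \<psi> x)"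
        using y K(2) F_add by (auto simp: y_eq nbhd_def subset_iff)
      then show ?thesis using K(4) by (auto simp: y_eq)
    qed
    ultimately show "\<exists>U. openin (prod_topology T T) U \<and> p \<in> U \<and> (\<forall>y\<in>U. (case y of (x, y) \<Rightarrow> x \<otimes>\<^bsub>G\<^esub> y) \<in> V)"
      by blast
  qed
  show "continuous_map T T (\<lambda>x. inv\<^bsub>G\<^esub> x)"
    unfolding continuous_map_eq_topcontinuous_at topcontinuous_at_def
  proof (intro ballI conjI allI impI)
    fix \<phi> assume "\<phi> \<in> topspace T"
    then have \<phi>: "\<phi> \<in> F" by simp
    show "\<phi> \<in> topspace T" by fact
    show "(\<lambda>x. inv\<^bsub>G\<^esub> x) \<in> topspace T \<rightarrow> topspace T" by (auto simp: inv_G F_neg)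
    fix V assume V: "openin T V \<and> inv\<^bsub>G\<^esub> \<phi> \<in> V"
    then obtain K \<epsilon> where K: "compact K" "K \<subseteq> E" "\<epsilon> > 0" "nbhd K \<epsilon> (inv\<^bsub>G\<^esub> \<phi>) \<subseteq> V"
      using openin_nbhdE[of V "inv\<^bsub>G\<^esub> \<phi>"] by auto
    have "inv\<^bsub>G\<^esub> \<psi> \<in> V" if "\<psi> \<in> nbhd K \<epsilon> \<phi>" for \<psi>
    proof -
      have \<psi>: "\<psi> \<in> F" using that by (simp add: nbhd_def)
      have "cmod (- \<psi> x - - \<phi> x) < \<epsilon>" if "x \<in> K" for x
      proof -
        have "cmod (\<psi> x - \<phi> x) < \<epsilon>" using \<open>\<psi> \<in> nbhd K \<epsilon> \<phi>\<close> that by (simp add: nbhd_def)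
        then show ?thesis using norm_minus_commute[of "\<psi> x" "\<phi> x"] by simp
      qed
      then have "inv\<^bsub>G\<^esub> \<psi> \<in> nbhd K \<epsilon> (inv\<^bsub>G\<^esub> \<phi>)"
        using \<phi> \<psi> K(2) F_neg by (auto simp: inv_G nbhd_def subset_iff)
      then show ?thesis using K(4) by blast
    qed
    then show "\<exists>U. openin T U \<and> \<phi> \<in> U \<and> (\<forall>\<psi>\<in>U. inv\<^bsub>G\<^esub> \<psi> \<in> V)"
      using openin_nbhd[OF K(1,2) \<phi> K(3)] nbhd_self[OF \<phi> K(3)] by blast
  qed
qed

text \<open>
  The \<open>l\<^sup>1\<close>-norm of the values of \<open>\<phi>\<close> is attained on a combination with signs. This turns smallness of \<open>\<phi>\<close>
  on the vertices of a cube into smallness of the sum of absolute values.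
\<close>

lemma sum_abs_le_signs:
  fixes h :: "nat \<Rightarrow> 'e" and n :: nat
  assumes \<phi>: "\<phi> \<in> F" and h: "\<And>i. i < n \<Longrightarrow> h i \<in> E"
    and M: "\<And>A. cmod (\<phi> (\<Sum>i<n. (if i \<in> A then 1 else - 1) *\<^sub>R h i)) \<le> M"
  shows "(\<Sum>i<n. \<bar>Re (\<phi> (h i))\<bar> + \<bar>Im (\<phi> (h i))\<bar>) \<le> 2 * M"
proof -
  have eq: "\<phi> (\<Sum>i<n. (if i \<in> A then 1 else - 1) *\<^sub>R h i) = (\<Sum>i<n. of_real (if i \<in> A then 1 else - 1) * \<phi> (h i))" for A
    using \<phi> h by (subst F_app_sum) (simp_all add: F_app_scaleR E_scaleR del: scaleR_minus_left)
  have "(\<Sum>i<n. \<bar>Re (\<phi> (h i))\<bar>) = Re (\<phi> (\<Sum>i<n. (if i \<in> {i. Re (\<phi> (h i)) \<ge> 0} then 1 else - 1) *\<^sub>R h i))"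
    unfolding eq by (simp add: Re_sum) (intro sum.cong, auto)
  also have "\<dots> \<le> M" using complex_Re_le_cmod M order_trans by blast
  finally have 1: "(\<Sum>i<n. \<bar>Re (\<phi> (h i))\<bar>) \<le> M" .
  have "(\<Sum>i<n. \<bar>Im (\<phi> (h i))\<bar>) = Im (\<phi> (\<Sum>i<n. (if i \<in> {i. Im (\<phi> (h i)) \<ge> 0} then 1 else - 1) *\<^sub>R h i))"
    unfolding eq by (simp add: Im_sum) (intro sum.cong, auto)
  also have "\<dots> \<le> M" using abs_Im_le_cmod M order_trans abs_ge_self by meson
  finally have "(\<Sum>i<n. \<bar>Im (\<phi> (h i))\<bar>) \<le> M" .
  with 1 show ?thesis by (simp add: sum.distrib)
qed

text \<open>
  Given a compact set \<open>K\<close>, expand the real and imaginary parts of its elements as series of combinations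
  of vectors \<open>H n i\<close> with coefficients in \<open>[-1, 1]\<close>, and let \<open>q \<phi>\<close> be the sum over \<open>n\<close> and \<open>i\<close> of
  \<open>\<bar>Re (\<phi> (H n i))\<bar> + \<bar>Im (\<phi> (H n i))\<bar>\<close>. Then \<open>\<bar>\<phi>\<bar> \<le> 2 q \<phi>\<close> on \<open>K\<close>, so that smallness of \<open>q\<close> forces
  smallness on \<open>K\<close>. Conversely \<open>q \<phi>\<close> is small when \<open>\<phi>\<close> is small on a suitable compact set \<open>L\<close>, so that
  \<open>q\<close> is continuous at 0. Since \<open>q\<close> is a sum of absolute values of real additive functions, \<open>exp (- q)\<close>
  is positive definite.
\<close>

theorem unitarily_representable_tau_k:
  assumes R: "R \<subseteq> E" "0 \<in> R" "\<And>x y. x \<in> R \<Longrightarrow> y \<in> R \<Longrightarrow> x + y \<in> R" "\<And>r x. x \<in> R \<Longrightarrow> r *\<^sub>R x \<in> R"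
    and cube: "cube_spanned R"
    and parts: "continuous_on E re" "continuous_on E im"
      "\<And>x. x \<in> E \<Longrightarrow> re x \<in> R" "\<And>x. x \<in> E \<Longrightarrow> im x \<in> R" "\<And>x. x \<in> E \<Longrightarrow> x = re x + \<i> *\<^sub>C im x"
  shows "unitarily_representable G T"
proof (rule unitarily_representable_if_positive_definite[OF topological_group_tau_k])
  have zero: "(\<lambda>x\<in>E. 0) \<in> F" by (rule F_zero)
  fix g assume g: "g \<in> carrier G" "g \<noteq> \<one>\<^bsub>G\<^esub>"
  then have "\<exists>x\<in>E. g x \<noteq> 0"
    using extensionalityI[of g E "\<lambda>x\<in>E. 0"] F_extensional[of g] by auto
  then obtain x where x: "x \<in> E" "g x \<noteq> 0" by blast
  then show "\<exists>N. openin T N \<and> \<one>\<^bsub>G\<^esub> \<in> N \<and> g \<notin> N"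
    using openin_nbhd[of "{x}" "\<lambda>x\<in>E. 0" "cmod (g x)"] zero
    by (intro exI[of _ "nbhd {x} (cmod (g x)) (\<lambda>x\<in>E. 0)"]) (auto simp: nbhd_def)
next
  fix U assume "openin T U" "\<one>\<^bsub>G\<^esub> \<in> U"
  then obtain K \<epsilon> where K: "compact K" "K \<subseteq> E" "\<epsilon> > 0" "nbhd K \<epsilon> (\<lambda>x\<in>E. 0) \<subseteq> U"
    using openin_nbhdE[of U "\<lambda>x\<in>E. 0"] by auto
  have c1: "compact (re ` K \<union> im ` K)"
    using parts K continuous_on_subset by (intro compact_Un compact_continuous_image) blast+
  have c2: "re ` K \<union> im ` K \<subseteq> R" using parts K by blast
  show "\<exists>\<psi>. psd_on (carrier G) (\<lambda>g h. \<psi> (inv\<^bsub>G\<^esub> h \<otimes>\<^bsub>G\<^esub> g)) \<and> \<psi> \<one>\<^bsub>G\<^esub> = 1 \<and>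
        (\<forall>\<epsilon>>0. \<exists>U. openin T U \<and> \<one>\<^bsub>G\<^esub> \<in> U \<and> (\<forall>g\<in>U. 1 - \<psi> g < \<epsilon>)) \<and>
        (\<exists>\<delta>>0. \<forall>g\<in>carrier G. 1 - \<psi> g < \<delta> \<longrightarrow> g \<in> U)"
  proof (rule cube_spanned_compact_expansion[OF cube R(3,4) c1 c2])
    fix N :: "nat \<Rightarrow> nat" and H r
    assume r: "r > 0" and HR: "\<And>n i. i < N n \<Longrightarrow> H n i \<in> R"
      and small: "\<And>n a. (\<And>i. i < N n \<Longrightarrow> \<bar>a i\<bar> \<le> 1) \<Longrightarrow> norm (\<Sum>i<N n. a i *\<^sub>R H n i) \<le> 2 * r / 4 ^ n"
      and expand: "\<And>f. f \<in> re ` K \<union> im ` K \<Longrightarrow>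
        \<exists>a. (\<forall>n. \<forall>i<N n. \<bar>a n i\<bar> \<le> 1) \<and> (\<lambda>n. \<Sum>i<N n. a n i *\<^sub>R H n i) sums f"
    have HE: "H n i \<in> E" if "i < N n" for n i using HR[OF that] R(1) by blast
    define t where "t n \<phi> = (\<Sum>i<N n. \<bar>Re (\<phi> (H n i))\<bar> + \<bar>Im (\<phi> (H n i))\<bar>)" for n and \<phi> :: "'e \<Rightarrow> complex"
    define q where "q \<phi> = (\<Sum>n. t n \<phi>)" for \<phi>
    define sgns where "sgns n A = (\<Sum>i<N n. (if i \<in> A then 1 else - 1 :: real) *\<^sub>R H n i)" for n A
    have sgns_E: "sgns n A \<in> E" for n A
      unfolding sgns_def by (intro E_sum E_scaleR HE) auto
    have sgns_norm: "norm (sgns n A) \<le> 2 * r / 4 ^ n" for n A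
      unfolding sgns_def by (rule small) auto
    have t_nonneg: "0 \<le> t n \<phi>" for n \<phi> unfolding t_def by (intro sum_nonneg) auto
    have t_le: "t n \<phi> \<le> 2 * M" if "\<phi> \<in> F" "\<And>A. cmod (\<phi> (sgns n A)) \<le> M" for n \<phi> M
      unfolding t_def using that HE by (intro sum_abs_le_signs) (auto simp: sgns_def)
    have summable_t: "summable (\<lambda>n. t n \<phi>)" if \<phi>: "\<phi> \<in> F" for \<phi>
    proof -
      obtain B where B: "B > 0" "\<And>x. x \<in> E \<Longrightarrow> cmod (\<phi> x) \<le> B * norm x" using F_bound_pos[OF \<phi>] by auto
      have "t n \<phi> \<le> 2 * (B * (2 * r / 4 ^ n))" for n
        using B sgns_E sgns_norm by (intro t_le[OF \<phi>]) (meson mult_left_mono order_trans less_imp_le)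
      then have "norm (t n \<phi>) \<le> (4 * B * r) * (1 / 4) ^ n" for n
        using t_nonneg[of n \<phi>] by (simp add: power_one_over mult.assoc)
      moreover have "summable (\<lambda>n. (4 * B * r) * (1 / 4 :: real) ^ n)"
        by (intro summable_mult summable_geometric) auto
      ultimately show ?thesis using summable_comparison_test'[of "\<lambda>n. (4 * B * r) * (1 / 4) ^ n" 0 "\<lambda>n. t n \<phi>"] by blast
    qed
    have q_nonneg: "0 \<le> q \<phi>" if "\<phi> \<in> F" for \<phi>
      unfolding q_def by (intro suminf_nonneg summable_t that t_nonneg)
    have q_dominates: "cmod (\<phi> f) \<le> q \<phi>" if \<phi>: "\<phi> \<in> F" and f: "f \<in> re ` K \<union> im ` K" for \<phi> f
    proof -
      obtain a where a: "\<forall>n. \<forall>i<N n. \<bar>a n i\<bar> \<le> 1" "(\<lambda>n. \<Sum>i<N n. a n i *\<^sub>R H n i) sums f"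
        using expand[OF f] by blast
      let ?p = "\<lambda>m. \<Sum>n<m. \<Sum>i<N n. a n i *\<^sub>R H n i"
      have pE: "?p m \<in> E" for m by (intro E_sum E_scaleR HE) auto
      have fE: "f \<in> E" using f parts(3,4) K(2) R(1) by blast
      have term_le: "cmod (\<phi> (\<Sum>i<N n. a n i *\<^sub>R H n i)) \<le> t n \<phi>" for n
      proof -
        have "\<phi> (\<Sum>i<N n. a n i *\<^sub>R H n i) = (\<Sum>i<N n. of_real (a n i) * \<phi> (H n i))"
          using \<phi> HE by (subst F_app_sum) (auto simp: F_app_scaleR intro!: E_scaleR)
        also have "cmod \<dots> \<le> (\<Sum>i<N n. cmod (of_real (a n i) * \<phi> (H n i)))" by (rule norm_sum)
        also have "\<dots> \<le> t n \<phi>"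
          unfolding t_def
        proof (rule sum_mono)
          fix i assume "i \<in> {..<N n}"
          then have "cmod (of_real (a n i) * \<phi> (H n i)) \<le> 1 * cmod (\<phi> (H n i))"
            unfolding norm_mult using a(1) by (intro mult_right_mono) auto
          then show "cmod (of_real (a n i) * \<phi> (H n i)) \<le> \<bar>Re (\<phi> (H n i))\<bar> + \<bar>Im (\<phi> (H n i))\<bar>"
            using cmod_le[of "\<phi> (H n i)"] by simp
        qed
        finally show ?thesis .
      qed
      have "cmod (\<phi> (?p m)) \<le> q \<phi>" for m
      proof -
        have "\<phi> (?p m) = (\<Sum>n<m. \<phi> (\<Sum>i<N n. a n i *\<^sub>R H n i))"
          by (intro F_app_sum \<phi> E_sum E_scaleR HE) auto
        also have "cmod \<dots> \<le> (\<Sum>n<m. t n \<phi>)" by (rule order_trans[OF norm_sum sum_mono]) (rule term_le)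
        also have "\<dots> \<le> q \<phi>" unfolding q_def by (intro sum_le_suminf summable_t \<phi> t_nonneg) auto
        finally show ?thesis .
      qed
      moreover have "(\<lambda>m. \<phi> (?p m)) \<longlonglongrightarrow> \<phi> f"
        using continuous_on_tendsto_compose[OF F_continuous_on[OF \<phi>], of ?p f] a(2) pE fE
        by (simp add: sums_def)
      ultimately show ?thesis
        by (intro LIMSEQ_le_const2[OF tendsto_norm]) auto
    qed
    have q_K: "cmod (\<phi> x) \<le> 2 * q \<phi>" if \<phi>: "\<phi> \<in> F" and x: "x \<in> K" for \<phi> x
    proof -
      have xE: "x \<in> E" "re x \<in> E" "im x \<in> E" using x K(2) parts(3,4) R(1) by blast+
      have "\<phi> x = \<phi> (re x) + \<i> * \<phi> (im x)"
        using parts(5)[OF xE(1)] \<phi> xE by (metis E_scaleC F_app_add F_app_scaleC)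
      then have "cmod (\<phi> x) \<le> cmod (\<phi> (re x)) + cmod (\<phi> (im x))"
        using norm_triangle_ineq[of "\<phi> (re x)" "\<i> * \<phi> (im x)"] by (simp add: norm_mult)
      then show ?thesis using q_dominates[OF \<phi>, of "re x"] q_dominates[OF \<phi>, of "im x"] x by auto
    qed
    \<comment> \<open>The sign combinations of level \<open>n\<close> have norm at most \<open>2 r / 4\<^sup>n\<close>. Multiplied by \<open>2\<^sup>n\<close> they still tend to
      0, and the gain of \<open>2\<^sup>n\<close> makes a uniform bound on \<open>L\<close> summable over the levels.\<close>
    define P where "P n = (\<lambda>A. (2 ^ n :: real) *\<^sub>R sgns n A) ` Pow {..<N n}" for n
    define L where "L = insert 0 (\<Union>n. P n)"
    have "compact L"
      unfolding L_def
    proof (rule compact_insert_zero_UN_finite)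
      show "finite (P n)" for n by (simp add: P_def)
      show "norm x \<le> 2 * r * (1 / 2) ^ n" if x: "x \<in> P n" for x n
      proof -
        obtain A where "x = (2 ^ n :: real) *\<^sub>R sgns n A" using x by (auto simp: P_def)
        then have "norm x \<le> 2 ^ n * (2 * r / 4 ^ n)"
          using mult_left_mono[OF sgns_norm[of n A], of "2 ^ n"] by simp
        also have "(4 :: real) ^ n = 2 ^ n * 2 ^ n" by (simp flip: power_mult_distrib)
        finally show ?thesis by (simp add: power_one_over)
      qed
      show "(\<lambda>n. 2 * r * (1 / 2) ^ n) \<longlonglongrightarrow> 0"
        by (intro tendsto_mult_right_zero LIMSEQ_realpow_zero) auto
    qed
    have "L \<subseteq> E" using E_zero E_scaleR[OF sgns_E] by (auto simp: L_def P_def)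
    have q_L: "q \<phi> \<le> 4 * \<delta>" if \<phi>: "\<phi> \<in> F" and L: "\<And>x. x \<in> L \<Longrightarrow> cmod (\<phi> x) \<le> \<delta>" for \<phi> \<delta>
    proof -
      have "t n \<phi> \<le> 2 * (\<delta> * (1 / 2) ^ n)" for n
      proof (rule t_le[OF \<phi>])
        fix A
        have "sgns n A = sgns n (A \<inter> {..<N n})" unfolding sgns_def by (rule sum.cong) auto
        then have "(2 ^ n :: real) *\<^sub>R sgns n A \<in> L" by (auto simp: L_def P_def)
        then have "2 ^ n * cmod (\<phi> (sgns n A)) \<le> \<delta>"
          using L[of "(2 ^ n :: real) *\<^sub>R sgns n A"] \<phi> sgns_E by (simp add: F_app_scaleR norm_mult norm_power)
        then show "cmod (\<phi> (sgns n A)) \<le> \<delta> * (1 / 2) ^ n"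
          by (simp add: power_one_over field_simps)
      qed
      then have "q \<phi> \<le> (\<Sum>n. 2 * \<delta> * (1 / 2) ^ n)"
        unfolding q_def by (intro suminf_le summable_t \<phi> summable_mult summable_geometric) (auto simp: mult.assoc)
      also have "\<dots> = 4 * \<delta>" by (subst suminf_mult) (auto simp: suminf_geometric)
      finally show ?thesis .
    qed
    have diff: "inv\<^bsub>G\<^esub> \<psi> \<otimes>\<^bsub>G\<^esub> \<phi> \<in> F" if "\<phi> \<in> F" "\<psi> \<in> F" for \<phi> \<psi>
      using F_add[OF F_neg[OF that(2)] that(1)] that by (simp add: inv_G)
    have diff_app: "(inv\<^bsub>G\<^esub> \<psi> \<otimes>\<^bsub>G\<^esub> \<phi>) x = \<phi> x - \<psi> x" if "\<phi> \<in> F" "\<psi> \<in> F" "x \<in> E" for \<phi> \<psi> x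
      using that by (simp add: inv_G)
    define D where "D n \<phi> \<psi> = (\<Sum>i<N n. \<bar>Re (\<phi> (H n i)) - Re (\<psi> (H n i))\<bar> + \<bar>Im (\<phi> (H n i)) - Im (\<psi> (H n i))\<bar>)"
      for n and \<phi> \<psi> :: "'e \<Rightarrow> complex"
    have D: "D n \<phi> \<psi> = t n (inv\<^bsub>G\<^esub> \<psi> \<otimes>\<^bsub>G\<^esub> \<phi>)" if "\<phi> \<in> F" "\<psi> \<in> F" for n \<phi> \<psi>
      unfolding D_def t_def using diff_app[OF that] HE by (intro sum.cong) (auto simp del: G_simps)
    have "negative_kernel F (D n)" for n
      unfolding D_def by (intro negative_kernel_sum negative_kernel_add negative_kernel_abs)
    then have "negative_kernel F (\<lambda>\<phi> \<psi>. \<Sum>n. D n \<phi> \<psi>)"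
      by (rule negative_kernel_suminf) (simp add: D summable_t diff del: G_simps)
    then have psd: "psd_on F (\<lambda>\<phi> \<psi>. exp (- (\<Sum>n. D n \<phi> \<psi>)))" by (rule psd_on_exp_minus)
    have "psd_on F (\<lambda>\<phi> \<psi>. exp (- q (inv\<^bsub>G\<^esub> \<psi> \<otimes>\<^bsub>G\<^esub> \<phi>)))"
      by (rule psd_on_limit[where K = "\<lambda>_ \<phi> \<psi>. exp (- (\<Sum>n. D n \<phi> \<psi>))"]) (simp_all add: psd q_def D del: G_simps)
    moreover have "exp (- q (\<one>\<^bsub>G\<^esub>)) = 1"
      unfolding q_def t_def using HE by simp
    \<comment> \<open>On \<open>L\<close> the bound \<open>\<epsilon> / 5\<close> gives \<open>q \<phi> \<le> 4 \<epsilon> / 5\<close>.\<close>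
    moreover have "\<exists>V. openin T V \<and> \<one>\<^bsub>G\<^esub> \<in> V \<and> (\<forall>\<phi>\<in>V. 1 - exp (- q \<phi>) < \<epsilon>)" if "\<epsilon> > 0" for \<epsilon>
    proof (intro exI[of _ "nbhd L (\<epsilon> / 5) (\<lambda>x\<in>E. 0)"] conjI ballI)
      show "openin T (nbhd L (\<epsilon> / 5) (\<lambda>x\<in>E. 0))"
        using that by (intro openin_nbhd \<open>compact L\<close> \<open>L \<subseteq> E\<close> F_zero) auto
      show "\<one>\<^bsub>G\<^esub> \<in> nbhd L (\<epsilon> / 5) (\<lambda>x\<in>E. 0)" using that by (simp add: nbhd_self F_zero)
      fix \<phi> assume "\<phi> \<in> nbhd L (\<epsilon> / 5) (\<lambda>x\<in>E. 0)"
      then have "\<phi> \<in> F" "\<And>x. x \<in> L \<Longrightarrow> cmod (\<phi> x) \<le> \<epsilon> / 5"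
        using \<open>L \<subseteq> E\<close> by (auto simp: nbhd_def subset_iff intro: less_imp_le)
      then have "q \<phi> \<le> 4 * (\<epsilon> / 5)" by (rule q_L)
      moreover have "1 - exp (- q \<phi>) \<le> q \<phi>" using exp_ge_add_one_self[of "- q \<phi>"] by simp
      ultimately show "1 - exp (- q \<phi>) < \<epsilon>" using that by simp
    qed
    \<comment> \<open>The constant makes \<open>q \<phi> < \<epsilon> / 3\<close>, hence \<open>\<bar>\<phi>\<bar> \<le> 2 q \<phi> < \<epsilon>\<close> on \<open>K\<close>.\<close>
    moreover have "\<exists>\<delta>>0. \<forall>\<phi>\<in>F. 1 - exp (- q \<phi>) < \<delta> \<longrightarrow> \<phi> \<in> U"
    proof (intro exI[of _ "1 - exp (- (\<epsilon> / 3))"] conjI ballI impI)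
      show "0 < 1 - exp (- (\<epsilon> / 3))" using K(3) by simp
      fix \<phi> assume \<phi>: "\<phi> \<in> F" "1 - exp (- q \<phi>) < 1 - exp (- (\<epsilon> / 3))"
      then have "q \<phi> < \<epsilon> / 3" by simp
      then have "cmod (\<phi> x) < \<epsilon>" if "x \<in> K" for x using q_K[OF \<phi>(1) that] K(3) by linarith
      then have "\<phi> \<in> nbhd K \<epsilon> (\<lambda>x\<in>E. 0)" using \<phi>(1) K(2) by (auto simp: nbhd_def subset_iff)
      then show "\<phi> \<in> U" using K(4) by blast
    qed
    ultimately show ?thesis
      by (intro exI[of _ "\<lambda>\<phi>. exp (- q \<phi>)"]) (simp only: G_simps, blast)
  qed
qed

end

section \<open>Commutative C*-algebras\<close>

lemma cube_spanned_isometry: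
  fixes L :: "'a::real_normed_vector \<Rightarrow> 'b::real_normed_vector"
  assumes L: "linear L" "\<And>x. x \<in> R \<Longrightarrow> norm (L x) = norm x"
    and R: "0 \<in> R" "\<And>x y. x \<in> R \<Longrightarrow> y \<in> R \<Longrightarrow> x + y \<in> R" "\<And>r x. x \<in> R \<Longrightarrow> r *\<^sub>R x \<in> R"
    and cube: "cube_spanned (L ` R)"
  shows "cube_spanned R"
  unfolding cube_spanned_def
proof (intro allI impI)
  fix F assume F: "finite F" "F \<subseteq> R \<inter> cball 0 1"
  then have LF: "finite (L ` F)" "L ` F \<subseteq> L ` R \<inter> cball 0 1"
    using L(2) F by (auto simp: subset_iff)
  obtain n :: nat and h where h: "\<forall>i<n. h i \<in> L ` R"
      "\<forall>f\<in>L ` F. \<exists>a. (\<forall>i<n. \<bar>a i\<bar> \<le> 1) \<and> f = (\<Sum>i<n. a i *\<^sub>R h i)"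
      "\<forall>a. (\<forall>i<n. \<bar>a i\<bar> \<le> 1) \<longrightarrow> norm (\<Sum>i<n. a i *\<^sub>R h i) \<le> 2"
    using cube[unfolded cube_spanned_def, rule_format, OF LF] by (elim exE conjE)
  have "\<forall>i. \<exists>x. i < n \<longrightarrow> x \<in> R \<and> h i = L x" using h(1) by blast
  then obtain g where g: "\<And>i. i < n \<Longrightarrow> g i \<in> R \<and> h i = L (g i)" by metis
  have sum_R: "(\<Sum>i<m. a i *\<^sub>R g i) \<in> R" if "m \<le> n" for a m
    using that by (induction m) (simp_all add: R g)
  have sum_L: "(\<Sum>i<n. a i *\<^sub>R h i) = L (\<Sum>i<n. a i *\<^sub>R g i)" for a
    using g by (simp add: linear_sum[OF L(1)] linear_scale[OF L(1)])
  have inj: "x = y" if "x \<in> R" "y \<in> R" "L x = L y" for x y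
  proof -
    have "x - y \<in> R" using R(2)[OF that(1) R(3)[OF that(2), of "-1"]] by simp
    then have "norm (x - y) = 0" using L(2)[of "x - y"] that(3) by (simp add: linear_diff[OF L(1)])
    then show ?thesis by simp
  qed
  show "\<exists>(n::nat) h. (\<forall>i<n. h i \<in> R) \<and>
        (\<forall>f\<in>F. \<exists>a. (\<forall>i<n. \<bar>a i\<bar> \<le> 1) \<and> f = (\<Sum>i<n. a i *\<^sub>R h i)) \<and>
        (\<forall>a. (\<forall>i<n. \<bar>a i\<bar> \<le> 1) \<longrightarrow> norm (\<Sum>i<n. a i *\<^sub>R h i) \<le> 2)"
  proof (intro exI[of _ n] exI[of _ g] conjI allI impI ballI)
    show "g i \<in> R" if "i < n" for i using g that by blast
    fix f assume f: "f \<in> F"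
    then obtain a where a: "\<forall>i<n. \<bar>a i\<bar> \<le> 1" "L f = (\<Sum>i<n. a i *\<^sub>R h i)" using h(2) by blast
    then have "f = (\<Sum>i<n. a i *\<^sub>R g i)" unfolding sum_L using f F by (intro inj sum_R) auto
    then show "\<exists>a. (\<forall>i<n. \<bar>a i\<bar> \<le> 1) \<and> f = (\<Sum>i<n. a i *\<^sub>R g i)" using a by blast
  next
    fix a :: "nat \<Rightarrow> real" assume "\<forall>i<n. \<bar>a i\<bar> \<le> 1"
    then have "norm (\<Sum>i<n. a i *\<^sub>R h i) \<le> 2" using h(3) by blast
    then show "norm (\<Sum>i<n. a i *\<^sub>R g i) \<le> 2"
      unfolding sum_L using L(2)[OF sum_R[OF order_refl]] by simp
  qed
qed

lemma star_zero: "star 0 = (0 :: 'a::cstar_algebra)"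
  using star_add[of 0 "0 :: 'a"] by simp

lemma star_scaleR: "star (r *\<^sub>R x) = r *\<^sub>R star (x :: 'a::cstar_algebra)"
  by (simp add: scaleR_eq_scaleC star_scaleC)

lemma star_minus: "star (- x) = - star (x :: 'a::cstar_algebra)"
  using star_scaleR[of "-1" x] by simp

lemma star_diff: "star (x - y) = star x - star (y :: 'a::cstar_algebra)"
  using star_add[of x "- y"] by (simp add: star_minus)

lemma norm_star: "norm (star x) = norm (x :: 'a::cstar_algebra)"
proof -
  have le: "norm x \<le> norm (star x)" for x :: 'a
  proof (cases "x = 0")
    case False
    have "norm x * norm x \<le> norm (star x) * norm x"
      using cstar_identity[of x] norm_mult_ineq[of "star x" x] by (simp add: power2_eq_square)
    then show ?thesis using False by simp
  qed (simp add: star_zero)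
  show ?thesis using le[of x] le[of "star x"] by (simp add: star_star)
qed

lemma bounded_linear_star: "bounded_linear (star :: 'a::cstar_algebra \<Rightarrow> 'a)"
  by (rule bounded_linear_intro[of _ 1]) (auto simp: star_add star_scaleR norm_star)

lemma mult_zero_imp_zero:
  fixes d :: "'a::cstar_algebra"
  assumes "\<And>y. y * d = 0" shows "d = 0"
  using cstar_identity[of d] assms by simp

text \<open>
  An algebra without unit acts on itself by multiplication, and its self-adjoint part lies in this
  unital algebra of operators, a substitute for the unitization that carries the right norm from the
  start. On a commutative algebra the adjoint of a multiplier \<open>T\<close> is \<open>x \<mapsto> (T x\<^sup>*)\<^sup>*\<close>, so that the
  second condition says that \<open>T\<close> is self-adjoint.
\<close>

definition self_adjoint_multipliers :: "('a::comm_cstar_algebra \<Rightarrow>\<^sub>L 'a) set" where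
  "self_adjoint_multipliers = {T. (\<forall>x y. blinfun_apply T (x * y) = blinfun_apply T x * y) \<and>
     (\<forall>x. blinfun_apply T (star x) = star (blinfun_apply T x))}"

context
  fixes T :: "'a::comm_cstar_algebra \<Rightarrow>\<^sub>L 'a"
  assumes T: "T \<in> self_adjoint_multipliers"
begin

lemma multiplier_left: "T (x * y) = T x * y"
  using T by (simp add: self_adjoint_multipliers_def)

lemma multiplier_right: "T (x * y) = x * T y"
  using multiplier_left[of y x] by (simp add: mult.commute)

lemma multiplier_star: "T (star x) = star (T x)"
  using T by (simp add: self_adjoint_multipliers_def)

end

lemma multipliers_commute:
  assumes "S \<in> self_adjoint_multipliers" "T \<in> self_adjoint_multipliers"
  shows "S \<cdot> T = T \<cdot> S"
proof (rule blinfun_eqI)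
  fix x :: 'a
  have "S (T x) - T (S x) = 0"
  proof (rule mult_zero_imp_zero)
    fix y
    have "y * S (T x) = S (y * T x)" using multiplier_right[OF assms(1)] by simp
    also have "\<dots> = S y * T x" using multiplier_left[OF assms(1)] .
    also have "\<dots> = T (S y * x)" using multiplier_right[OF assms(2)] by simp
    also have "S y * x = S (y * x)" using multiplier_left[OF assms(1)] by simp
    also have "\<dots> = y * S x" using multiplier_right[OF assms(1)] .
    also have "T (y * S x) = y * T (S x)" using multiplier_right[OF assms(2)] .
    finally show "y * (S (T x) - T (S x)) = 0" by (simp add: right_diff_distrib)
  qed
  then show "(S \<cdot> T) x = (T \<cdot> S) x" by simp
qed

lemma scaleC_minus_left: "(- c) *\<^sub>C x = - (c *\<^sub>C (x :: 'a::complex_normed_space))"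
  using scaleC_scaleC[of "-1" c x] scaleR_eq_scaleC[of "-1" "c *\<^sub>C x"] by simp

lemma scaleC_diff_right: "c *\<^sub>C (x - y) = c *\<^sub>C x - c *\<^sub>C (y :: 'a::complex_normed_space)"
  using linear_diff[OF bounded_linear.linear[OF bounded_linear_scaleC]] .

text \<open>
  For \<open>p = U x + \<i> V x\<close> the product \<open>p\<^sup>* p\<close> is \<open>(U\<^sup>2 + V\<^sup>2) (x\<^sup>* x)\<close>, which bounds \<open>p\<close> by the C*-identity. The
  same bound holds with \<open>- \<i>\<close> in place of \<open>\<i>\<close>, and \<open>U x\<close> is the mean of the two elements.
\<close>

lemma norm_multiplier_sum_squares:
  fixes U V :: "'a::comm_cstar_algebra \<Rightarrow>\<^sub>L 'a"
  assumes U: "U \<in> self_adjoint_multipliers" and V: "V \<in> self_adjoint_multipliers"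
  shows "(norm U)\<^sup>2 \<le> norm (U \<cdot> U + V \<cdot> V)"
proof -
  define c where "c = norm (U \<cdot> U + V \<cdot> V)"
  \<comment> \<open>The number \<open>w\<close> stands for \<open>\<i>\<close> or \<open>- \<i>\<close>.\<close>
  have *: "norm (U x + w *\<^sub>C V x) \<le> sqrt c * norm x" if w: "cnj w = - w" "w * w = -1" for w x
  proof -
    let ?p = "U x + w *\<^sub>C V x"
    have UU: "U a * W b = U (W (a * b))" if "W \<in> self_adjoint_multipliers" for W a b
      using multiplier_left[OF U, of a "W b"] multiplier_right[OF that, of a b] by simp
    have VW: "V a * W b = V (W (a * b))" if "W \<in> self_adjoint_multipliers" for W a b
      using multiplier_left[OF V, of a "W b"] multiplier_right[OF that, of a b] by simp
    have com: "V (U z) = U (V z)" for z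
      using multipliers_commute[OF U V] by (metis blinfun_apply_blinfun_compose)
    have "star ?p = U (star x) + (- w) *\<^sub>C V (star x)"
      by (simp add: star_add star_scaleC w multiplier_star[OF U] multiplier_star[OF V])
    then have "star ?p * ?p = U (star x) * U x + w *\<^sub>C (U (star x) * V x)
        + (- w) *\<^sub>C (V (star x) * U x) + ((- w) * w) *\<^sub>C (V (star x) * V x)"
      by (simp add: distrib_left distrib_right scaleC_mult_left scaleC_mult_right scaleC_scaleC scaleC_add_right add.assoc)
    also have "\<dots> = (U \<cdot> U + V \<cdot> V) (star x * x)"
      using w by (simp add: UU[OF U] UU[OF V] VW[OF U] VW[OF V] com scaleC_minus_left scaleC_one blinfun.add_left)
    finally have "(norm ?p)\<^sup>2 \<le> c * norm (star x * x)"
      unfolding c_def using norm_blinfun[of "U \<cdot> U + V \<cdot> V" "star x * x"]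
      by (simp flip: cstar_identity)
    also have "\<dots> = (sqrt c * norm x)\<^sup>2"
      by (simp add: cstar_identity power_mult_distrib c_def)
    finally show ?thesis by (rule power2_le_imp_le) (simp add: c_def)
  qed
  have "norm U \<le> sqrt c"
  proof (rule norm_blinfun_bound)
    show "0 \<le> sqrt c" by (simp add: c_def)
    fix x
    have "(U x + \<i> *\<^sub>C V x) + (U x + (- \<i>) *\<^sub>C V x) = 2 *\<^sub>R U x"
      by (simp add: scaleC_minus_left scaleR_2)
    then have "2 * norm (U x) = norm ((U x + \<i> *\<^sub>C V x) + (U x + (- \<i>) *\<^sub>C V x))"
      by simp
    also have "\<dots> \<le> sqrt c * norm x + sqrt c * norm x"
      by (rule norm_triangle_mono) (rule *; simp)+
    finally show "norm (U x) \<le> sqrt c * norm x" by simp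
  qed
  then have "(norm U)\<^sup>2 \<le> (sqrt c)\<^sup>2" by (intro power_mono) auto
  then show ?thesis by (simp add: c_def)
qed

lemma closed_self_adjoint_multipliers: "closed (self_adjoint_multipliers :: ('a::comm_cstar_algebra \<Rightarrow>\<^sub>L 'a) set)"
  unfolding self_adjoint_multipliers_def
  by (intro closed_Collect_conj closed_Collect_all closed_Collect_eq continuous_intros
      bounded_linear.continuous_on[OF bounded_linear_star])

lemma real_commutative_cstar_multipliers:
  "real_commutative_cstar (self_adjoint_multipliers :: ('a::comm_cstar_algebra \<Rightarrow>\<^sub>L 'a) set)"
  by standard
    (simp_all only: closed_self_adjoint_multipliers multipliers_commute norm_multiplier_sum_squares,
     auto simp: self_adjoint_multipliers_def blinfun.add_left blinfun.scaleR_left distrib_right star_add star_scaleR)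

text \<open>
  Multiplication operators embed the self-adjoint elements isometrically, and their image is a
  subalgebra of the self-adjoint multipliers, in general without unit.
\<close>

lemma cube_spanned_self_adjoint: "cube_spanned {x :: 'a::comm_cstar_algebra. star x = x}"
proof (rule cube_spanned_isometry)
  let ?L = "blinfun_mult_right :: 'a \<Rightarrow> 'a \<Rightarrow>\<^sub>L 'a"
  let ?J = "?L ` {x. star x = x}"
  interpret L: bounded_linear ?L by (rule bounded_linear_blinfun_mult_right)
  show "linear ?L" by (rule L.linear_axioms)
  show "norm (?L x) = norm x" if "x \<in> {x. star x = x}" for x
  proof (rule antisym)
    show "norm (?L x) \<le> norm x"
      by (rule norm_blinfun_bound) (auto simp: norm_mult_ineq)
    have "norm x * norm x = norm (?L x x)" using cstar_identity[of x] that by (simp add: power2_eq_square)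
    also have "\<dots> \<le> norm (?L x) * norm x" by (rule norm_blinfun)
    finally show "norm x \<le> norm (?L x)" by (cases "x = 0") auto
  qed
  interpret real_commutative_cstar "self_adjoint_multipliers :: ('a \<Rightarrow>\<^sub>L 'a) set"
    by (rule real_commutative_cstar_multipliers)
  show "cube_spanned ?J"
  proof (rule cube_spanned_subalgebra)
    show "?J \<subseteq> self_adjoint_multipliers"
    proof
      fix T assume "T \<in> ?J"
      then obtain x where x: "star x = x" "T = ?L x" by auto
      then show "T \<in> self_adjoint_multipliers"
        using star_mult[of _ x] by (simp add: self_adjoint_multipliers_def star_mult mult_ac)
    qed
    show "0 \<in> ?J" using L.zero star_zero by force
    fix u v assume "u \<in> ?J" "v \<in> ?J"
    then obtain x y where xy: "star x = x" "u = ?L x" "star y = y" "v = ?L y" by auto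
    have "u + v = ?L (x + y)" "star (x + y) = x + y" using xy by (simp_all add: L.add star_add)
    then show "u + v \<in> ?J" by blast
    have "u \<cdot> v = ?L (x * y)" using xy by (intro blinfun_eqI) (simp add: mult.assoc)
    moreover have "star (x * y) = x * y" using xy by (simp add: star_mult mult.commute)
    ultimately show "u \<cdot> v \<in> ?J" by blast
  next
    fix r u assume "u \<in> ?J"
    then obtain x where x: "star x = x" "u = ?L x" by auto
    have "r *\<^sub>R u = ?L (r *\<^sub>R x)" "star (r *\<^sub>R x) = r *\<^sub>R x" using x by (simp_all add: L.scaleR star_scaleR)
    then show "r *\<^sub>R u \<in> ?J" by blast
  qed
qed (auto simp: star_zero star_add star_scaleR)

lemma i_half_minus_i: "\<i> *\<^sub>C ((1/2) *\<^sub>R ((- \<i>) *\<^sub>C z)) = (1/2) *\<^sub>R (z :: 'a::complex_normed_space)"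
  by (simp add: scaleR_eq_scaleC scaleC_scaleC)

lemma unitarily_representable_cdual:
  "unitarily_representable (additive_group UNIV (cdual :: ('a::comm_cstar_algebra \<Rightarrow> complex) set))
     (tau_k UNIV (cdual :: ('a \<Rightarrow> complex) set))"
proof -
  interpret bounded_functionals UNIV "cdual :: ('a \<Rightarrow> complex) set"
  proof
    fix \<phi> \<psi> :: "'a \<Rightarrow> complex" assume \<phi>: "\<phi> \<in> cdual"
    then obtain B where B: "\<And>x. cmod (\<phi> x) \<le> B * norm x" by (auto simp: cdual_def)
    then show "\<exists>B. \<forall>x\<in>UNIV. cmod (\<phi> x) \<le> B * norm x" by blast
    show "(\<lambda>x\<in>UNIV. - \<phi> x) \<in> cdual"
      using \<phi> by (auto simp: cdual_def clinear_on_def)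
    assume \<psi>: "\<psi> \<in> cdual"
    then obtain C where C: "\<And>x. cmod (\<psi> x) \<le> C * norm x" by (auto simp: cdual_def)
    have "cmod (\<phi> x + \<psi> x) \<le> (B + C) * norm x" for x
      using norm_triangle_ineq[of "\<phi> x" "\<psi> x"] B[of x] C[of x] by (simp add: distrib_right)
    then have "\<exists>B. \<forall>x. cmod (\<phi> x + \<psi> x) \<le> B * norm x" by blast
    then show "(\<lambda>x\<in>UNIV. \<phi> x + \<psi> x) \<in> cdual"
      using \<phi> \<psi> by (auto simp: cdual_def clinear_on_def algebra_simps)
  qed (auto simp: cdual_def clinear_on_def intro: exI[of _ 0])
  define re where "re x = (1/2) *\<^sub>R (x + star x)" for x :: 'a
  define im where "im x = (1/2) *\<^sub>R ((- \<i>) *\<^sub>C (x - star x))" for x :: 'a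
  show ?thesis
  proof (rule unitarily_representable_tau_k)
    show "cube_spanned {x :: 'a. star x = x}" by (rule cube_spanned_self_adjoint)
    show "continuous_on UNIV re" "continuous_on UNIV im"
      unfolding re_def im_def
      by (intro continuous_intros bounded_linear.continuous_on[OF bounded_linear_star]
          bounded_linear.continuous_on[OF bounded_linear_scaleC])+
    fix x :: 'a
    show "re x \<in> {x. star x = x}"
      by (simp add: re_def star_scaleR star_add star_star add.commute)
    show "im x \<in> {x. star x = x}"
      by (simp add: im_def star_scaleR star_scaleC star_diff star_star scaleC_minus_left scaleC_diff_right)
    show "x = re x + \<i> *\<^sub>C im x"
      unfolding im_def i_half_minus_i re_def by (simp add: scaleR_2 flip: scaleR_add_right)
  qed (auto simp: star_zero star_add star_scaleR)
qed

section \<open>Commutative von Neumann algebras\<close>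

lemma Re_cinner_le: "Re (cinner x y) \<le> norm x * norm (y :: 'h::chilbert_space)"
  using complex_inner_space.Re_vinner_le[OF complex_hilbert_space.axioms(1)[OF complex_hilbert_space_UNIV], of x y]
  by (simp add: cinner_self)

lemma cmod_cinner_le: "cmod (cinner x y) \<le> norm x * norm (y :: 'h::chilbert_space)"
proof (cases "cinner x y = 0")
  case False
  let ?w = "cinner x y"
  let ?a = "cnj ?w / of_real (cmod ?w)"
  have "cinner (?a *\<^sub>C x) y = of_real (cmod ?w)"
    using False by (simp add: cinner_scaleC_left complex_norm_square[symmetric] power2_eq_square
        mult.commute[of "cnj _"])
  then have "cmod ?w \<le> cmod ?a * norm x * norm y"
    using Re_cinner_le[of "?a *\<^sub>C x" y] by (simp add: norm_scaleC)
  then show ?thesis using False by (simp add: norm_divide)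
qed simp

lemma cinner_add_right: "cinner x (y + z) = cinner x y + cinner x (z :: 'h::chilbert_space)"
  by (subst (1 2 3) cinner_commute) (simp add: cinner_add_left)

lemma cinner_scaleC_right: "cinner x (a *\<^sub>C y) = cnj a * cinner x (y :: 'h::chilbert_space)"
  by (subst (1 2) cinner_commute) (simp add: cinner_scaleC_left)

lemma bounded_bilinear_cinner: "bounded_bilinear (cinner :: 'h::chilbert_space \<Rightarrow> 'h \<Rightarrow> complex)"
proof
  show "\<exists>K. \<forall>a b :: 'h. norm (cinner a b) \<le> norm a * norm b * K"
    by (intro exI[of _ 1] allI) (simp add: cmod_cinner_le)
qed (simp_all add: cinner_add_left cinner_add_right cinner_scaleC_left cinner_scaleC_right scaleR_eq_scaleC[where 'a = 'h] scaleR_conv_of_real)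

interpretation cinner: bounded_bilinear "cinner :: 'h::chilbert_space \<Rightarrow> 'h \<Rightarrow> complex"
  by (rule bounded_bilinear_cinner)

lemma is_adjoint_sym: assumes "is_adjoint S T" shows "is_adjoint T S"
  unfolding is_adjoint_def
proof (intro allI)
  fix x y
  have "cinner (S x) y = cnj (cinner y (S x))" by (rule cinner_commute)
  also have "\<dots> = cnj (cinner (T y) x)" using assms by (simp add: is_adjoint_def)
  also have "\<dots> = cinner x (T y)" by (rule cinner_commute[symmetric])
  finally show "cinner (S x) y = cinner x (T y)" .
qed

lemma is_adjoint_add: "is_adjoint S T \<Longrightarrow> is_adjoint S' T' \<Longrightarrow> is_adjoint (S + S') (T + T')"
  by (simp add: is_adjoint_def blinfun.add_left cinner.add_left cinner.add_right)

lemma is_adjoint_diff: "is_adjoint S T \<Longrightarrow> is_adjoint S' T' \<Longrightarrow> is_adjoint (S - S') (T - T')"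
  by (simp add: is_adjoint_def blinfun.diff_left cinner.diff_left cinner.diff_right)

lemma is_adjoint_scaleC: "is_adjoint S T \<Longrightarrow> is_adjoint (cnj c *\<^sub>C S) (c *\<^sub>C T)"
  by (simp add: is_adjoint_def scaleC_blinfun.rep_eq cinner_scaleC_left cinner_scaleC_right)

lemma is_adjoint_scaleR: "is_adjoint S T \<Longrightarrow> is_adjoint (r *\<^sub>R S) (r *\<^sub>R T)"
  by (simp add: is_adjoint_def blinfun.scaleR_left cinner.scaleR_left cinner.scaleR_right)

text \<open>
  As \<open>\<parallel>S y\<parallel>\<^sup>2 = \<langle>T (S y), y\<rangle>\<close>, the Cauchy-Schwarz inequality bounds \<open>S\<close>. Applied to differences, this makes
  taking adjoints continuous.
\<close>

lemma norm_adjoint_le: assumes "is_adjoint S T" shows "norm S \<le> norm T"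
proof (rule norm_blinfun_bound)
  fix y
  have "complex_of_real ((norm (S y))\<^sup>2) = cinner (T (S y)) y"
    using assms by (simp add: is_adjoint_def cinner_self)
  then have "(norm (S y))\<^sup>2 = Re (cinner (T (S y)) y)" by (metis Re_complex_of_real)
  also have "\<dots> \<le> norm (T (S y)) * norm y" by (rule Re_cinner_le)
  also have "\<dots> \<le> norm T * norm (S y) * norm y" by (intro mult_right_mono norm_blinfun) simp
  finally have "norm (S y) * norm (S y) \<le> (norm T * norm y) * norm (S y)"
    by (simp add: power2_eq_square mult_ac)
  then show "norm (S y) \<le> norm T * norm y" by (cases "S y = 0") auto
qed simp

text \<open>
  By the Cauchy-Schwarz inequality the series is dominated by
  \<open>\<parallel>T\<parallel> \<parallel>\<xi> n\<parallel> \<parallel>\<eta> n\<parallel> \<le> \<parallel>T\<parallel> (\<parallel>\<xi> n\<parallel>\<^sup>2 + \<parallel>\<eta> n\<parallel>\<^sup>2)\<close>.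
\<close>

lemma ultraweak_functional_bounded_linear:
  assumes "\<xi> \<in> square_summable" "\<eta> \<in> square_summable"
  shows "bounded_linear (\<lambda>T :: 'h::chilbert_space \<Rightarrow>\<^sub>L 'h. \<Sum>n. cinner (T (\<xi> n)) (\<eta> n))"
proof -
  have summable: "summable (\<lambda>n. norm (\<xi> n) * norm (\<eta> n))"
  proof (rule summable_comparison_test')
    show "summable (\<lambda>n. (norm (\<xi> n))\<^sup>2 + (norm (\<eta> n))\<^sup>2)"
      using assms by (intro summable_add) (auto simp: square_summable_def)
    show "norm (norm (\<xi> n) * norm (\<eta> n)) \<le> (norm (\<xi> n))\<^sup>2 + (norm (\<eta> n))\<^sup>2" if "n \<ge> 0" for n
    proof -
      have "2 * (norm (\<xi> n) * norm (\<eta> n)) \<le> (norm (\<xi> n))\<^sup>2 + (norm (\<eta> n))\<^sup>2"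
        using sum_squares_bound[of "norm (\<xi> n)" "norm (\<eta> n)"] by (simp add: mult.assoc)
      moreover have "0 \<le> norm (\<xi> n) * norm (\<eta> n)" by simp
      ultimately show ?thesis unfolding real_norm_def by linarith
    qed
  qed
  have le: "norm (cinner (T (\<xi> n)) (\<eta> n)) \<le> norm T * (norm (\<xi> n) * norm (\<eta> n))" for T :: "'h \<Rightarrow>\<^sub>L 'h" and n
  proof -
    have "norm (cinner (T (\<xi> n)) (\<eta> n)) \<le> norm (T (\<xi> n)) * norm (\<eta> n)" by (rule cmod_cinner_le)
    also have "\<dots> \<le> norm T * norm (\<xi> n) * norm (\<eta> n)" by (intro mult_right_mono norm_blinfun) simp
    finally show ?thesis by (simp add: mult.assoc)
  qed
  have norm_summable: "summable (\<lambda>n. norm (cinner (T (\<xi> n)) (\<eta> n)))" for T :: "'h \<Rightarrow>\<^sub>L 'h"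
    by (rule summable_comparison_test'[OF summable_mult[OF summable, of "norm T"], of 0]) (use le in simp)
  note s = summable_norm_cancel[OF norm_summable]
  show ?thesis
  proof (rule bounded_linear_intro[of _ "\<Sum>n. norm (\<xi> n) * norm (\<eta> n)"])
    fix S T :: "'h \<Rightarrow>\<^sub>L 'h" and r
    show "(\<Sum>n. cinner ((S + T) (\<xi> n)) (\<eta> n)) = (\<Sum>n. cinner (S (\<xi> n)) (\<eta> n)) + (\<Sum>n. cinner (T (\<xi> n)) (\<eta> n))"
      using s by (simp add: blinfun.add_left cinner.add_left suminf_add)
    show "(\<Sum>n. cinner ((r *\<^sub>R T) (\<xi> n)) (\<eta> n)) = r *\<^sub>R (\<Sum>n. cinner (T (\<xi> n)) (\<eta> n))"
      using s by (simp add: blinfun.scaleR_left cinner.scaleR_left suminf_scaleR_right)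
    have "norm (\<Sum>n. cinner (T (\<xi> n)) (\<eta> n)) \<le> (\<Sum>n. norm (cinner (T (\<xi> n)) (\<eta> n)))"
      by (rule summable_norm[OF norm_summable])
    also have "\<dots> \<le> (\<Sum>n. norm T * (norm (\<xi> n) * norm (\<eta> n)))"
      by (intro suminf_le le norm_summable summable_mult summable)
    also have "\<dots> = norm T * (\<Sum>n. norm (\<xi> n) * norm (\<eta> n))" by (rule suminf_mult[OF summable])
    finally show "norm (\<Sum>n. cinner (T (\<xi> n)) (\<eta> n)) \<le> norm T * (\<Sum>n. norm (\<xi> n) * norm (\<eta> n))" .
  qed
qed

lemma ultraweak_weaker_than_norm: "continuous_map euclidean ultraweak_topology (\<lambda>T :: 'h::chilbert_space \<Rightarrow>\<^sub>L 'h. T)"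
  unfolding ultraweak_topology_def
proof (rule continuous_map_pullback')
  show "continuous_map euclidean (product_topology (\<lambda>_. euclidean) (square_summable \<times> square_summable))
    ((\<lambda>T :: 'h \<Rightarrow>\<^sub>L 'h. \<lambda>(\<xi>, \<eta>)\<in>square_summable \<times> square_summable. \<Sum>n. cinner (T (\<xi> n)) (\<eta> n)) \<circ> (\<lambda>T. T))"
    unfolding continuous_map_componentwise
  proof (intro conjI ballI)
    fix p :: "(nat \<Rightarrow> 'h) \<times> (nat \<Rightarrow> 'h)" assume "p \<in> square_summable \<times> square_summable"
    then obtain \<xi> \<eta> where p: "p = (\<xi>, \<eta>)" "\<xi> \<in> square_summable" "\<eta> \<in> square_summable" by auto
    show "continuous_map euclidean euclidean (\<lambda>T :: 'h \<Rightarrow>\<^sub>L 'h. ((\<lambda>T :: 'h \<Rightarrow>\<^sub>L 'h. \<lambda>(\<xi>, \<eta>)\<in>square_summable \<times> square_summable.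
        \<Sum>n. cinner (T (\<xi> n)) (\<eta> n)) \<circ> (\<lambda>T. T)) T p)"
      using linear_continuous_on[OF ultraweak_functional_bounded_linear[OF p(2,3)], of UNIV] p by simp
  qed auto
qed simp

text \<open>
  An ultraweakly continuous functional is continuous in norm, since the ultraweak topology is the
  coarser one, and hence bounded.
\<close>

lemma predual_bounded:
  assumes M: "0 \<in> M" "\<And>c T. T \<in> M \<Longrightarrow> c *\<^sub>C T \<in> M" and \<phi>: "\<phi> \<in> predual M"
  shows "\<exists>B. \<forall>T\<in>M. cmod (\<phi> T) \<le> B * norm T"
proof -
  have lin: "clinear_on M \<phi>" and c: "continuous_map (subtopology ultraweak_topology M) euclidean \<phi>"
    using \<phi> by (auto simp: predual_def)
  have "continuous_map (top_of_set M) (subtopology ultraweak_topology M) (\<lambda>T. T)"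
    using ultraweak_weaker_than_norm
    by (intro continuous_map_into_subtopology continuous_map_from_subtopology) auto
  from continuous_map_compose[OF this c] have "continuous_on M \<phi>" by (simp add: comp_def)
  moreover have scale: "\<phi> (r *\<^sub>R T) = of_real r * \<phi> T" if "T \<in> M" for r T
    using lin that by (simp add: clinear_on_def scaleR_eq_scaleC)
  moreover have \<phi>0: "\<phi> 0 = 0" using scale[OF M(1), of 0] by simp
  ultimately obtain d where d: "d > 0" "\<And>T. T \<in> M \<Longrightarrow> norm T < d \<Longrightarrow> cmod (\<phi> T) < 1"
    using M(1) unfolding continuous_on_iff by (metis dist_0_norm dist_commute zero_less_one)
  have "cmod (\<phi> T) \<le> (2 / d) * norm T" if T: "T \<in> M" for T
  proof (cases "T = 0")
    case False
    let ?r = "d / (2 * norm T)"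
    have "?r *\<^sub>R T \<in> M" using M(2)[OF T] by (simp add: scaleR_eq_scaleC)
    moreover have "norm (?r *\<^sub>R T) < d" using False d(1) by simp
    ultimately have "cmod (\<phi> (?r *\<^sub>R T)) < 1" by (rule d(2))
    then have "?r * cmod (\<phi> T) < 1" using scale[OF T, of ?r] d(1) by (simp add: norm_mult norm_divide)
    then show ?thesis using False d(1) by (simp add: field_simps)
  qed (simp add: \<phi>0)
  then show ?thesis by blast
qed

text \<open>
  For self-adjoint \<open>u\<close>, \<open>v\<close> one has \<open>\<parallel>u x\<parallel>\<^sup>2 + \<parallel>v x\<parallel>\<^sup>2 = \<langle>x, (u\<^sup>2 + v\<^sup>2) x\<rangle>\<close>, which gives the inequality for sums
  of squares. Closedness in norm follows from closedness in the strong operator topology.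
\<close>

lemma real_commutative_cstar_self_adjoint:
  assumes M: "von_neumann_algebra M" "commutative_operators M"
  shows "real_commutative_cstar {T \<in> M. is_adjoint T T}"
proof
  let ?R = "{T \<in> M. is_adjoint T T}"
  have scaleR: "r *\<^sub>R T \<in> M" if "T \<in> M" for r T
    using M that by (simp add: von_neumann_algebra_def scaleR_eq_scaleC)
  fix u v assume u: "u \<in> ?R" and v: "v \<in> ?R"
  show "u + v \<in> ?R" using M u v by (auto simp: von_neumann_algebra_def is_adjoint_add)
  show "r *\<^sub>R u \<in> ?R" for r using u scaleR by (simp add: is_adjoint_scaleR)
  show com: "u \<cdot> v = v \<cdot> u" using M u v by (auto simp: commutative_operators_def)
  have "is_adjoint (u \<cdot> v) (u \<cdot> v)"
    unfolding is_adjoint_def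
  proof (intro allI)
    fix x y
    have "cinner ((u \<cdot> v) x) y = cinner x (v (u y))" using u v by (simp add: is_adjoint_def)
    also have "v (u y) = (u \<cdot> v) y" unfolding com by simp
    finally show "cinner ((u \<cdot> v) x) y = cinner x ((u \<cdot> v) y)" .
  qed
  then show "u \<cdot> v \<in> ?R" using M u v by (simp add: von_neumann_algebra_def)
  show "(norm u)\<^sup>2 \<le> norm (u \<cdot> u + v \<cdot> v)"
  proof -
    let ?c = "norm (u \<cdot> u + v \<cdot> v)"
    have "norm u \<le> sqrt ?c"
    proof (rule norm_blinfun_bound)
      fix x
      have sq: "cinner x (w (w x)) = complex_of_real ((norm (w x))\<^sup>2)" if "w \<in> ?R" for w
        using that cinner_self[of "w x"] by (simp add: is_adjoint_def)
      have "complex_of_real ((norm (u x))\<^sup>2 + (norm (v x))\<^sup>2) = cinner x ((u \<cdot> u + v \<cdot> v) x)"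
        using sq[OF u] sq[OF v] by (simp add: blinfun.add_left cinner.add_right)
      then have "(norm (u x))\<^sup>2 + (norm (v x))\<^sup>2 = Re (cinner x ((u \<cdot> u + v \<cdot> v) x))"
        by (metis Re_complex_of_real)
      also have "\<dots> \<le> norm x * norm ((u \<cdot> u + v \<cdot> v) x)" by (rule Re_cinner_le)
      also have "\<dots> \<le> norm x * (?c * norm x)" by (intro mult_left_mono norm_blinfun) simp
      also have "\<dots> = (sqrt ?c * norm x)\<^sup>2" by (simp add: power_mult_distrib power2_eq_square)
      finally have "(norm (u x))\<^sup>2 \<le> (sqrt ?c * norm x)\<^sup>2"
        using zero_le_power2[of "norm (v x)"] by linarith
      then show "norm (u x) \<le> sqrt ?c * norm x" by (rule power2_le_imp_le) simp
    qed simp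
    then have "(norm u)\<^sup>2 \<le> (sqrt ?c)\<^sup>2" by (intro power_mono) auto
    then show ?thesis by simp
  qed
next
  show "id_blinfun \<in> {T \<in> M. is_adjoint T T}"
    using M by (simp add: von_neumann_algebra_def is_adjoint_def)
next
  have "closedin strong_operator_topology M" using M by (simp add: von_neumann_algebra_def)
  then have "closed M"
    using closedin_continuous_map_preimage[OF strong_operator_topology_weaker_than_euclidean] by fastforce
  moreover have "closed {T :: 'a \<Rightarrow>\<^sub>L 'a. is_adjoint T T}"
    unfolding is_adjoint_def
    by (intro closed_Collect_all closed_Collect_eq cinner.continuous_on continuous_intros)
  ultimately show "closed {T \<in> M. is_adjoint T T}"
    using closed_Int[of M "{T. is_adjoint T T}"] by (simp add: Int_def)
qed

lemma unitarily_representable_predual: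
  fixes M :: "('h::chilbert_space \<Rightarrow>\<^sub>L 'h) set"
  assumes M: "von_neumann_algebra M" "commutative_operators M"
  shows "unitarily_representable (additive_group M (predual M)) (tau_k M (predual M))"
proof -
  have add: "S + T \<in> M" if "S \<in> M" "T \<in> M" for S T using M that by (simp add: von_neumann_algebra_def)
  have scaleC: "c *\<^sub>C T \<in> M" if "T \<in> M" for c T using M that by (simp add: von_neumann_algebra_def)
  have scaleR: "r *\<^sub>R T \<in> M" if "T \<in> M" for r T using scaleC[OF that] by (simp add: scaleR_eq_scaleC)
  have zero: "0 \<in> M"
    using scaleR[of id_blinfun 0] M by (simp add: von_neumann_algebra_def)
  have diff: "S - T \<in> M" if "S \<in> M" "T \<in> M" for S T using add[OF that(1) scaleR[OF that(2), of "-1"]] by simp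
  interpret bounded_functionals M "predual M"
  proof
    show "0 \<in> M" by (rule zero)
    show "x + y \<in> M" if "x \<in> M" "y \<in> M" for x y by (rule add[OF that])
    show "c *\<^sub>C x \<in> M" if "x \<in> M" for c x by (rule scaleC[OF that])
    show "(\<lambda>x\<in>M. 0) \<in> predual M"
      using add scaleC by (auto simp: predual_def clinear_on_def intro: continuous_map_eq[of _ _ "\<lambda>_. 0"])
    fix \<phi> assume \<phi>: "\<phi> \<in> predual M"
    show "\<phi> \<in> extensional M" "clinear_on M \<phi>" using \<phi> by (auto simp: predual_def)
    show "\<exists>B. \<forall>x\<in>M. cmod (\<phi> x) \<le> B * norm x" by (rule predual_bounded[OF zero scaleC \<phi>])
    have "continuous_map (subtopology ultraweak_topology M) euclidean (\<lambda>x. - \<phi> x)"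
      using \<phi> by (intro continuous_map_minus) (auto simp: predual_def)
    then have "continuous_map (subtopology ultraweak_topology M) euclidean (\<lambda>x\<in>M. - \<phi> x)"
      by (rule continuous_map_eq) auto
    then show "(\<lambda>x\<in>M. - \<phi> x) \<in> predual M"
      using \<phi> add scaleC by (auto simp: predual_def clinear_on_def)
    fix \<psi> assume \<psi>: "\<psi> \<in> predual M"
    have "continuous_map (subtopology ultraweak_topology M) euclidean (\<lambda>x. \<phi> x + \<psi> x)"
      using \<phi> \<psi> by (intro continuous_map_add) (auto simp: predual_def)
    then have "continuous_map (subtopology ultraweak_topology M) euclidean (\<lambda>x\<in>M. \<phi> x + \<psi> x)"
      by (rule continuous_map_eq) auto
    then show "(\<lambda>x\<in>M. \<phi> x + \<psi> x) \<in> predual M"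
      using \<phi> \<psi> add scaleC by (auto simp: predual_def clinear_on_def algebra_simps)
  qed
  define adj where "adj T = (SOME S. S \<in> M \<and> is_adjoint S T)" for T
  have adj: "adj T \<in> M \<and> is_adjoint (adj T) T" if "T \<in> M" for T
    unfolding adj_def by (rule someI_ex) (use M that in \<open>auto simp: von_neumann_algebra_def\<close>)
  have "dist (adj S) (adj T) \<le> 1 * dist S T" if "S \<in> M" "T \<in> M" for S T
    unfolding dist_norm using norm_adjoint_le[OF is_adjoint_diff[of "adj S" S "adj T" T]] adj that by simp
  then have "1-lipschitz_on M adj" by (intro lipschitz_onI) auto
  then have cont: "continuous_on M adj" by (rule lipschitz_on_continuous_on)
  define re where "re T = (1/2) *\<^sub>R (T + adj T)" for T
  define im where "im T = (1/2) *\<^sub>R ((- \<i>) *\<^sub>C (T - adj T))" for T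
  interpret R: real_commutative_cstar "{T \<in> M. is_adjoint T T}"
    by (rule real_commutative_cstar_self_adjoint[OF M])
  show ?thesis
  proof (rule unitarily_representable_tau_k)
    show "cube_spanned {T \<in> M. is_adjoint T T}"
      by (rule R.cube_spanned_subalgebra[OF order_refl R.zero R.add R.scaleR R.mult])
    show "{T \<in> M. is_adjoint T T} \<subseteq> M" by blast
    show "0 \<in> {T \<in> M. is_adjoint T T}" by (rule R.zero)
    show "x + y \<in> {T \<in> M. is_adjoint T T}" if "x \<in> {T \<in> M. is_adjoint T T}" "y \<in> {T \<in> M. is_adjoint T T}" for x y
      by (rule R.add[OF that])
    show "r *\<^sub>R x \<in> {T \<in> M. is_adjoint T T}" if "x \<in> {T \<in> M. is_adjoint T T}" for r x
      by (rule R.scaleR[OF that])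
    show "continuous_on M re" "continuous_on M im"
      unfolding re_def im_def
      by (intro continuous_intros cont bounded_linear.continuous_on[OF bounded_linear_scaleC])+
    fix T assume T: "T \<in> M"
    have a: "adj T \<in> M" "is_adjoint (adj T) T" using adj[OF T] by auto
    note a' = is_adjoint_sym[OF a(2)]
    have "is_adjoint (T + adj T) (T + adj T)"
      using is_adjoint_add[OF a(2) a'] by (simp add: add.commute)
    then show "re T \<in> {T \<in> M. is_adjoint T T}"
      unfolding re_def using is_adjoint_scaleR scaleR add T a by simp
    have "is_adjoint (cnj (- \<i>) *\<^sub>C (adj T - T)) ((- \<i>) *\<^sub>C (T - adj T))"
      by (intro is_adjoint_scaleC is_adjoint_diff a a')
    moreover have "cnj (- \<i>) *\<^sub>C (adj T - T) = (- \<i>) *\<^sub>C (T - adj T)"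
      by (simp add: scaleC_minus_left scaleC_diff_right)
    ultimately have "is_adjoint ((- \<i>) *\<^sub>C (T - adj T)) ((- \<i>) *\<^sub>C (T - adj T))" by simp
    then show "im T \<in> {T \<in> M. is_adjoint T T}"
      unfolding im_def using is_adjoint_scaleR scaleR[OF scaleC[OF diff[OF T]]] a by simp
    show "T = re T + \<i> *\<^sub>C im T"
      unfolding im_def i_half_minus_i re_def by (simp add: scaleR_2 flip: scaleR_add_right)
  qed
qed

theorem corollary3p5:
  fixes M :: "('h::chilbert_space \<Rightarrow>\<^sub>L 'h) set"
  assumes "von_neumann_algebra M" and "commutative_operators M"
  shows "unitarily_representable
           (additive_group UNIV (cdual :: ('a::comm_cstar_algebra \<Rightarrow> complex) set))
           (tau_k UNIV (cdual :: ('a \<Rightarrow> complex) set)) \<and>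
         unitarily_representable (additive_group M (predual M)) (tau_k M (predual M))"
  using unitarily_representable_cdual unitarily_representable_predual[OF assms] by blast

end
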